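(* Let $\mathcal{P}$ be a homogeneous Poisson process of intensity $1$ on $\mathbb{R}$, let $\mu$ be a degree distribution (a probability measure on the strictly positive integers), and consider the random direction stable multi-matching. (i) If $\mu(\{2\})=1$, then almost surely there is no infinite component. (ii) If $\mu$ has bounded support, then $\mathbb{E}^*[X^{1/2}]=\infty$, where $X$ is the average length of all edges incident to the origin under the Palm version of the process.
   Context: Setting. Write $[\mathcal{P}]=\{x\in\mathbb{R}:\mathcal{P}(\{x\})>0\}$ for the point-set of $\mathcal{P}$. Conditionally on $\mathcal{P}$, the points $x\in[\mathcal{P}]$ carry i.i.d. marks $D_x$ with law $\mu$ ($D_x$ is the number of stubs, i.e. half-edges, at $x$); the resulting marked point process is denoted $(\mathcal{P},\xi)$ with $\xi(\{x\})=D_x$. Matching scheme. A matching scheme for $(\mathcal{P},\xi)$ is a point process $\mathcal{M}$ on the space of unordered pairs of points of $\mathbb{R}$ such that almost surely every pair $(x,y)\in[\mathcal{M}]$ has $x,y\in[\mathcal{P}]$, and in the graph $G$ with vertex set $[\mathcal{P}]$ and edge set $[\mathcal{M}]$ each vertex $x$ has degree exactly $D_x$. All matching schemes are assumed simple (almost surely $G$ has no self-loops and no multiple edges) and translation-invariant ($\mathcal{M}$ is invariant in law under all translations of $\mathbb{R}$). "Component" means connected component of $G$; it is infinite if it has infinitely many vertices. The length of an edge $(x,y)$ is $|x-y|$. Random direction stable multi-matching. Conditionally on $(\mathcal{P},\xi)$, give each $x\in[\mathcal{P}]$ independently an integer mark $R_x\sim\mathrm{Binomial}(D_x,1/2)$.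 If $x<y$ and $(x,y)$ is an edge, it is called a right-edge of $x$ and a left-edge of $y$. A matching scheme is a random direction stable multi-matching if each $x\in[\mathcal{P}]$ has exactly $R_x$ incident right-edges and a.s., for any $x<y$ in $[\mathcal{P}]$, either $x,y$ are linked by an edge, or $x$ has no incident right-edge longer than $|x-y|$, or $y$ has no incident left-edge longer than $|x-y|$. Such a matching exists and is a.s. unique given the marked process. Palm version. $\mathbb{P}^*$ and $\mathbb{E}^*$ denote probability and expectation for the Palm version $(\mathcal{P}^*,\xi^*,\mathcal{M}^* )$ of $(\mathcal{P},\xi,\mathcal{M})$ with respect to $\mathcal{P}$ (informally, the law conditioned on there being a point at $0$). For $x\in[\mathcal{P}]$, $X_x$ is the average length of all edges incident to $x$, and $X=X_0$ in the Palm version; equivalently, since the intensity is $1$, $\mathbb{P}^*(X\in B)=\mathbb{E}\,\#\{x\in[\mathcal{P}]\cap[0,1):X_x\in B\}$ for Borel $B$. *)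

theory Defs
  imports "HOL-Probability.Probability" "HOL-Library.Uprod"
begin

text \<open>
  Every point process below is simple (a homogeneous Poisson process has almost surely no multiple
  points, and matching schemes are simple by convention). A simple point process on a measurable
  space \<open>N\<close> is represented by the random set of its points, i.e. by a measurable map into
  \<open>config_algebra N\<close>, whose sigma-algebra is the one generated by the counting maps
  \<open>S \<mapsto> #(S \<inter> A)\<close> for measurable \<open>A\<close>. Thus the value of the process \<open>P\<close> at \<open>\<omega>\<close> is
  the point set \<open>[P]\<close>.
\<close>

definition npts :: "'b set \<Rightarrow> 'b set \<Rightarrow> ennreal" where
  "npts S A = emeasure (count_space UNIV) (S \<inter> A)"

definition config_algebra :: "'b measure \<Rightarrow> 'b set measure" where
  "config_algebra N = sigma (Pow (space N))
     {{S \<in> Pow (space N). npts S A \<in> B} | A B. A \<in> sets N \<and> B \<in> sets borel}"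

text \<open>The weights are written out because \<open>poisson_pmf\<close> is unspecified for rate \<open>0\<close>, i.e. for null sets.\<close>

definition poisson_process :: "'w measure \<Rightarrow> real \<Rightarrow> ('w \<Rightarrow> real set) \<Rightarrow> bool" where
  "poisson_process M l P \<longleftrightarrow>
     P \<in> M \<rightarrow>\<^sub>M config_algebra borel \<and>
     (\<forall>A\<in>sets borel. bounded A \<longrightarrow> (\<forall>k::nat.
        measure M {w \<in> space M. npts (P w) A = of_nat k} =
          (l * measure lborel A) ^ k / fact k * exp (- (l * measure lborel A)))) \<and>
     (\<forall>A :: nat \<Rightarrow> real set. (\<forall>i. A i \<in> sets borel \<and> bounded (A i)) \<longrightarrow> disjoint_family A \<longrightarrow>
        prob_space.indep_vars M (\<lambda>_. borel) (\<lambda>i w. npts (P w) (A i)) UNIV)"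

definition marked_points :: "('w \<Rightarrow> real set) \<Rightarrow> ('w \<Rightarrow> real \<Rightarrow> nat) \<Rightarrow> 'w \<Rightarrow> (real \<times> nat) set" where
  "marked_points P Y w = (\<lambda>x. (x, Y w x)) ` P w"

definition marked_algebra :: "(real \<times> nat) set measure" where
  "marked_algebra = config_algebra (borel \<Otimes>\<^sub>M count_space UNIV)"

text \<open>
  Conditionally on the sigma-algebra \<open>F\<close> (with respect to which \<open>P\<close> is measurable), the marks
  \<open>Y w x\<close> of the points \<open>x \<in> P w\<close> are independent, and the mark of \<open>x\<close> has the (possibly
  random) law \<open>K w x\<close>. As usual, the points are listed by an \<open>F\<close>-measurable enumeration \<open>X\<close>;
  values of \<open>Y w\<close> outside \<open>P w\<close> are irrelevant.
\<close>

definition cond_indep_marks ::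
  "'w measure \<Rightarrow> 'w measure \<Rightarrow> ('w \<Rightarrow> real set) \<Rightarrow> ('w \<Rightarrow> real \<Rightarrow> nat) \<Rightarrow> ('w \<Rightarrow> real \<Rightarrow> nat pmf) \<Rightarrow> bool"
where
  "cond_indep_marks M F P Y K \<longleftrightarrow>
     marked_points P Y \<in> M \<rightarrow>\<^sub>M marked_algebra \<and>
     (\<exists>X :: nat \<Rightarrow> 'w \<Rightarrow> real.
        (\<forall>i. X i \<in> borel_measurable F) \<and>
        (AE w in M. bij_betw (\<lambda>i. X i w) UNIV (P w)) \<and>
        (\<forall>i. (\<lambda>w. Y w (X i w)) \<in> M \<rightarrow>\<^sub>M count_space UNIV) \<and>
        (\<forall>n. \<forall>r :: nat \<Rightarrow> nat. AE w in M.
           real_cond_exp M F (indicator {w \<in> space M. \<forall>i<n. Y w (X i w) = r i}) w =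
             (\<Prod>i<n. pmf (K w (X i w)) (r i))))"

definition degree_marks ::
  "'w measure \<Rightarrow> ('w \<Rightarrow> real set) \<Rightarrow> nat pmf \<Rightarrow> ('w \<Rightarrow> real \<Rightarrow> nat) \<Rightarrow> bool" where
  "degree_marks M P \<mu> D \<longleftrightarrow>
     cond_indep_marks M (vimage_algebra (space M) P (config_algebra borel)) P D (\<lambda>_ _. \<mu>)"

definition direction_marks ::
  "'w measure \<Rightarrow> ('w \<Rightarrow> real set) \<Rightarrow> ('w \<Rightarrow> real \<Rightarrow> nat) \<Rightarrow> ('w \<Rightarrow> real \<Rightarrow> nat) \<Rightarrow> bool" where
  "direction_marks M P D R \<longleftrightarrow>
     cond_indep_marks M (vimage_algebra (space M) (marked_points P D) marked_algebra) P R
       (\<lambda>w x. binomial_pmf (D w x) (1/2))"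

definition upair_algebra :: "real uprod measure" where
  "upair_algebra = sigma UNIV {A. {(x, y). Upair x y \<in> A} \<in> sets (borel \<Otimes>\<^sub>M borel)}"

definition shift_pts :: "real \<Rightarrow> real set \<Rightarrow> real set" where
  "shift_pts t S = (\<lambda>x. x + t) ` S"

definition shift_marked :: "real \<Rightarrow> (real \<times> nat) set \<Rightarrow> (real \<times> nat) set" where
  "shift_marked t S = (\<lambda>(x, d). (x + t, d)) ` S"

definition shift_edges :: "real \<Rightarrow> real uprod set \<Rightarrow> real uprod set" where
  "shift_edges t E = map_uprod (\<lambda>x. x + t) ` E"

definition nbrs :: "real uprod set \<Rightarrow> real \<Rightarrow> real set" where
  "nbrs E x = {y. Upair x y \<in> E}"

text \<open>
  Edges form a set, so there are no multiple edges; together with the absence of self-loops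
  this makes the degree of \<open>x\<close> the number of its neighbours.
\<close>

definition matching_scheme ::
  "'w measure \<Rightarrow> ('w \<Rightarrow> real set) \<Rightarrow> ('w \<Rightarrow> real \<Rightarrow> nat) \<Rightarrow> ('w \<Rightarrow> real uprod set) \<Rightarrow> bool" where
  "matching_scheme M P D E \<longleftrightarrow>
     E \<in> M \<rightarrow>\<^sub>M config_algebra upair_algebra \<and>
     (AE w in M.
        (\<forall>e\<in>E w. set_uprod e \<subseteq> P w) \<and>
        (\<forall>x. Upair x x \<notin> E w) \<and>
        (\<forall>x\<in>P w. finite (nbrs (E w) x) \<and> card (nbrs (E w) x) = D w x)) \<and>
     (\<forall>t. distr M (config_algebra upair_algebra) (\<lambda>w. shift_edges t (E w)) =
          distr M (config_algebra upair_algebra) E)"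

definition random_direction_stable_multimatching ::
  "'w measure \<Rightarrow> ('w \<Rightarrow> real set) \<Rightarrow> ('w \<Rightarrow> real \<Rightarrow> nat) \<Rightarrow> ('w \<Rightarrow> real \<Rightarrow> nat) \<Rightarrow>
     ('w \<Rightarrow> real uprod set) \<Rightarrow> bool"
where
  "random_direction_stable_multimatching M P D R E \<longleftrightarrow>
     matching_scheme M P D E \<and>
     direction_marks M P D R \<and>
     (AE w in M.
        (\<forall>x\<in>P w. card {y \<in> nbrs (E w) x. x < y} = R w x) \<and>
        (\<forall>x\<in>P w. \<forall>y\<in>P w. x < y \<longrightarrow>
           Upair x y \<in> E w \<or>
           \<not> (\<exists>z\<in>nbrs (E w) x. x < z \<and> \<bar>x - z\<bar> > \<bar>x - y\<bar>) \<or>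
           \<not> (\<exists>z\<in>nbrs (E w) y. z < y \<and> \<bar>z - y\<bar> > \<bar>x - y\<bar>)))"

definition component :: "real set \<Rightarrow> real uprod set \<Rightarrow> real \<Rightarrow> real set" where
  "component V E x = {y \<in> V. (x, y) \<in> {(u, v). u \<in> V \<and> v \<in> V \<and> Upair u v \<in> E}\<^sup>*}"

definition avg_edge_length :: "real uprod set \<Rightarrow> real \<Rightarrow> real" where
  "avg_edge_length E x = (\<Sum>y\<in>nbrs E x. \<bar>x - y\<bar>) / real (card (nbrs E x))"

text \<open>
  Law of the Palm version \<open>(P*, \<xi>*, M*)\<close>: the configuration is seen from a typical point of
  \<open>P\<close>, \<open>A \<mapsto> E #{x \<in> P \<inter> [0,1). \<theta>\<^sub>-\<^sub>x (P, \<xi>, M) \<in> A} / E #(P \<inter> [0,1))\<close>. The divisor is the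
  intensity of \<open>P\<close>.
\<close>

type_synonym matched_config = "real set \<times> (real \<times> nat) set \<times> real uprod set"

definition matched_algebra :: "matched_config measure" where
  "matched_algebra =
     config_algebra borel \<Otimes>\<^sub>M (marked_algebra \<Otimes>\<^sub>M config_algebra upair_algebra)"

definition shift_matched :: "real \<Rightarrow> matched_config \<Rightarrow> matched_config" where
  "shift_matched t = (\<lambda>(S, Z, E). (shift_pts t S, shift_marked t Z, shift_edges t E))"

definition palm ::
  "'w measure \<Rightarrow> ('w \<Rightarrow> real set) \<Rightarrow> ('w \<Rightarrow> real \<Rightarrow> nat) \<Rightarrow> ('w \<Rightarrow> real uprod set) \<Rightarrow>
     matched_config measure"
where
  "palm M P D E = measure_of (space matched_algebra) (sets matched_algebra)
     (\<lambda>A. (\<integral>\<^sup>+ w. npts {x \<in> P w. shift_matched (- x) (P w, marked_points P D w, E w) \<in> A} {0..<1} \<partial>M)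
          / (\<integral>\<^sup>+ w. npts (P w) {0..<1} \<partial>M))"

end

theory Submission
  imports Defs
begin

text \<open>
  \<^bold>\<open>Finite components.\<close> When all degrees are \<open>2\<close>, let a point \<open>x\<close> contribute the step
  \<open>R\<^sub>x - 1\<close>, half of the excess of its right stubs over its left stubs. An excursion is an interval
  \<open>[x, y]\<close> between two points such that this walk, started at \<open>x\<close>, stays positive until it returns to
  \<open>0\<close> at \<open>y\<close>. Its stubs balance, so as many edges leave it to the left as to the right. Stability says
  that two points which both have an edge reaching beyond the other are linked. If an edge does leave
  the excursion, this and the bound \<open>2\<close> on the degree leave a single possibility: \<open>y\<close> is matched
  to \<open>x\<close> and to one point further left, the second right edge of \<open>x\<close> goes beyond \<open>y\<close>, and the points
  strictly between \<open>x\<close> and \<open>y\<close> have all their edges among themselves (\<open>excursion_leaving\<close>). An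
  excursion and the next larger one around it therefore cannot both be left by an edge
  (\<open>nested_excursion_closed\<close>), and a component that meets an excursion left by no edge stays in it,
  hence is finite. What remains is that every point lies in two such nested excursions. Conditionally
  on the points, the walk is a lazy simple random walk, so it is unbounded below to the right of
  any place and, read backwards, unbounded above to the left of it (\<open>marks_walk_unbounded\<close>).

  \<^bold>\<open>Long edges.\<close> The sum of \<open>2 R\<^sub>x - D\<^sub>x\<close> over the points of \<open>[0, n)\<close> is at most the number of edges
  with exactly one end in \<open>[0, n)\<close>, in absolute value (\<open>imbalance_le_crossing\<close>). Given the points and
  their degrees its characteristic function at \<open>\<theta>\<close> is the product of the \<open>(cos \<theta>) ^ D\<^sub>x\<close>. Since \<open>D\<^sub>x \<ge> 1\<close>
  and \<open>\<bar>u\<bar> \<ge> 1 - cos u\<close>, the choice \<open>\<theta> = 1 / \<surd>n\<close> shows that the mean number of these edges is at least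
  a multiple of \<open>\<surd>n\<close> (\<open>crossing_lower_bound\<close>). On the other hand, such an edge with an end in
  \<open>[k, k + 1)\<close> is longer than \<open>k\<close> or than \<open>n - 1 - k\<close>. By stationarity the mean is therefore at most twice the
  sum over \<open>m < n\<close> of \<open>T m\<close>, the mean number of edges longer than \<open>m\<close> with an end in \<open>[0, 1)\<close>
  (\<open>crossing_le_sum_edge_tail\<close>). When the degrees are bounded, the sum of \<open>T m / \<surd>m\<close> over \<open>m \<ge> 1\<close> is at most a
  constant times the Palm expectation of \<open>\<surd>X\<close>, with \<open>X\<close> the average edge length at the origin. Were this expectation finite, the sum of \<open>T m\<close> over
  \<open>m < n\<close> would be of smaller order than \<open>\<surd>n\<close>, a contradiction.

  Two measure-theoretic facts carry the rest. Joint expectations of the marks and of functions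
  measurable with respect to the conditioning \<open>\<sigma>\<close>-algebra are computed under product distributions
  (\<open>cond_law_of_marks\<close>). The set function that defines the Palm law is countably additive, and
  integrals with respect to it are sums over the points of \<open>[0, 1)\<close> (\<open>palm_campbell\<close>).
\<close>

section \<open>Measurability of random configurations\<close>

lemma npts_mono: "S \<inter> A \<subseteq> T \<inter> B \<Longrightarrow> npts S A \<le> npts T B"
  unfolding npts_def by (rule emeasure_mono) auto

lemma npts_UN_le:
  assumes "S \<inter> A \<subseteq> (\<Union>i. T i \<inter> B i)"
  shows "npts S A \<le> (\<Sum>i. npts (T i) (B i))"
proof -
  have "npts S A \<le> emeasure (count_space UNIV) (\<Union>i. T i \<inter> B i)"
    unfolding npts_def by (rule emeasure_mono) (use assms in auto)
  also have "\<dots> \<le> (\<Sum>i. npts (T i) (B i))"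
    unfolding npts_def by (rule emeasure_subadditive_countably) auto
  finally show ?thesis .
qed

lemma npts_UN_finite_le:
  assumes "S \<inter> A \<subseteq> (\<Union>i\<in>I. T i \<inter> B i)" "finite I"
  shows "npts S A \<le> (\<Sum>i\<in>I. npts (T i) (B i))"
proof -
  have "npts S A \<le> emeasure (count_space UNIV) (\<Union>i\<in>I. T i \<inter> B i)"
    unfolding npts_def by (rule emeasure_mono) (use assms in auto)
  also have "\<dots> \<le> (\<Sum>i\<in>I. npts (T i) (B i))"
    unfolding npts_def by (rule emeasure_subadditive_finite) (use assms in auto)
  finally show ?thesis .
qed

lemma npts_finite: "finite (S \<inter> A) \<Longrightarrow> npts S A = of_nat (card (S \<inter> A))"
  unfolding npts_def by (simp add: emeasure_count_space)

lemma npts_less_top_iff: "npts S A < top \<longleftrightarrow> finite (S \<inter> A)"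
  unfolding npts_def using of_nat_less_top by (cases "finite (S \<inter> A)") (simp_all add: emeasure_count_space)

lemma npts_Diff:
  assumes "finite (S \<inter> A)" "C \<subseteq> A"
  shows "npts S (A - C) = npts S A - npts S C"
proof -
  have fin: "finite (S \<inter> C)"
    by (rule finite_subset[OF _ assms(1)]) (use assms(2) in blast)
  have "emeasure (count_space UNIV) (S \<inter> A - S \<inter> C) =
      emeasure (count_space UNIV) (S \<inter> A) - emeasure (count_space UNIV) (S \<inter> C)"
    by (rule emeasure_Diff) (use fin assms(2) in \<open>auto simp: emeasure_count_space_finite\<close>)
  moreover have "S \<inter> (A - C) = S \<inter> A - S \<inter> C" by blast
  ultimately show ?thesis unfolding npts_def by simp
qed

lemma npts_image:
  assumes "inj_on f S"
  shows "npts (f ` S) A = npts S (f -` A)"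
proof -
  have "bij_betw f (S \<inter> f -` A) (f ` S \<inter> A)"
    using assms by (auto simp: bij_betw_def intro: inj_on_subset)
  then have "emeasure (count_space UNIV) (f ` S \<inter> A) = emeasure (count_space UNIV) (S \<inter> f -` A)"
    by (auto simp: emeasure_count_space bij_betw_finite bij_betw_same_card)
  then show ?thesis
    unfolding npts_def .
qed

text \<open>
  Counting the points of an enumerated configuration is summing over the indices. This turns
  statements about random sets into statements about sequences of random variables.
\<close>

lemma npts_enum:
  assumes "bij_betw (X :: nat \<Rightarrow> 'b) UNIV V"
  shows "npts {x \<in> V. Q x} B = (\<Sum>i. indicator {x. x \<in> B \<and> Q x} (X i))"
proof -
  have "npts {x \<in> V. Q x} B = (\<integral>\<^sup>+x. indicator ({x \<in> V. Q x} \<inter> B) x \<partial>count_space UNIV)"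
    unfolding npts_def by simp
  also have "\<dots> = (\<integral>\<^sup>+x. indicator {x. x \<in> B \<and> Q x} x * indicator V x \<partial>count_space UNIV)"
    by (intro nn_integral_cong) (auto simp: indicator_def)
  also have "\<dots> = (\<integral>\<^sup>+x. indicator {x. x \<in> B \<and> Q x} x \<partial>count_space V)"
    by (simp add: nn_integral_count_space_indicator)
  also have "\<dots> = (\<integral>\<^sup>+i. indicator {x. x \<in> B \<and> Q x} (X i) \<partial>count_space UNIV)"
    by (rule nn_integral_bij_count_space[OF assms, symmetric])
  also have "\<dots> = (\<Sum>i. indicator {x. x \<in> B \<and> Q x} (X i))"
    by (simp add: nn_integral_count_space_nat)
  finally show ?thesis .
qed

lemma space_config_algebra: "space (config_algebra N) = Pow (space N)"
  unfolding config_algebra_def by (rule space_measure_of) auto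

lemma sets_config_algebra:
  "sets (config_algebra N) = sigma_sets (Pow (space N))
     {{S \<in> Pow (space N). npts S A \<in> B} | A B. A \<in> sets N \<and> B \<in> sets borel}"
  unfolding config_algebra_def by (rule sets_measure_of) auto

lemma measurable_npts [measurable]:
  assumes "A \<in> sets N"
  shows "(\<lambda>S. npts S A) \<in> borel_measurable (config_algebra N)"
proof (rule measurableI)
  fix B :: "ennreal set" assume "B \<in> sets borel"
  then show "(\<lambda>S. npts S A) -` B \<inter> space (config_algebra N) \<in> sets (config_algebra N)"
    unfolding sets_config_algebra space_config_algebra
    by (intro sigma_sets.Basic) (use assms in auto)
qed simp

lemma measurable_config_algebraI:
  assumes "\<And>w. w \<in> space F \<Longrightarrow> \<Xi> w \<subseteq> space N"
    and "\<And>A. A \<in> sets N \<Longrightarrow> (\<lambda>w. npts (\<Xi> w) A) \<in> borel_measurable F"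
  shows "\<Xi> \<in> F \<rightarrow>\<^sub>M config_algebra N"
  unfolding config_algebra_def
proof (rule measurable_measure_of)
  show "\<Xi> \<in> space F \<rightarrow> Pow (space N)" using assms(1) by auto
next
  fix Y assume "Y \<in> {{S \<in> Pow (space N). npts S A \<in> B} |A B. A \<in> sets N \<and> B \<in> sets borel}"
  then obtain A B where Y: "Y = {S \<in> Pow (space N). npts S A \<in> B}" "A \<in> sets N" "B \<in> sets borel"
    by auto
  then have "\<Xi> -` Y \<inter> space F = (\<lambda>w. npts (\<Xi> w) A) -` B \<inter> space F"
    using assms(1) by auto
  also have "\<dots> \<in> sets F"
    using assms(2)[OF Y(2)] Y(3) by (rule measurable_sets)
  finally show "\<Xi> -` Y \<inter> space F \<in> sets F" .
qed auto

lemma measurable_empty_config: "(\<lambda>_. {}) \<in> M \<rightarrow>\<^sub>M config_algebra K"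
  by (intro measurable_const) (simp add: space_config_algebra)

text \<open>
  A locally finite random configuration is a kernel of counting measures, so the count of a section
  of a jointly measurable set is measurable. On each set of the exhaustion the counts are finite,
  which allows the \<open>\<pi>\<close>-\<open>\<lambda>\<close> argument starting from rectangles; complements need the finiteness.
\<close>

lemma measurable_npts_section:
  fixes \<Xi> :: "'w \<Rightarrow> 'b set" and B :: "nat \<Rightarrow> 'b set"
  assumes \<Xi> [measurable]: "\<Xi> \<in> F \<rightarrow>\<^sub>M config_algebra N"
    and B [measurable]: "\<And>n. B n \<in> sets N" and inc: "incseq B" and ex: "(\<Union>n. B n) = space N"
    and fin: "\<And>w n. w \<in> space F \<Longrightarrow> npts (\<Xi> w) (B n) < top"
    and C: "C \<in> sets (F \<Otimes>\<^sub>M N)"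
  shows "(\<lambda>w. npts (\<Xi> w) (Pair w -` C)) \<in> borel_measurable F"
proof -
  have bounded: "(\<lambda>w. npts (\<Xi> w) (B n \<inter> Pair w -` C)) \<in> borel_measurable F" for n
    using Int_stable_pair_measure_generator pair_measure_closed C unfolding sets_pair_measure
  proof (induct rule: sigma_sets_induct_disjoint)
    case (basic A)
    then obtain a b where A: "A = a \<times> b" and [measurable]: "a \<in> sets F" "b \<in> sets N" by auto
    have "npts (\<Xi> w) (B n \<inter> Pair w -` A) = indicator a w * npts (\<Xi> w) (B n \<inter> b)" for w
      unfolding A npts_def by (cases "w \<in> a") auto
    then show ?case by simp
  next
    case empty
    then show ?case by (simp add: npts_def)
  next
    case (compl A)
    have "npts (\<Xi> w) (B n \<inter> Pair w -` (space F \<times> space N - A)) =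
            npts (\<Xi> w) (B n) - npts (\<Xi> w) (B n \<inter> Pair w -` A)" if w: "w \<in> space F" for w
    proof -
      have eq: "B n \<inter> Pair w -` (space F \<times> space N - A) = B n - B n \<inter> Pair w -` A"
        using sets.sets_into_space[OF B, of n] w by auto
      have "finite (\<Xi> w \<inter> B n)"
        using fin[OF w, of n] by (simp add: npts_less_top_iff)
      then show ?thesis
        unfolding eq by (rule npts_Diff) blast
    qed
    then show ?case
      using compl by (simp cong: measurable_cong)
  next
    case (union A)
    have "npts (\<Xi> w) (B n \<inter> Pair w -` (\<Union>i. A i)) = (\<Sum>i. npts (\<Xi> w) (B n \<inter> Pair w -` A i))" for w
    proof -
      have "disjoint_family (\<lambda>i. \<Xi> w \<inter> (B n \<inter> Pair w -` A i))"
        using union(1) unfolding disjoint_family_on_def by blast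
      then have "(\<Sum>i. npts (\<Xi> w) (B n \<inter> Pair w -` A i)) =
          emeasure (count_space UNIV) (\<Union>i. \<Xi> w \<inter> (B n \<inter> Pair w -` A i))"
        unfolding npts_def by (intro suminf_emeasure) auto
      also have "(\<Union>i. \<Xi> w \<inter> (B n \<inter> Pair w -` A i)) = \<Xi> w \<inter> (B n \<inter> Pair w -` (\<Union>i. A i))"
        by blast
      finally show ?thesis
        unfolding npts_def by (rule sym)
    qed
    then show ?case using union by simp
  qed
  have "npts (\<Xi> w) (Pair w -` C) = (SUP n. npts (\<Xi> w) (B n \<inter> Pair w -` C))" if "w \<in> space F" for w
  proof -
    have "incseq (\<lambda>n. \<Xi> w \<inter> (B n \<inter> Pair w -` C))"
      using inc unfolding incseq_def by blast
    then have "(SUP n. npts (\<Xi> w) (B n \<inter> Pair w -` C)) =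
        emeasure (count_space UNIV) (\<Union>n. \<Xi> w \<inter> (B n \<inter> Pair w -` C))"
      unfolding npts_def by (intro SUP_emeasure_incseq) auto
    also have "(\<Union>n. \<Xi> w \<inter> (B n \<inter> Pair w -` C)) = \<Xi> w \<inter> Pair w -` C"
      using ex measurable_space[OF \<Xi> that] by (auto simp: space_config_algebra)
    finally show ?thesis unfolding npts_def by simp
  qed
  then show ?thesis
    using bounded by (simp cong: measurable_cong)
qed

text \<open>
  The case of interest is \<open>f w x = x - X w\<close> for a random point \<open>X w\<close>: the configuration seen from one of
  its own points is again measurable. Injectivity prevents the image from merging points.
\<close>

lemma measurable_config_image:
  fixes \<Xi> :: "'w \<Rightarrow> 'b set" and B :: "nat \<Rightarrow> 'b set"
  assumes \<Xi>: "\<Xi> \<in> F \<rightarrow>\<^sub>M config_algebra N"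
    and B: "\<And>n. B n \<in> sets N" "incseq B" "(\<Union>n. B n) = space N"
    and fin: "\<And>w n. w \<in> space F \<Longrightarrow> npts (\<Xi> w) (B n) < top"
    and f: "(\<lambda>(w, x). f w x) \<in> F \<Otimes>\<^sub>M N \<rightarrow>\<^sub>M N'"
    and inj: "\<And>w. w \<in> space F \<Longrightarrow> inj_on (f w) (space N)"
  shows "(\<lambda>w. f w ` \<Xi> w) \<in> F \<rightarrow>\<^sub>M config_algebra N'"
proof (rule measurable_config_algebraI)
  have sub: "\<Xi> w \<subseteq> space N" if "w \<in> space F" for w
    using measurable_space[OF \<Xi> that] by (simp add: space_config_algebra)
  show "f w ` \<Xi> w \<subseteq> space N'" if "w \<in> space F" for w
    using measurable_space[OF f] sub[OF that] that by (fastforce simp: space_pair_measure)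
  fix A assume A: "A \<in> sets N'"
  define C where "C = (\<lambda>(w, x). f w x) -` A \<inter> space (F \<Otimes>\<^sub>M N)"
  have "C \<in> sets (F \<Otimes>\<^sub>M N)"
    unfolding C_def using f A by (rule measurable_sets)
  with \<Xi> B fin have "(\<lambda>w. npts (\<Xi> w) (Pair w -` C)) \<in> borel_measurable F"
    by (rule measurable_npts_section)
  moreover have "npts (f w ` \<Xi> w) A = npts (\<Xi> w) (Pair w -` C)" if w: "w \<in> space F" for w
  proof -
    have "npts (f w ` \<Xi> w) A = npts (\<Xi> w) (f w -` A)"
      by (rule npts_image) (use inj[OF w] sub[OF w] in \<open>rule inj_on_subset\<close>)
    also have "\<dots> = npts (\<Xi> w) (Pair w -` C)"
      using sub[OF w] w by (intro antisym npts_mono) (auto simp: C_def space_pair_measure)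
    finally show ?thesis .
  qed
  ultimately show "(\<lambda>w. npts (f w ` \<Xi> w) A) \<in> borel_measurable F"
    by (simp cong: measurable_cong)
qed

section \<open>Unordered pairs\<close>

lemma space_upair_algebra [simp]: "space upair_algebra = UNIV"
  unfolding upair_algebra_def by (simp add: space_measure_of_conv)

text \<open>
  The generating family of \<^const>\<open>upair_algebra\<close> is already a \<open>\<sigma>\<close>-algebra, namely the quotient one.
\<close>

lemma in_sets_upair_algebra:
  "A \<in> sets upair_algebra \<longleftrightarrow> {(x, y). Upair x y \<in> A} \<in> sets (borel \<Otimes>\<^sub>M (borel :: real measure))"
proof -
  let ?G = "{A. {(x :: real, y). Upair x y \<in> A} \<in> sets (borel \<Otimes>\<^sub>M borel)}"
  have "sigma_algebra UNIV ?G"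
    unfolding sigma_algebra_iff2
  proof safe
    show "{(x :: real, y). Upair x y \<in> {}} \<in> sets (borel \<Otimes>\<^sub>M borel)" by simp
  next
    fix A :: "real uprod set" assume A: "{(x, y). Upair x y \<in> A} \<in> sets (borel \<Otimes>\<^sub>M borel)"
    have "{(x, y). Upair x y \<in> UNIV - A} = space (borel \<Otimes>\<^sub>M borel) - {(x, y). Upair x y \<in> A}"
      by (auto simp: space_pair_measure)
    also have "\<dots> \<in> sets (borel \<Otimes>\<^sub>M borel)" using A by (rule sets.compl_sets)
    finally show "{(x, y). Upair x y \<in> UNIV - A} \<in> sets (borel \<Otimes>\<^sub>M borel)" .
  next
    fix A :: "nat \<Rightarrow> real uprod set" assume A: "range A \<subseteq> ?G"
    have "{(x, y). Upair x y \<in> (\<Union>i. A i)} = (\<Union>i. {(x, y). Upair x y \<in> A i})" by auto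
    also have "\<dots> \<in> sets (borel \<Otimes>\<^sub>M borel)" using A by (intro sets.countable_UN) auto
    finally show "{(x, y). Upair x y \<in> (\<Union>i. A i)} \<in> sets (borel \<Otimes>\<^sub>M borel)" .
  qed auto
  then have "sets upair_algebra = ?G"
    unfolding upair_algebra_def by (simp only: sigma_algebra.sigma_sets_eq sets_measure_of[of ?G UNIV] subset_UNIV Pow_UNIV)
  then show ?thesis by auto
qed

lemma sets_upair_algebraI:
  assumes "{z \<in> space (borel \<Otimes>\<^sub>M (borel :: real measure)). Upair (fst z) (snd z) \<in> A} \<in> sets (borel \<Otimes>\<^sub>M borel)"
  shows "A \<in> sets upair_algebra"
  using assms by (simp add: in_sets_upair_algebra space_pair_measure case_prod_beta')

lemma measurable_Upair [measurable]: "(\<lambda>(x, y). Upair x y) \<in> borel \<Otimes>\<^sub>M borel \<rightarrow>\<^sub>M upair_algebra"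
proof (rule measurableI)
  fix A assume "A \<in> sets upair_algebra"
  then show "(\<lambda>(x, y). Upair x y) -` A \<inter> space (borel \<Otimes>\<^sub>M borel) \<in> sets (borel \<Otimes>\<^sub>M borel)"
    unfolding in_sets_upair_algebra by (simp add: space_pair_measure vimage_def case_prod_beta')
qed simp

lemma measurable_from_upair:
  assumes "(\<lambda>(x, y). f (Upair x y)) \<in> borel \<Otimes>\<^sub>M borel \<rightarrow>\<^sub>M N"
  shows "f \<in> upair_algebra \<rightarrow>\<^sub>M N"
proof (rule measurableI)
  show "f e \<in> space N" for e
    using measurable_space[OF assms] by (cases e) (auto simp: space_pair_measure)
  fix A assume "A \<in> sets N"
  then have "(\<lambda>(x, y). f (Upair x y)) -` A \<inter> space (borel \<Otimes>\<^sub>M borel) \<in> sets (borel \<Otimes>\<^sub>M borel)"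
    using assms by (intro measurable_sets)
  then show "f -` A \<inter> space upair_algebra \<in> sets upair_algebra"
    unfolding in_sets_upair_algebra by (simp add: space_pair_measure vimage_def case_prod_beta')
qed

text \<open>
  The minimum and the maximum form a measurable section of the quotient map from ordered to
  unordered pairs, which reduces joint measurability in \<open>w\<close> and \<open>e\<close> to that on the plane.
\<close>

lemma measurable_map_uprod_shift:
  assumes [measurable]: "X \<in> borel_measurable F"
  shows "(\<lambda>(w, e). map_uprod (\<lambda>x. x + X w) e) \<in> F \<Otimes>\<^sub>M upair_algebra \<rightarrow>\<^sub>M upair_algebra"
proof -
  have [measurable]: "(\<lambda>e. Min (set_uprod e)) \<in> borel_measurable upair_algebra"
      "(\<lambda>e. Max (set_uprod e)) \<in> borel_measurable upair_algebra"
    by (rule measurable_from_upair; simp)+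
  have "map_uprod (\<lambda>x. x + X w) e = Upair (Min (set_uprod e) + X w) (Max (set_uprod e) + X w)" for w e
    by (cases e) (auto simp: min_def max_def)
  then show ?thesis by simp
qed

section \<open>Excursions of the stub walk\<close>

lemma nbrs_sym: "y \<in> nbrs G x \<longleftrightarrow> x \<in> nbrs G y"
  unfolding nbrs_def mem_Collect_eq by (metis Upair_inject)

text \<open>
  An edge inside \<open>A\<close> is a right edge of one end and a left edge of the other and cancels, so only the
  edges that leave \<open>A\<close> contribute to the imbalance.
\<close>

lemma stub_imbalance_eq_boundary:
  fixes A :: "real set"
  assumes A: "finite A" and fin: "\<And>x. x \<in> A \<Longrightarrow> finite (nbrs G x)"
  shows "(\<Sum>x\<in>A. int (card {y \<in> nbrs G x. x < y}) - int (card {y \<in> nbrs G x. y < x})) =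
    (\<Sum>x\<in>A. int (card {y \<in> nbrs G x - A. x < y})) - (\<Sum>x\<in>A. int (card {y \<in> nbrs G x - A. y < x}))"
proof -
  have split: "card {y \<in> nbrs G x. Q y} = card {y \<in> A. y \<in> nbrs G x \<and> Q y} + card {y \<in> nbrs G x - A. Q y}"
    if "x \<in> A" for x Q
  proof -
    have "{y \<in> nbrs G x. Q y} = {y \<in> A. y \<in> nbrs G x \<and> Q y} \<union> {y \<in> nbrs G x - A. Q y}" by blast
    moreover have "finite {y \<in> nbrs G x - A. Q y}" using fin[OF that] by simp
    ultimately show ?thesis using A by (simp add: card_Un_disjoint disjoint_iff)
  qed
  have count: "card {y \<in> A. Q y} = (\<Sum>y\<in>A. of_bool (Q y))" for Q :: "real \<Rightarrow> bool"
    using A by (simp add: Int_def)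
  have "(\<Sum>x\<in>A. card {y \<in> A. y \<in> nbrs G x \<and> x < y}) = (\<Sum>x\<in>A. \<Sum>y\<in>A. of_bool (y \<in> nbrs G x \<and> x < y))"
    by (simp only: count)
  also have "\<dots> = (\<Sum>y\<in>A. \<Sum>x\<in>A. of_bool (x \<in> nbrs G y \<and> x < y))"
    by (subst sum.swap) (simp only: nbrs_sym)
  also have "\<dots> = (\<Sum>x\<in>A. card {y \<in> A. y \<in> nbrs G x \<and> y < x})"
    by (simp only: count)
  finally have inner: "(\<Sum>x\<in>A. int (card {y \<in> A. y \<in> nbrs G x \<and> x < y})) =
      (\<Sum>x\<in>A. int (card {y \<in> A. y \<in> nbrs G x \<and> y < x}))"
    unfolding of_nat_sum[symmetric] by (rule arg_cong)
  have "(\<Sum>x\<in>A. int (card {y \<in> nbrs G x. x < y}) - int (card {y \<in> nbrs G x. y < x})) =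
    (\<Sum>x\<in>A. (int (card {y \<in> A. y \<in> nbrs G x \<and> x < y}) - int (card {y \<in> A. y \<in> nbrs G x \<and> y < x})) +
      (int (card {y \<in> nbrs G x - A. x < y}) - int (card {y \<in> nbrs G x - A. y < x})))"
      proof (rule sum.cong[OF refl])
    fix x assume "x \<in> A"
    note split[OF this, of "\<lambda>y. x < y"] split[OF this, of "\<lambda>y. y < x"]
    then show "int (card {y \<in> nbrs G x. x < y}) - int (card {y \<in> nbrs G x. y < x}) =
      (int (card {y \<in> A. y \<in> nbrs G x \<and> x < y}) - int (card {y \<in> A. y \<in> nbrs G x \<and> y < x})) +
      (int (card {y \<in> nbrs G x - A. x < y}) - int (card {y \<in> nbrs G x - A. y < x}))"
      by (simp only: of_nat_add algebra_simps)
  qed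
  then show ?thesis
    using inner by (simp only: sum.distrib sum_subtractf)
qed

locale stable_two_regular =
  fixes V :: "real set" and G :: "real uprod set" and R :: "real \<Rightarrow> nat"
  assumes locally_finite: "\<And>a b. finite (V \<inter> {a..b})"
    and edge_subset: "\<And>e. e \<in> G \<Longrightarrow> set_uprod e \<subseteq> V"
    and no_loop: "\<And>x. Upair x x \<notin> G"
    and finite_nbrs: "\<And>x. x \<in> V \<Longrightarrow> finite (nbrs G x)"
    and card_nbrs: "\<And>x. x \<in> V \<Longrightarrow> card (nbrs G x) = 2"
    and card_right: "\<And>x. x \<in> V \<Longrightarrow> card {y \<in> nbrs G x. x < y} = R x"
    and stable: "\<And>x y. x \<in> V \<Longrightarrow> y \<in> V \<Longrightarrow> x < y \<Longrightarrow>
           y \<in> nbrs G x \<or> \<not> (\<exists>z\<in>nbrs G x. x < z \<and> \<bar>x - z\<bar> > \<bar>x - y\<bar>) \<or>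
           \<not> (\<exists>z\<in>nbrs G y. z < y \<and> \<bar>z - y\<bar> > \<bar>x - y\<bar>)"
begin

definition walk :: "real set \<Rightarrow> int" where
  "walk I = (\<Sum>x\<in>V \<inter> I. int (R x) - 1)"

text \<open>
  The walk is read just before each point \<open>z\<close>; positivity up to \<open>y\<close> itself then also says that the walk
  has not returned to \<open>0\<close> earlier.
\<close>

definition excursion :: "real \<Rightarrow> real \<Rightarrow> bool" where
  "excursion x y \<longleftrightarrow> x \<in> V \<and> y \<in> V \<and> x < y \<and>
     (\<forall>z\<in>V. x < z \<and> z \<le> y \<longrightarrow> 1 \<le> walk {x..<z}) \<and> walk {x..y} = 0"

lemma finite_V_Int [intro]: "I \<subseteq> {a..b} \<Longrightarrow> finite (V \<inter> I)"
  using locally_finite[of a b] by (rule rev_finite_subset) blast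

lemma finite_V_intervals [simp]:
  "finite (V \<inter> {a..b})" "finite (V \<inter> {a..<b})" "finite (V \<inter> {a<..b})" "finite (V \<inter> {a<..<b})"
  by (auto intro!: finite_V_Int[of _ a b])

lemma nbrs_in_V: "y \<in> nbrs G x \<Longrightarrow> x \<in> V" "y \<in> nbrs G x \<Longrightarrow> y \<in> V"
  using edge_subset[of "Upair x y"] by (auto simp: nbrs_def)

lemma nbrs_neq: "y \<in> nbrs G x \<Longrightarrow> x \<noteq> y"
  using no_loop by (auto simp: nbrs_def)

lemma card_left: "x \<in> V \<Longrightarrow> card {y \<in> nbrs G x. y < x} + R x = 2"
proof -
  assume x: "x \<in> V"
  have "nbrs G x = {y \<in> nbrs G x. y < x} \<union> {y \<in> nbrs G x. x < y}"
    using nbrs_neq by fastforce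
  moreover have "card ({y \<in> nbrs G x. y < x} \<union> {y \<in> nbrs G x. x < y}) =
      card {y \<in> nbrs G x. y < x} + card {y \<in> nbrs G x. x < y}"
    by (rule card_Un_disjoint) (use finite_nbrs[OF x] in auto)
  ultimately have "card (nbrs G x) = card {y \<in> nbrs G x. y < x} + card {y \<in> nbrs G x. x < y}"
    by (simp only:)
  then show ?thesis using card_nbrs[OF x] card_right[OF x] by simp
qed

lemma walk_eq_boundary:
  assumes "finite (V \<inter> I)"
  shows "2 * walk I = (\<Sum>x\<in>V \<inter> I. int (card {y \<in> nbrs G x - V \<inter> I. x < y})) -
    (\<Sum>x\<in>V \<inter> I. int (card {y \<in> nbrs G x - V \<inter> I. y < x}))"
proof -
  have "2 * walk I = (\<Sum>x\<in>V \<inter> I. int (card {y \<in> nbrs G x. x < y}) - int (card {y \<in> nbrs G x. y < x}))"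
    unfolding walk_def sum_distrib_left
  proof (rule sum.cong)
    fix x assume "x \<in> V \<inter> I"
    then have x: "x \<in> V" by simp
    define l where "l = card {y \<in> nbrs G x. y < x}"
    have "l + R x = 2" unfolding l_def by (rule card_left[OF x])
    then show "2 * (int (R x) - 1) = int (card {y \<in> nbrs G x. x < y}) - int (card {y \<in> nbrs G x. y < x})"
      unfolding l_def[symmetric] card_right[OF x] by simp
  qed simp
  also have "\<dots> = (\<Sum>x\<in>V \<inter> I. int (card {y \<in> nbrs G x - V \<inter> I. x < y})) -
    (\<Sum>x\<in>V \<inter> I. int (card {y \<in> nbrs G x - V \<inter> I. y < x}))"
    by (rule stub_imbalance_eq_boundary) (use assms finite_nbrs in auto)
  finally show ?thesis .
qed

lemma walk_split:
  assumes "V \<inter> I = (V \<inter> J) \<union> (V \<inter> K)" "V \<inter> J \<inter> K = {}" "finite (V \<inter> J)" "finite (V \<inter> K)"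
  shows "walk I = walk J + walk K"
  unfolding walk_def assms(1) by (rule sum.union_disjoint) (use assms in auto)

lemma walk_snoc: "a \<le> y \<Longrightarrow> y \<in> V \<Longrightarrow> walk {a..y} = walk {a..<y} + (int (R y) - 1)"
  by (subst walk_split[of _ "{a..<y}" "{y}"]) (auto simp: walk_def)

lemma walk_cons: "x < b \<Longrightarrow> x \<in> V \<Longrightarrow> walk {x..<b} = (int (R x) - 1) + walk {x<..<b}"
  by (subst walk_split[of _ "{x}" "{x<..<b}"]) (auto simp: walk_def)

lemma walk_eq_right_leaving:
  assumes "\<And>u a. u \<in> V \<Longrightarrow> x \<le> u \<Longrightarrow> u < z \<Longrightarrow> a \<in> nbrs G u \<Longrightarrow> x \<le> a"
  shows "2 * walk {x..<z} = (\<Sum>u\<in>V \<inter> {x..<z}. int (card {v \<in> nbrs G u. z \<le> v}))"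
proof -
  let ?A = "V \<inter> {x..<z}"
  have "(\<Sum>u\<in>?A. int (card {v \<in> nbrs G u - ?A. v < u})) = 0"
  proof (rule sum.neutral, rule ballI)
    fix u assume "u \<in> ?A"
    then have "{v \<in> nbrs G u - ?A. v < u} = {}"
      using assms[of u] nbrs_in_V by fastforce
    then show "int (card {v \<in> nbrs G u - ?A. v < u}) = 0" by (simp only: card.empty of_nat_0)
  qed
  moreover have "(\<Sum>u\<in>?A. int (card {v \<in> nbrs G u - ?A. u < v})) = (\<Sum>u\<in>?A. int (card {v \<in> nbrs G u. z \<le> v}))"
  proof (rule sum.cong)
    fix u assume "u \<in> ?A"
    then have "{v \<in> nbrs G u - ?A. u < v} = {v \<in> nbrs G u. z \<le> v}"
      using nbrs_in_V by fastforce
    then show "int (card {v \<in> nbrs G u - ?A. u < v}) = int (card {v \<in> nbrs G u. z \<le> v})" by (simp only:)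
  qed simp
  ultimately show ?thesis
    using walk_eq_boundary[of "{x..<z}"] by simp
qed

text \<open>
  The stubs of an excursion balance, so an edge leaving it to the right is accompanied by one leaving
  it to the left.
\<close>

lemma excursion_leaving_left:
  assumes exc: "excursion x y" and u: "u \<in> V" "x \<le> u" "u \<le> y" and v: "v \<in> nbrs G u" "v \<notin> {x..y}"
  shows "\<exists>z\<in>V. x \<le> z \<and> z \<le> y \<and> (\<exists>a\<in>nbrs G z. a < x)"
proof (rule ccontr)
  let ?A = "V \<inter> {x..y}"
  assume no: "\<not> ?thesis"
  have "(\<Sum>u\<in>?A. int (card {v \<in> nbrs G u - ?A. v < u})) = 0"
  proof (rule sum.neutral, rule ballI)
    fix u assume "u \<in> ?A"
    then have "{v \<in> nbrs G u - ?A. v < u} = {}"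
      using no nbrs_in_V by fastforce
    then show "int (card {v \<in> nbrs G u - ?A. v < u}) = 0" by (simp only: card.empty of_nat_0)
  qed
  moreover have "walk {x..y} = 0" using exc by (simp add: excursion_def)
  ultimately have "(\<Sum>u\<in>?A. int (card {v \<in> nbrs G u - ?A. u < v})) = 0"
    using walk_eq_boundary[of "{x..y}"] by simp
  then have "card {v \<in> nbrs G u - ?A. u < v} = 0"
    using u by (subst (asm) sum_nonneg_eq_0_iff) auto
  then have "v \<notin> {v \<in> nbrs G u - ?A. u < v}"
    using finite_nbrs[OF u(1)] by auto
  then have "v < x" using v u nbrs_neq[OF v(1)] by auto
  then show False using no u v by blast
qed

text \<open>
  Let \<open>z\<close> be the first point with an edge to the left of \<open>x\<close>. Before \<open>z\<close> the walk is positive and no edge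
  leaves to the left, so at least two edges reach from \<open>[x, z)\<close> to \<open>z\<close> or further. By stability each of
  their left ends is a neighbour of \<open>z\<close>; as one neighbour of \<open>z\<close> lies to the left of \<open>x\<close>, there is only one
  such end \<open>u\<close>, and it carries two edges reaching \<open>z\<close> or further. So the walk returns to \<open>0\<close> at \<open>z\<close>,
  that is, \<open>z = y\<close>. If \<open>u\<close> were not \<open>x\<close>, an edge from the left of \<open>u\<close> would end strictly between \<open>u\<close> and
  \<open>z\<close>, and its right end would form an unstable pair with \<open>u\<close>. So \<open>u = x\<close>, and no other edges
  lead out of the open interval.
\<close>

lemma excursion_leaving:
  assumes exc: "excursion x y" and "u \<in> V" "x \<le> u" "u \<le> y" "v \<in> nbrs G u" "v \<notin> {x..y}"
  shows "(\<exists>a\<in>nbrs G y. a < x) \<and> (\<forall>p\<in>V. x < p \<and> p < y \<longrightarrow> nbrs G p \<subseteq> {x<..<y})"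
proof -
  have xy: "x \<in> V" "y \<in> V" "x < y" and pos: "\<And>z. z \<in> V \<Longrightarrow> x < z \<Longrightarrow> z \<le> y \<Longrightarrow> 1 \<le> walk {x..<z}"
    and zero: "walk {x..y} = 0"
    using exc by (auto simp: excursion_def)
  define Z where "Z = {z \<in> V \<inter> {x..y}. \<exists>a\<in>nbrs G z. a < x}"
  define z where "z = Min Z"
  have Z: "finite Z" "Z \<noteq> {}"
  proof -
    show "finite Z"
      by (rule rev_finite_subset[OF finite_V_intervals(1)[of x y]]) (auto simp: Z_def)
    show "Z \<noteq> {}"
      using excursion_leaving_left[OF assms] by (auto simp: Z_def)
  qed
  then have "z \<in> Z" unfolding z_def by (rule Min_in)
  then obtain a where z: "z \<in> V" "x \<le> z" "z \<le> y" and a: "a \<in> nbrs G z" "a < x"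
    by (auto simp: Z_def)
  have before_z: "x \<le> b" if "q \<in> V" "x \<le> q" "q < z" "b \<in> nbrs G q" for q b
  proof (rule ccontr)
    assume "\<not> x \<le> b"
    then have "b < x" by simp
    then have "q \<in> Z" using that z unfolding Z_def by auto
    then show False using Min_le[OF Z(1)] that(3) unfolding z_def by fastforce
  qed
  have ne_s: "V \<inter> {x<..y} \<noteq> {}" using xy by auto
  define s where "s = Min (V \<inter> {x<..y})"
  have s: "s \<in> V" "x < s" "s \<le> y"
    using Min_in[OF _ ne_s] unfolding s_def by auto
  have "V \<inter> {x..<s} = {x}"
    using xy s Min_le[of "V \<inter> {x<..y}"] unfolding s_def[symmetric] by fastforce
  then have "walk {x..<s} = int (R x) - 1" by (simp add: walk_def)
  then have Rx: "R x = 2" using pos[OF s] card_left[OF xy(1)] by simp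
  then have no_left_x: "\<And>b. b \<in> nbrs G x \<Longrightarrow> x < b"
    using card_left[OF xy(1)] finite_nbrs[OF xy(1)] nbrs_neq by fastforce
  have xz: "x < z" using z a no_left_x[of a] by (cases "x = z") auto
  \<comment> \<open>By stability every point before \<open>z\<close> with an edge beyond \<open>z\<close> is a left neighbour of \<open>z\<close>.\<close>
  have linked: "u \<in> nbrs G z" if u: "u \<in> V" "x \<le> u" "u < z" and v: "v \<in> nbrs G u" "z \<le> v" for u v
  proof (cases "v = z")
    case True
    then show ?thesis using v nbrs_sym by blast
  next
    case False
    then have "\<exists>b\<in>nbrs G u. u < b \<and> \<bar>u - b\<bar> > \<bar>u - z\<bar>"
      using u v by (intro bexI[of _ v]) auto
    moreover have "\<exists>b\<in>nbrs G z. b < z \<and> \<bar>b - z\<bar> > \<bar>u - z\<bar>"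
      using u a z by (intro bexI[of _ a]) auto
    ultimately have "z \<in> nbrs G u" using stable[OF u(1) z(1) u(3)] by blast
    then show ?thesis using nbrs_sym by blast
  qed
  \<comment> \<open>the points before \<open>z\<close> with an edge to \<open>z\<close> or beyond\<close>
  define U where "U = {u \<in> V \<inter> {x..<z}. \<exists>v\<in>nbrs G u. z \<le> v}"
  have finU: "finite U"
    by (rule rev_finite_subset[OF finite_V_intervals(2)[of x z]]) (auto simp: U_def)
  have left_z: "insert a U \<subseteq> {b \<in> nbrs G z. b < z}"
    using a xz linked by (auto simp: U_def)
  have "a \<notin> U" using a by (auto simp: U_def)
  then have "Suc (card U) = card (insert a U)" using finU by simp
  also have "\<dots> \<le> card {b \<in> nbrs G z. b < z}"
    by (rule card_mono) (use left_z finite_nbrs[OF z(1)] in auto)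
  finally have cardU: "Suc (card U) \<le> card {b \<in> nbrs G z. b < z}" .
  have walk_z: "1 \<le> walk {x..<z}" by (rule pos) (use z xz in auto)
  have "2 * walk {x..<z} = (\<Sum>u\<in>V \<inter> {x..<z}. int (card {v \<in> nbrs G u. z \<le> v}))"
    by (rule walk_eq_right_leaving) (rule before_z)
  also have "\<dots> = (\<Sum>u\<in>U. int (card {v \<in> nbrs G u. z \<le> v}))"
  proof (rule sum.mono_neutral_right)
    show "\<forall>i\<in>V \<inter> {x..<z} - U. int (card {v \<in> nbrs G i. z \<le> v}) = 0"
    proof
      fix i assume "i \<in> V \<inter> {x..<z} - U"
      then have "{v \<in> nbrs G i. z \<le> v} = {}" by (auto simp: U_def)
      then show "int (card {v \<in> nbrs G i. z \<le> v}) = 0" by (simp only: card.empty of_nat_0)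
    qed
  qed (auto simp: U_def)
  finally have sumU: "2 * walk {x..<z} = (\<Sum>u\<in>U. int (card {v \<in> nbrs G u. z \<le> v}))" .
  have "card {b \<in> nbrs G z. b < z} \<le> 2" using card_left[OF z(1)] by simp
  moreover have "U \<noteq> {}" using sumU walk_z by auto
  ultimately have "card U = 1" using cardU finU by (cases "card U") auto
  then obtain u where U: "U = {u}" by (auto simp: card_1_singleton_iff)
  then have u: "u \<in> V" "x \<le> u" "u < z" by (auto simp: U_def)
  have right_u: "card {v \<in> nbrs G u. z \<le> v} \<le> R u"
    unfolding card_right[OF u(1), symmetric]
    by (rule card_mono) (use u finite_nbrs in auto)
  then have Ru: "R u = 2" "walk {x..<z} = 1" "card {v \<in> nbrs G u. z \<le> v} = 2"
    using sumU walk_z card_left[OF u(1)] unfolding U by auto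
  have right_u_eq: "{v \<in> nbrs G u. z \<le> v} = {v \<in> nbrs G u. u < v}"
    by (rule card_subset_eq) (use u finite_nbrs Ru card_right[OF u(1)] in auto)
  have u_right: "z \<le> v" if "v \<in> nbrs G u" for v
  proof -
    have "card {y \<in> nbrs G u. y < u} = 0" using card_left[OF u(1)] Ru by simp
    then have "\<not> v < u" using that finite_nbrs[OF u(1)] by auto
    then have "u < v" using nbrs_neq[OF that] by auto
    then show ?thesis using that right_u_eq by auto
  qed
  have "R z = 0" using cardU \<open>card U = 1\<close> card_left[OF z(1)] by simp
  then have zero_z: "walk {x..z} = 0" using walk_snoc[of x z] z Ru by simp
  have zy: "z = y"
  proof (rule ccontr)
    assume "z \<noteq> y"
    then have ne: "V \<inter> {z<..y} \<noteq> {}" using z xy by auto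
    define t where "t = Min (V \<inter> {z<..y})"
    have t: "t \<in> V" "z < t" "t \<le> y"
      using Min_in[OF _ ne] unfolding t_def by auto
    have "V \<inter> {x..<t} = V \<inter> {x..z}"
      using t xz Min_le[of "V \<inter> {z<..y}"] unfolding t_def[symmetric] by fastforce
    then have "walk {x..<t} = 0" using zero_z by (simp add: walk_def)
    then show False using pos[OF t(1)] t xz by simp
  qed
  have ux: "u = x"
  proof (rule ccontr)
    assume "u \<noteq> x"
    then have xu: "x < u" using u by simp
    have walk_u: "1 \<le> walk {x..<u}" using pos[OF u(1) xu] u z by simp
    have "2 * walk {x..<u} = (\<Sum>q\<in>V \<inter> {x..<u}. int (card {v \<in> nbrs G q. u \<le> v}))"
      by (rule walk_eq_right_leaving) (rule before_z, use u in auto)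
    then have "(\<Sum>q\<in>V \<inter> {x..<u}. int (card {v \<in> nbrs G q. u \<le> v})) \<noteq> 0" using walk_u by simp
    then obtain p where p: "p \<in> V" "x \<le> p" "p < u" "card {v \<in> nbrs G p. u \<le> v} \<noteq> 0"
      by (auto elim: sum.not_neutral_contains_not_neutral)
    then obtain q where q: "q \<in> nbrs G p" "u \<le> q" by (metis (mono_tags, lifting) card_eq_0_iff empty_Collect_eq)
    have "q \<noteq> u" using u_right[of p] q p u nbrs_sym by fastforce
    then have uq: "u < q" using q by simp
    have qz: "q < z"
    proof (rule ccontr)
      assume "\<not> q < z"
      then have "\<exists>v\<in>nbrs G p. z \<le> v" using q by (intro bexI[of _ q]) auto
      then have "p \<in> U" using p u by (auto simp: U_def)
      then show False using U p by simp
    qed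
    have "q \<notin> nbrs G u" using u_right qz by fastforce
    moreover have "\<exists>b\<in>nbrs G u. u < b \<and> \<bar>u - b\<bar> > \<bar>u - q\<bar>"
    proof -
      obtain b where "b \<in> nbrs G u" "z \<le> b" using U by (auto simp: U_def)
      then show ?thesis using uq qz by (intro bexI[of _ b]) auto
    qed
    moreover have "\<exists>b\<in>nbrs G q. b < q \<and> \<bar>b - q\<bar> > \<bar>u - q\<bar>"
      using p q uq by (intro bexI[of _ p]) (auto simp: nbrs_sym[of p])
    ultimately show False using stable[OF u(1) nbrs_in_V(2)[OF q(1)] uq] by blast
  qed
  have "nbrs G p \<subseteq> {x<..<y}" if p: "p \<in> V" "x < p" "p < y" for p
  proof
    fix q assume q: "q \<in> nbrs G p"
    have "x \<le> q" using before_z[of p q] p q zy by simp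
    moreover have "q \<noteq> x" using u_right[of p] q p zy ux nbrs_sym by fastforce
    moreover have "q < y"
    proof (rule ccontr)
      assume "\<not> q < y"
      then have "\<exists>v\<in>nbrs G p. z \<le> v" using q zy by (intro bexI[of _ q]) auto
      then have "p \<in> U" using p zy by (auto simp: U_def)
      then show False using U p ux by simp
    qed
    ultimately show "q \<in> {x<..<y}" by simp
  qed
  then show ?thesis using a zy by blast
qed

text \<open>
  If the outer excursion is left by an edge, its interior is closed under adjacency. The points
  between \<open>x2\<close> and \<open>x1\<close> balance, and no edge leaves them to the left, hence none to the right. So \<open>y1\<close> cannot
  have the neighbour to the left of \<open>x1\<close> that it would have if the inner excursion were left by an edge, too.
\<close>

lemma nested_excursion_closed:
  assumes inner: "excursion x1 y1" and outer: "excursion x2 y2"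
    and nested: "x2 < x1" "y1 < y2" and level: "walk {x2<..<x1} = 0"
  shows "(\<forall>u\<in>V \<inter> {x1..y1}. nbrs G u \<subseteq> {x1..y1}) \<or> (\<forall>u\<in>V \<inter> {x2..y2}. nbrs G u \<subseteq> {x2..y2})"
proof (rule ccontr)
  assume "\<not> ?thesis"
  then obtain u1 v1 u2 v2 where
    1: "u1 \<in> V" "x1 \<le> u1" "u1 \<le> y1" "v1 \<in> nbrs G u1" "v1 \<notin> {x1..y1}" and
    2: "u2 \<in> V" "x2 \<le> u2" "u2 \<le> y2" "v2 \<in> nbrs G u2" "v2 \<notin> {x2..y2}"
    by (auto simp: subset_iff)
  obtain a where a: "a \<in> nbrs G y1" "a < x1"
    using excursion_leaving[OF inner 1] by blast
  have inside: "\<And>p. p \<in> V \<Longrightarrow> x2 < p \<Longrightarrow> p < y2 \<Longrightarrow> nbrs G p \<subseteq> {x2<..<y2}"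
    using excursion_leaving[OF outer 2] by blast
  have x1: "x1 \<in> V" "x1 < y1" and y1: "y1 \<in> V" using inner by (auto simp: excursion_def)
  have a': "x2 < a" using inside[of y1] a nested x1 y1 by auto
  let ?A = "V \<inter> {x2<..<x1}"
  have aA: "a \<in> ?A" using a a' nbrs_in_V by auto
  have "(\<Sum>u\<in>?A. int (card {v \<in> nbrs G u - ?A. v < u})) = 0"
  proof (rule sum.neutral, rule ballI)
    fix u assume u: "u \<in> ?A"
    then have "nbrs G u \<subseteq> V \<inter> {x2<..<y2}"
      using inside[of u] nested x1 nbrs_in_V by auto
    then have "{v \<in> nbrs G u - ?A. v < u} = {}" using u by fastforce
    then show "int (card {v \<in> nbrs G u - ?A. v < u}) = 0" by (simp only: card.empty of_nat_0)
  qed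
  then have "(\<Sum>u\<in>?A. int (card {v \<in> nbrs G u - ?A. u < v})) = 0"
    using walk_eq_boundary[of "{x2<..<x1}"] level by simp
  then have "card {v \<in> nbrs G a - ?A. a < v} = 0"
    using aA by (subst (asm) sum_nonneg_eq_0_iff) auto
  then have "y1 \<notin> {v \<in> nbrs G a - ?A. a < v}"
    using finite_nbrs[of a] aA by auto
  then show False using a x1 nbrs_sym by fastforce
qed

text \<open>
  The walk has no downward step larger than \<open>1\<close>, so at its first return below \<open>1\<close> it equals \<open>0\<close>.
\<close>

lemma excursion_exists:
  assumes x: "x \<in> V" and v: "v \<in> V" "x \<le> v" and above: "1 \<le> walk {x..v}"
    and pos: "\<And>z. z \<in> V \<Longrightarrow> x < z \<Longrightarrow> z \<le> v \<Longrightarrow> 1 \<le> walk {x..<z}"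
    and ret: "\<exists>y\<in>V. v < y \<and> walk {x..y} \<le> 0"
  shows "\<exists>y. v < y \<and> excursion x y"
proof -
  obtain y0 where y0: "y0 \<in> V" "v < y0" "walk {x..y0} \<le> 0" using ret by blast
  define Y where "Y = {y \<in> V \<inter> {v<..y0}. walk {x..y} \<le> 0}"
  define y where "y = Min Y"
  have Y: "finite Y" "Y \<noteq> {}"
  proof -
    show "finite Y"
      by (rule rev_finite_subset[OF finite_V_intervals(3)[of v y0]]) (auto simp: Y_def)
    show "Y \<noteq> {}" using y0 by (auto simp: Y_def)
  qed
  then have "y \<in> Y" unfolding y_def by (rule Min_in)
  then have y: "y \<in> V" "v < y" "y \<le> y0" "walk {x..y} \<le> 0" by (auto simp: Y_def)
  have before: "1 \<le> walk {x..z}" if "z \<in> V" "v \<le> z" "z < y" for z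
  proof (cases "z = v")
    case False
    then have "\<not> walk {x..z} \<le> 0"
      using that y Min_le[OF Y(1), of z] unfolding y_def[symmetric] by (auto simp: Y_def)
    then show ?thesis by simp
  qed (use above in simp)
  have pos': "1 \<le> walk {x..<z}" if z: "z \<in> V" "x < z" "z \<le> y" for z
  proof (cases "z \<le> v")
    case True
    then show ?thesis using pos z by simp
  next
    case False
    define t where "t = Max (V \<inter> {v..<z})"
    have ne: "V \<inter> {v..<z} \<noteq> {}" using v False by auto
    have t: "t \<in> V" "v \<le> t" "t < z" using Max_in[OF _ ne] unfolding t_def by auto
    have "V \<inter> {x..<z} = V \<inter> {x..t}"
      using t v False Max_ge[of "V \<inter> {v..<z}"] unfolding t_def[symmetric] by fastforce
    then have "walk {x..<z} = walk {x..t}" by (simp add: walk_def)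
    then show ?thesis using before[of t] t z by simp
  qed
  have "walk {x..y} = walk {x..<y} + (int (R y) - 1)"
    by (rule walk_snoc) (use y v in auto)
  then have "walk {x..y} = 0" using pos'[of y] y v by simp
  then show ?thesis
    using x y v pos' by (intro exI[of _ y]) (auto simp: excursion_def)
qed

lemma component_subset_closed:
  assumes closed: "\<forall>u\<in>V \<inter> I. nbrs G u \<subseteq> I" and v: "v \<in> I"
  shows "component V G v \<subseteq> V \<inter> I"
proof
  fix y assume "y \<in> component V G v"
  then have y: "y \<in> V" "(v, y) \<in> {(u, w). u \<in> V \<and> w \<in> V \<and> Upair u w \<in> G}\<^sup>*"
    by (auto simp: component_def)
  from y(2) have "y \<in> I"
    by (induction rule: rtrancl_induct) (use v closed in \<open>auto simp: nbrs_def\<close>)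
  then show "y \<in> V \<inter> I" using y by simp
qed

text \<open>
  The last point \<open>x1 \<le> v\<close> from which the walk is positive at \<open>v\<close> starts an excursion around \<open>v\<close>. The last point
  \<open>x2 < x1\<close> from which the walk is positive just before \<open>x1\<close> starts the next larger one: the walk between
  \<open>x2\<close> and \<open>x1\<close> sums to \<open>0\<close>.
\<close>

theorem component_finite:
  assumes down: "\<And>(c :: int) k. \<exists>y\<in>V. c \<le> y \<and> walk {of_int c..y} \<le> - int k"
    and up: "\<And>(c :: int) k. \<exists>x\<in>V. x \<le> c \<and> int k \<le> walk {x..of_int c}"
    and v: "v \<in> V"
  shows "finite (component V G v)"
proof -
  have past: "\<exists>x\<in>V. x \<le> b \<and> k \<le> walk (I \<inter> {x..})" if I: "I = {..b} \<or> I = {..<b}" for b k I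
  proof -
    define c where "c = \<lfloor>b\<rfloor> - 1"
    have c: "of_int c < b" unfolding c_def by linarith
    obtain x where x: "x \<in> V" "x \<le> c" "int (nat (k - walk (I \<inter> {of_int c<..}))) \<le> walk {x..of_int c}"
      using up by blast
    have "walk (I \<inter> {x..}) = walk {x..of_int c} + walk (I \<inter> {of_int c<..})"
    proof (rule walk_split)
      show "finite (V \<inter> (I \<inter> {of_int c<..}))"
        by (rule finite_V_Int[of _ "of_int c" b]) (use I in auto)
    qed (use I x c in auto)
    then have "k \<le> walk (I \<inter> {x..})" using x(3) by linarith
    then show ?thesis using x c by (intro bexI[of _ x]) auto
  qed
  have future: "\<exists>y\<in>V. b < y \<and> walk {x..y} \<le> 0" if "x \<le> b" for b x
  proof -
    define c where "c = \<lfloor>b\<rfloor> + 1"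
    have c: "b < of_int c" unfolding c_def by linarith
    obtain y where y: "y \<in> V" "of_int c \<le> y" "walk {of_int c..y} \<le> - int (nat (walk {x..<of_int c}))"
      using down by blast
    have "walk {x..y} = walk {x..<of_int c} + walk {of_int c..y}"
      by (rule walk_split) (use that c y in auto)
    then have "walk {x..y} \<le> 0" using y(3) by linarith
    then show ?thesis using y c by (intro bexI[of _ y]) auto
  qed
  define X1 where "X1 = {x \<in> V. x \<le> v \<and> 1 \<le> walk {x..v}}"
  obtain x10 where x10: "x10 \<in> X1"
    using past[of "{..v}" v 1] by (auto simp: X1_def Int_commute atLeastAtMost_def)
  \<comment> \<open>cutting at a known element makes the set finite without changing its maximum\<close>
  define x1 where "x1 = Max (X1 \<inter> {x10..})"
  have fin1: "finite (X1 \<inter> {x10..})"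
    by (rule finite_subset[OF _ finite_V_intervals(1)[of x10 v]]) (auto simp: X1_def)
  have "x1 \<in> X1 \<inter> {x10..}" unfolding x1_def by (rule Max_in) (use fin1 x10 in auto)
  then have x1: "x1 \<in> V" "x1 \<le> v" "1 \<le> walk {x1..v}" "x10 \<le> x1" by (auto simp: X1_def)
  have after1: "walk {z..v} \<le> 0" if "z \<in> V" "x1 < z" "z \<le> v" for z
  proof (rule ccontr)
    assume "\<not> ?thesis"
    then have "z \<in> X1 \<inter> {x10..}" using that x1 by (auto simp: X1_def)
    then show False using Max_ge[OF fin1, of z] that unfolding x1_def by simp
  qed
  have pos1: "1 \<le> walk {x1..<z}" if "z \<in> V" "x1 < z" "z \<le> v" for z
  proof -
    have "walk {x1..v} = walk {x1..<z} + walk {z..v}"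
      by (rule walk_split) (use that in auto)
    then show ?thesis using after1[OF that] x1 by simp
  qed
  obtain y1 where y1: "v < y1" and exc1: "excursion x1 y1"
    using excursion_exists[OF x1(1) v x1(2,3) pos1 future[OF x1(2)]] by blast

  define X2 where "X2 = {x \<in> V. x < x1 \<and> 1 \<le> walk {x..<x1}}"
  obtain x20 where x20: "x20 \<in> X2"
  proof -
    obtain x where x: "x \<in> V" "x \<le> x1" "1 \<le> walk ({..<x1} \<inter> {x..})"
      using past[of "{..<x1}" x1 1] by blast
    moreover have eq: "{..<x1} \<inter> {x..} = {x..<x1}" by auto
    moreover have "x \<noteq> x1" using x unfolding eq by (auto simp: walk_def)
    ultimately have "x \<in> X2" by (auto simp: X2_def)
    then show ?thesis using that by blast
  qed
  define x2 where "x2 = Max (X2 \<inter> {x20..})"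
  have fin2: "finite (X2 \<inter> {x20..})"
    by (rule finite_subset[OF _ finite_V_intervals(1)[of x20 x1]]) (auto simp: X2_def)
  have "x2 \<in> X2 \<inter> {x20..}" unfolding x2_def by (rule Max_in) (use fin2 x20 in auto)
  then have x2: "x2 \<in> V" "x2 < x1" "1 \<le> walk {x2..<x1}" "x20 \<le> x2" by (auto simp: X2_def)
  have after2: "walk {z..<x1} \<le> 0" if "z \<in> V" "x2 < z" "z < x1" for z
  proof (rule ccontr)
    assume "\<not> ?thesis"
    then have "z \<in> X2 \<inter> {x20..}" using that x2 by (auto simp: X2_def)
    then show False using Max_ge[OF fin2, of z] that unfolding x2_def by simp
  qed
  have "walk {x2<..<x1} \<le> 0"
  proof (cases "V \<inter> {x2<..<x1} = {}")
    case True
    then show ?thesis by (simp add: walk_def)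
  next
    case False
    define s where "s = Min (V \<inter> {x2<..<x1})"
    have s: "s \<in> V" "x2 < s" "s < x1" using Min_in[OF _ False] unfolding s_def by auto
    have "V \<inter> {x2<..<x1} = V \<inter> {s..<x1}"
      using s Min_le[of "V \<inter> {x2<..<x1}"] unfolding s_def[symmetric] by fastforce
    then show ?thesis using after2[OF s] by (simp add: walk_def)
  qed
  moreover have "R x2 \<le> 2" using card_left[OF x2(1)] by simp
  ultimately have level: "walk {x2..<x1} = 1" "walk {x2<..<x1} = 0"
    using walk_cons[OF x2(2,1)] x2(3) by auto
  have y1': "y1 \<in> V" "x1 < y1" "walk {x1..y1} = 0" "\<And>z. z \<in> V \<Longrightarrow> x1 < z \<Longrightarrow> z \<le> y1 \<Longrightarrow> 1 \<le> walk {x1..<z}"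
    using exc1 by (auto simp: excursion_def)
  have pos2: "1 \<le> walk {x2..<z}" if z: "z \<in> V" "x2 < z" "z \<le> y1" for z
  proof -
    consider "z < x1" | "z = x1" | "x1 < z" by linarith
    then show ?thesis
    proof cases
      case 1
      have "walk {x2..<x1} = walk {x2..<z} + walk {z..<x1}"
        by (rule walk_split) (use 1 z in auto)
      then show ?thesis using after2[of z] 1 z level by simp
    next
      case 2
      then show ?thesis using level by simp
    next
      case 3
      have "walk {x2..<z} = walk {x2..<x1} + walk {x1..<z}"
        by (rule walk_split) (use 3 z x2 in auto)
      then show ?thesis using y1'(4)[of z] 3 z level by simp
    qed
  qed
  have "walk {x2..y1} = walk {x2..<x1} + walk {x1..y1}"
    by (rule walk_split) (use x2 y1' in auto)
  then have "1 \<le> walk {x2..y1}" using level y1' by simp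
  then obtain y2 where y2: "y1 < y2" and exc2: "excursion x2 y2"
    using excursion_exists[OF x2(1) y1'(1) _ _ pos2 future[of x2 y1]] x2 y1' by auto
  have "\<exists>a b. component V G v \<subseteq> V \<inter> {a..b}"
    using nested_excursion_closed[OF exc1 exc2 x2(2) y2 level(2)]
  proof
    assume "\<forall>u\<in>V \<inter> {x1..y1}. nbrs G u \<subseteq> {x1..y1}"
    then have "component V G v \<subseteq> V \<inter> {x1..y1}"
      by (rule component_subset_closed) (use x1 y1 in auto)
    then show ?thesis by blast
  next
    assume "\<forall>u\<in>V \<inter> {x2..y2}. nbrs G u \<subseteq> {x2..y2}"
    then have "component V G v \<subseteq> V \<inter> {x2..y2}"
      by (rule component_subset_closed) (use x1 y1 x2 y2 in auto)
    then show ?thesis by blast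
  qed
  then show ?thesis by (meson finite_V_intervals(1) finite_subset)
qed

end

section \<open>Conditional law of finitely many marks\<close>

lemma countable_eventually_zero: "countable {r :: nat \<Rightarrow> nat. \<forall>i\<ge>m. r i = 0}"
proof (rule countable_subset)
  show "{r :: nat \<Rightarrow> nat. \<forall>i\<ge>m. r i = 0} \<subseteq> range (\<lambda>l i. if i < length l then l ! i else 0)"
  proof
    fix r :: "nat \<Rightarrow> nat" assume "r \<in> {r. \<forall>i\<ge>m. r i = 0}"
    then have "r = (\<lambda>i. if i < length (map r [0..<m]) then map r [0..<m] ! i else 0)"
      by (auto simp: fun_eq_iff)
    then show "r \<in> range (\<lambda>l i. if i < length l then l ! i else 0)" by (rule range_eqI)
  qed
qed simp

text \<open>
  The nonnegative version of conditional expectation can be paired with unbounded nonnegative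
  functions without a discussion of integrability.
\<close>

lemma (in sigma_finite_subalgebra) nn_cond_exp_indicator:
  assumes [measurable]: "A \<in> sets M"
  shows "AE w in M. nn_cond_exp M F (indicator A) w = ennreal (real_cond_exp M F (indicator A) w)"
proof -
  have zero: "AE w in M. 0 = nn_cond_exp M F (\<lambda>w. ennreal (- indicator A w)) w"
    using nn_cond_exp_F_meas[of "\<lambda>w. 0"]
    by (simp add: indicator_def ennreal_neg if_distrib cong: if_cong)
  have le: "AE w in M. nn_cond_exp M F (indicator A) w \<le> nn_cond_exp M F (\<lambda>_. 1) w"
    by (rule nn_cond_exp_mono) (auto simp: indicator_def)
  have one: "AE w in M. 1 = nn_cond_exp M F (\<lambda>_. 1) w"
    by (rule nn_cond_exp_F_meas) simp
  have eq: "(\<lambda>w. ennreal (indicator A w)) = indicator A"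
    by (simp add: fun_eq_iff ennreal_indicator)
  show ?thesis
    using zero le one
  proof eventually_elim
    case (elim w)
    then have "nn_cond_exp M F (indicator A) w < top"
      using order_le_less_trans[of "nn_cond_exp M F (indicator A) w" 1 top] by auto
    then show ?case
      using elim unfolding real_cond_exp_def eq by (simp flip: elim(1))
  qed
qed

text \<open>
  Given the \<open>\<sigma>\<close>-algebra \<open>F\<close>, the first \<open>m\<close> marks are independent with laws \<open>\<kappa> i\<close>. As the marks take
  countably many values, the integral splits over their values \<open>r\<close>, and each \<open>h r\<close> pulls out of the conditional
  expectation of the event that the marks equal \<open>r\<close>. The marks with index \<open>m\<close> or larger are set to the
  default value \<open>0\<close> of \<^const>\<open>Pi_pmf\<close>.
\<close>

theorem cond_law_of_marks:
  fixes \<rho> :: "nat \<Rightarrow> 'w \<Rightarrow> nat" and \<kappa> :: "nat \<Rightarrow> 'w \<Rightarrow> nat pmf" and h :: "(nat \<Rightarrow> nat) \<Rightarrow> 'w \<Rightarrow> ennreal"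
  assumes M: "prob_space M" and F: "subalgebra M F"
    and \<rho>: "\<And>i. \<rho> i \<in> M \<rightarrow>\<^sub>M count_space UNIV"
    and cond: "\<And>m r. AE w in M. real_cond_exp M F (indicator {w \<in> space M. \<forall>i<m. \<rho> i w = r i}) w =
                 (\<Prod>i<m. pmf (\<kappa> i w) (r i))"
    and h: "\<And>r. h r \<in> borel_measurable F"
  shows "(\<integral>\<^sup>+w. h (\<lambda>i. if i < m then \<rho> i w else 0) w \<partial>M) =
         (\<integral>\<^sup>+w. (\<integral>\<^sup>+r. h r w \<partial>Pi_pmf {..<m} 0 (\<lambda>i. \<kappa> i w)) \<partial>M)"
proof -
  interpret prob_space M by fact
  interpret finite_measure_subalgebra M F by unfold_locales fact
  define C where "C = {r :: nat \<Rightarrow> nat. \<forall>i\<ge>m. r i = 0}"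
  have C: "countable C" unfolding C_def by (rule countable_eventually_zero)
  define A where "A r = {w \<in> space M. \<forall>i<m. \<rho> i w = r i}" for r
  have A [measurable]: "A r \<in> sets M" for r
  proof -
    note \<rho>[measurable]
    show ?thesis unfolding A_def by measurable
  qed
  have h' [measurable]: "h r \<in> borel_measurable M" for r
    using h by (rule measurable_from_subalg[OF F])
  define g where "g r = real_cond_exp M F (indicator (A r))" for r
  have [measurable]: "g r \<in> borel_measurable M" for r unfolding g_def by measurable
  have "(\<integral>\<^sup>+w. h (\<lambda>i. if i < m then \<rho> i w else 0) w \<partial>M) =
      (\<integral>\<^sup>+w. (\<integral>\<^sup>+r. h r w * indicator (A r) w \<partial>count_space C) \<partial>M)"
  proof (rule nn_integral_cong)
    fix w assume w: "w \<in> space M"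
    define a where "a = (\<lambda>i. if i < m then \<rho> i w else 0)"
    have a: "a \<in> C" by (simp add: a_def C_def)
    have "(\<integral>\<^sup>+r. h r w * indicator (A r) w \<partial>count_space C) = (\<integral>\<^sup>+r. h r w * indicator {a} r \<partial>count_space C)"
    proof (rule nn_integral_cong)
      fix r assume "r \<in> space (count_space C)"
      then have "w \<in> A r \<longleftrightarrow> r = a"
        using w by (auto simp: A_def a_def C_def fun_eq_iff not_less)
      then show "h r w * indicator (A r) w = h r w * indicator {a} r"
        by (simp add: indicator_def)
    qed
    also have "\<dots> = h a w" using a by simp
    finally show "h (\<lambda>i. if i < m then \<rho> i w else 0) w = (\<integral>\<^sup>+r. h r w * indicator (A r) w \<partial>count_space C)"
      by (simp add: a_def)
  qed
  also have "\<dots> = (\<integral>\<^sup>+r. (\<integral>\<^sup>+w. h r w * indicator (A r) w \<partial>M) \<partial>count_space C)"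
    using C by (rule nn_integral_count_space_nn_integral) measurable
  also have "\<dots> = (\<integral>\<^sup>+r. (\<integral>\<^sup>+w. h r w * ennreal (g r w) \<partial>M) \<partial>count_space C)"
  proof (rule nn_integral_cong)
    fix r
    have "(\<integral>\<^sup>+w. h r w * indicator (A r) w \<partial>M) = (\<integral>\<^sup>+w. h r w * nn_cond_exp M F (indicator (A r)) w \<partial>M)"
      by (rule nn_cond_exp_intg[symmetric]) (use h in measurable)
    also have "\<dots> = (\<integral>\<^sup>+w. h r w * ennreal (g r w) \<partial>M)"
    proof (rule nn_integral_cong_AE)
      show "AE w in M. h r w * nn_cond_exp M F (indicator (A r)) w = h r w * ennreal (g r w)"
        using nn_cond_exp_indicator[OF A[of r]] unfolding g_def by eventually_elim simp
    qed
    finally show "(\<integral>\<^sup>+w. h r w * indicator (A r) w \<partial>M) = (\<integral>\<^sup>+w. h r w * ennreal (g r w) \<partial>M)" .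
  qed
  also have "\<dots> = (\<integral>\<^sup>+w. (\<integral>\<^sup>+r. h r w * ennreal (g r w) \<partial>count_space C) \<partial>M)"
    using C by (rule nn_integral_count_space_nn_integral[symmetric]) measurable
  also have "\<dots> = (\<integral>\<^sup>+w. (\<integral>\<^sup>+r. h r w \<partial>Pi_pmf {..<m} 0 (\<lambda>i. \<kappa> i w)) \<partial>M)"
  proof (rule nn_integral_cong_AE)
    have "AE w in M. \<forall>r\<in>C. g r w = (\<Prod>i<m. pmf (\<kappa> i w) (r i))"
      unfolding AE_ball_countable[OF C] g_def A_def using cond by blast
    then show "AE w in M. (\<integral>\<^sup>+r. h r w * ennreal (g r w) \<partial>count_space C) =
        (\<integral>\<^sup>+r. h r w \<partial>Pi_pmf {..<m} 0 (\<lambda>i. \<kappa> i w))"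
    proof eventually_elim
      case (elim w)
      let ?p = "Pi_pmf {..<m} 0 (\<lambda>i. \<kappa> i w)"
      have p: "pmf ?p r = (if r \<in> C then g r w else 0)" for r
        using elim by (auto simp: pmf_Pi C_def)
      have "(\<integral>\<^sup>+r. h r w \<partial>?p) = (\<integral>\<^sup>+r. ennreal (pmf ?p r) * h r w \<partial>count_space UNIV)"
        by (rule nn_integral_measure_pmf)
      also have "\<dots> = (\<integral>\<^sup>+r. h r w * ennreal (g r w) * indicator C r \<partial>count_space UNIV)"
        by (rule nn_integral_cong) (auto simp: p indicator_def mult.commute)
      also have "\<dots> = (\<integral>\<^sup>+r. h r w * ennreal (g r w) \<partial>count_space C)"
        by (simp add: nn_integral_count_space_indicator)
      finally show ?case by simp
    qed
  qed
  finally show ?thesis .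
qed

section \<open>Characteristic function of the stub imbalance\<close>

lemma expectation_pair_pmf_finite:
  fixes f :: "_ \<Rightarrow> 'c :: {banach, second_countable_topology}"
  assumes "finite (set_pmf p)" "finite (set_pmf q)"
  shows "measure_pmf.expectation (pair_pmf p q) f =
    measure_pmf.expectation p (\<lambda>x. measure_pmf.expectation q (\<lambda>y. f (x, y)))"
proof -
  have "measure_pmf.expectation (pair_pmf p q) f = (\<Sum>(x, y)\<in>set_pmf p \<times> set_pmf q. (pmf p x * pmf q y) *\<^sub>R f (x, y))"
    using assms by (subst integral_measure_pmf[of "set_pmf p \<times> set_pmf q"]) (auto simp: pmf_pair intro!: sum.cong)
  also have "\<dots> = (\<Sum>x\<in>set_pmf p. pmf p x *\<^sub>R (\<Sum>y\<in>set_pmf q. pmf q y *\<^sub>R f (x, y)))"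
    by (simp add: sum.cartesian_product scaleR_sum_right)
  also have "\<dots> = measure_pmf.expectation p (\<lambda>x. measure_pmf.expectation q (\<lambda>y. f (x, y)))"
    using assms by (simp add: integral_measure_pmf[of "set_pmf p"] integral_measure_pmf[of "set_pmf q"])
  finally show ?thesis .
qed

lemma finite_set_Pi_pmf:
  assumes "finite A" "\<And>x. x \<in> A \<Longrightarrow> finite (set_pmf (p x))"
  shows "finite (set_pmf (Pi_pmf A d p))"
  using assms by (simp add: set_Pi_pmf finite_PiE_dflt)

lemma expectation_prod_Pi_pmf_finite:
  fixes f :: "'a \<Rightarrow> 'b \<Rightarrow> complex"
  assumes "finite A" "\<And>x. x \<in> A \<Longrightarrow> finite (set_pmf (p x))"
  shows "measure_pmf.expectation (Pi_pmf A d p) (\<lambda>r. \<Prod>x\<in>A. f x (r x)) =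
    (\<Prod>x\<in>A. measure_pmf.expectation (p x) (f x))"
  using assms
proof (induction A rule: finite_induct)
  case (insert x A)
  have "measure_pmf.expectation (Pi_pmf (insert x A) d p) (\<lambda>r. \<Prod>z\<in>insert x A. f z (r z)) =
      measure_pmf.expectation (pair_pmf (p x) (Pi_pmf A d p)) (\<lambda>(y, r). \<Prod>z\<in>insert x A. f z ((r(x := y)) z))"
    using insert.hyps by (simp add: Pi_pmf_insert case_prod_beta')
  also have "\<dots> = measure_pmf.expectation (p x) (\<lambda>y. measure_pmf.expectation (Pi_pmf A d p)
      (\<lambda>r. \<Prod>z\<in>insert x A. f z ((r(x := y)) z)))"
    by (subst expectation_pair_pmf_finite) (use insert in \<open>auto intro: finite_set_Pi_pmf\<close>)
  also have "\<dots> = measure_pmf.expectation (p x) (\<lambda>y. measure_pmf.expectation (Pi_pmf A d p)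
      (\<lambda>r. f x y * (\<Prod>z\<in>A. f z (r z))))"
  proof (intro Bochner_Integration.integral_cong refl)
    fix y r
    have "(\<Prod>z\<in>A. f z ((r(x := y)) z)) = (\<Prod>z\<in>A. f z (r z))"
      by (rule prod.cong) (use insert.hyps in auto)
    then show "(\<Prod>z\<in>insert x A. f z ((r(x := y)) z)) = f x y * (\<Prod>z\<in>A. f z (r z))"
      using insert.hyps by simp
  qed
  also have "\<dots> = (\<Prod>z\<in>insert x A. measure_pmf.expectation (p z) (f z))"
    using insert by simp
  finally show ?case .
qed simp

text \<open>
  A binomial variable with parameter \<open>1/2\<close> centred in this way is a sum of \<open>d\<close> independent signs, each with
  characteristic function \<open>cos t\<close>.
\<close>

lemma expectation_cis_binomial:
  "measure_pmf.expectation (binomial_pmf d (1/2)) (\<lambda>k. cis (t * (2 * real k - real d))) = complex_of_real (cos t ^ d)"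
proof -
  have "complex_of_real (cos t ^ d) = (cis t / 2 + cis (- t) / 2) ^ d"
    by (simp add: complex_eq_iff flip: of_real_power add_divide_distrib)
  also have "\<dots> = (\<Sum>k\<le>d. of_nat (d choose k) * (cis t / 2) ^ k * (cis (- t) / 2) ^ (d - k))"
    by (rule binomial_ring)
  also have "\<dots> = (\<Sum>k\<le>d. (real (d choose k) * (1/2) ^ k * (1 - 1/2) ^ (d - k)) *\<^sub>R cis (t * (2 * real k - real d)))"
  proof (rule sum.cong)
    fix k assume "k \<in> {..d}"
    then have k: "k \<le> d" by simp
    have "cis t ^ k * cis (- t) ^ (d - k) = cis (t * (2 * real k - real d))"
      using k unfolding Complex.DeMoivre cis_mult by (simp add: algebra_simps of_nat_diff)
    then have "of_nat (d choose k) * (cis t / 2) ^ k * (cis (- t) / 2) ^ (d - k) =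
        of_nat (d choose k) * (1/2) ^ k * (1/2) ^ (d - k) * cis (t * (2 * real k - real d))"
      by (simp add: power_divide)
    then show "of_nat (d choose k) * (cis t / 2) ^ k * (cis (- t) / 2) ^ (d - k) =
        (real (d choose k) * (1/2) ^ k * (1 - 1/2) ^ (d - k)) *\<^sub>R cis (t * (2 * real k - real d))"
      by (simp add: scaleR_conv_of_real)
  qed simp
  also have "\<dots> = measure_pmf.expectation (binomial_pmf d (1/2)) (\<lambda>k. cis (t * (2 * real k - real d)))"
    by (rule expectation_binomial_pmf'[symmetric]) simp
  finally show ?thesis by simp
qed

lemma nn_integral_one_minus_cos:
  fixes A :: "'a set" and c :: "'a \<Rightarrow> real" and D :: "'a \<Rightarrow> nat"
  assumes "finite A"
  shows "(\<integral>\<^sup>+r. ennreal (1 - cos (\<Sum>x\<in>A. c x * (2 * real (r x) - real (D x)))) \<partial>Pi_pmf A 0 (\<lambda>x. binomial_pmf (D x) (1/2))) =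
    ennreal (1 - (\<Prod>x\<in>A. cos (c x) ^ D x))"
proof -
  let ?p = "Pi_pmf A 0 (\<lambda>x. binomial_pmf (D x) (1/2))"
  have fin: "finite (set_pmf ?p)"
    using assms by (intro finite_set_Pi_pmf) auto
  have cis_sum: "cis (\<Sum>x\<in>A. f x) = (\<Prod>x\<in>A. cis (f x))" for f :: "'a \<Rightarrow> real"
    using assms by (induction A rule: finite_induct) (auto simp flip: cis_mult)
  have "measure_pmf.expectation ?p (\<lambda>r. cos (\<Sum>x\<in>A. c x * (2 * real (r x) - real (D x)))) =
      Re (measure_pmf.expectation ?p (\<lambda>r. cis (\<Sum>x\<in>A. c x * (2 * real (r x) - real (D x)))))"
    by (subst integral_Re[symmetric]) (use fin in \<open>auto intro: integrable_measure_pmf_finite\<close>)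
  also have "measure_pmf.expectation ?p (\<lambda>r. cis (\<Sum>x\<in>A. c x * (2 * real (r x) - real (D x)))) =
      measure_pmf.expectation ?p (\<lambda>r. \<Prod>x\<in>A. cis (c x * (2 * real (r x) - real (D x))))"
    by (simp only: cis_sum)
  also have "\<dots> = (\<Prod>x\<in>A. complex_of_real (cos (c x) ^ D x))"
    by (subst expectation_prod_Pi_pmf_finite) (use assms in \<open>auto simp: expectation_cis_binomial\<close>)
  also have "Re \<dots> = (\<Prod>x\<in>A. cos (c x) ^ D x)"
    by (simp flip: of_real_prod of_real_power)
  finally have "measure_pmf.expectation ?p (\<lambda>r. 1 - cos (\<Sum>x\<in>A. c x * (2 * real (r x) - real (D x)))) =
      1 - (\<Prod>x\<in>A. cos (c x) ^ D x)"
    by (subst Bochner_Integration.integral_diff) (use fin in \<open>auto intro: integrable_measure_pmf_finite\<close>)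
  then show ?thesis
    by (subst nn_integral_eq_integral) (use fin in \<open>auto intro: integrable_measure_pmf_finite\<close>)
qed

section \<open>Recurrence of the lazy walk\<close>

text \<open>
  The walk started at \<open>k\<close> has steps \<open>r - 1\<close>, reflected when \<open>s = -1\<close>; the reflected walk is the one seen
  when the line is read from right to left.
\<close>

fun stays_positive :: "int \<Rightarrow> int \<Rightarrow> nat list \<Rightarrow> bool" where
  "stays_positive s k [] \<longleftrightarrow> 0 < k"
| "stays_positive s k (r # rs) \<longleftrightarrow> 0 < k \<and> stays_positive s (k + s * (int r - 1)) rs"

lemma stays_positiveI:
  "(\<And>j. j \<le> length rs \<Longrightarrow> 0 < k + s * (\<Sum>i<j. int (rs ! i) - 1)) \<Longrightarrow> stays_positive s k rs"
proof (induction rs arbitrary: k)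
  case Nil
  then show ?case using Nil[of 0] by simp
next
  case (Cons r rs)
  have "0 < k" using Cons.prems[of 0] by simp
  moreover have "stays_positive s (k + s * (int r - 1)) rs"
  proof (rule Cons.IH)
    fix j assume "j \<le> length rs"
    then show "0 < k + s * (int r - 1) + s * (\<Sum>i<j. int (rs ! i) - 1)"
      using Cons.prems[of "Suc j"] by (simp only: sum.lessThan_Suc_shift) (simp add: algebra_simps)
  qed
  ultimately show ?case by simp
qed

text \<open>
  The probability that the lazy simple random walk started at \<open>k\<close> stays positive for \<open>n\<close> steps, by
  conditioning on the first step.
\<close>

fun survival :: "nat \<Rightarrow> int \<Rightarrow> real" where
  "survival 0 k = of_bool (0 < k)"
| "survival (Suc n) k = (if 0 < k then (survival n (k - 1) + 2 * survival n k + survival n (k + 1)) / 4 else 0)"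

lemma survival_bounds: "0 \<le> survival n k" "survival n k \<le> 1"
proof -
  have "0 \<le> survival n k \<and> survival n k \<le> 1"
  proof (induction n arbitrary: k)
    case (Suc n)
    from Suc[of "k - 1"] Suc[of k] Suc[of "k + 1"] show ?case by auto
  qed simp
  then show "0 \<le> survival n k" "survival n k \<le> 1" by auto
qed

lemma survival_nonpos: "k \<le> 0 \<Longrightarrow> survival n k = 0"
  by (cases n) auto

lemma survival_decreasing: "survival (Suc n) k \<le> survival n k"
proof (induction n arbitrary: k)
  case 0
  show ?case by auto
next
  case (Suc n)
  show ?case
  proof (cases "0 < k")
    case True
    then have "survival (Suc (Suc n)) k =
        (survival (Suc n) (k - 1) + 2 * survival (Suc n) k + survival (Suc n) (k + 1)) / 4"
      by (subst survival.simps(2)) simp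
    also have "\<dots> \<le> (survival n (k - 1) + 2 * survival n k + survival n (k + 1)) / 4"
      by (intro divide_right_mono add_mono mult_left_mono Suc) simp_all
    also have "\<dots> = survival (Suc n) k" using True by simp
    finally show ?thesis .
  qed simp
qed

text \<open>
  The decreasing limit is harmonic on the positive integers and \<open>0\<close> at \<open>0\<close>, hence linear; being bounded, it
  vanishes.
\<close>

lemma survival_tendsto_0: "(\<lambda>n. survival n k) \<longlonglongrightarrow> 0"
proof -
  have "\<exists>L. (\<lambda>n. survival n k) \<longlonglongrightarrow> L" for k
    using decseq_convergent[of "\<lambda>n. survival n k" 0] survival_bounds survival_decreasing
    by (metis decseq_SucI)
  then obtain L where L: "\<And>k. (\<lambda>n. survival n k) \<longlonglongrightarrow> L k" by metis
  have L0: "L k = 0" if "k \<le> 0" for k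
    using L[of k] survival_nonpos[OF that] by (simp add: LIMSEQ_const_iff)
  have L1: "0 \<le> L k" "L k \<le> 1" for k
    using L[of k] survival_bounds by (auto intro: LIMSEQ_le_const LIMSEQ_le_const2)
  have harm: "L (k + 1) = 2 * L k - L (k - 1)" if "0 < k" for k
  proof -
    have "(\<lambda>n. survival (Suc n) k) \<longlonglongrightarrow> (L (k - 1) + 2 * L k + L (k + 1)) / 4"
      using that by (simp add: tendsto_intros L)
    moreover have "(\<lambda>n. survival (Suc n) k) \<longlonglongrightarrow> L k"
      using L by (rule LIMSEQ_Suc)
    ultimately have "L k = (L (k - 1) + 2 * L k + L (k + 1)) / 4"
      by (rule LIMSEQ_unique[rotated])
    then show ?thesis by simp
  qed
  have lin: "L (int n) = real n * L 1 \<and> L (int n + 1) = (real n + 1) * L 1" for n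
  proof (induction n)
    case (Suc n)
    then show ?case using harm[of "int n + 1"] by (simp add: algebra_simps)
  qed (simp add: L0)
  have "L 1 = 0"
  proof (rule ccontr)
    assume "L 1 \<noteq> 0"
    then have pos: "0 < L 1" using L1(1)[of 1] by simp
    then obtain n where "1 < real n * L 1" using reals_Archimedean3 by blast
    then show False using lin[of n] L1(2)[of "int n"] by simp
  qed
  then have "L k = 0" using lin[of "nat k"] L0[of k] by (cases "0 \<le> k") auto
  then show ?thesis using L[of k] by simp
qed

lemma emeasure_stays_positive:
  assumes A: "finite A" "set a \<subseteq> A" and a: "distinct a" and s: "s = 1 \<or> s = -1"
  shows "emeasure (Pi_pmf A 0 (\<lambda>_. binomial_pmf 2 (1/2))) {r. stays_positive s k (map r a)} =
    ennreal (survival (length a) k)"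
proof -
  let ?b = "binomial_pmf 2 (1/2 :: real)"
  have step: "(\<integral>\<^sup>+r. ennreal (g r) \<partial>?b) = ennreal ((g 0 + 2 * g 1 + g 2) / 4)" if "\<And>r. 0 \<le> g r" for g
  proof -
    have "(\<integral>\<^sup>+r. ennreal (g r) \<partial>?b) = (\<Sum>r\<le>2. ennreal (g r * pmf ?b r))"
      by (subst nn_integral_measure_pmf_finite) (auto simp: ennreal_mult' that)
    also have "\<dots> = ennreal (\<Sum>r\<le>2. g r * pmf ?b r)"
      by (rule sum_ennreal) (simp add: that)
    also have "(\<Sum>r\<le>2. g r * pmf ?b r) = (g 0 + 2 * g 1 + g 2) / 4"
      by (simp add: numeral_2_eq_2 field_simps power2_eq_square)
    finally show ?thesis .
  qed
  have main: "emeasure (Pi_pmf (set a) 0 (\<lambda>_. ?b)) {r. stays_positive s k (map r a)} = ennreal (survival (length a) k)"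
    using a
  proof (induction a arbitrary: k)
    case Nil
    then show ?case by (auto simp: indicator_def)
  next
    case (Cons x a)
    let ?P = "Pi_pmf (set a) 0 (\<lambda>_. ?b)"
    have *: "map (f(x := y)) a = map f a" for f :: "'a \<Rightarrow> nat" and y
      using Cons.prems by simp
    have "emeasure (Pi_pmf (set (x # a)) 0 (\<lambda>_. ?b)) {r. stays_positive s k (map r (x # a))} =
        emeasure (pair_pmf ?b ?P) {(y, f). 0 < k \<and> stays_positive s (k + s * (int y - 1)) (map f a)}"
      using Cons.prems by (simp add: Pi_pmf_insert vimage_def case_prod_beta' * del: fun_upd_apply)
        (simp add: *)
    also have "\<dots> = (\<integral>\<^sup>+y. \<integral>\<^sup>+f. indicator {(y, f). 0 < k \<and> stays_positive s (k + s * (int y - 1)) (map f a)} (y, f) \<partial>?P \<partial>?b)"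
      by (simp flip: nn_integral_pair_pmf')
    also have "\<dots> = (\<integral>\<^sup>+y. ennreal (if 0 < k then survival (length a) (k + s * (int y - 1)) else 0) \<partial>?b)"
    proof (rule nn_integral_cong)
      fix y
      have "(\<integral>\<^sup>+f. indicator {(y, f). 0 < k \<and> stays_positive s (k + s * (int y - 1)) (map f a)} (y, f) \<partial>?P) =
        (\<integral>\<^sup>+f. (if 0 < k then indicator {f. stays_positive s (k + s * (int y - 1)) (map f a)} f else 0) \<partial>?P)"
        by (rule nn_integral_cong) (auto simp: indicator_def)
      then show "(\<integral>\<^sup>+f. indicator {(y, f). 0 < k \<and> stays_positive s (k + s * (int y - 1)) (map f a)} (y, f) \<partial>?P) =
        ennreal (if 0 < k then survival (length a) (k + s * (int y - 1)) else 0)"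
        using Cons by simp
    qed
    also have "\<dots> = ennreal (survival (length (x # a)) k)"
      using s by (subst step) (auto simp: survival_bounds algebra_simps)
    finally show ?case .
  qed
  have "Pi_pmf (set a) 0 (\<lambda>_. ?b) = map_pmf (\<lambda>f x. if x \<in> set a then f x else 0) (Pi_pmf A 0 (\<lambda>_. ?b))"
    by (rule Pi_pmf_subset) (use A in auto)
  then have "emeasure (Pi_pmf (set a) 0 (\<lambda>_. ?b)) {r. stays_positive s k (map r a)} =
      emeasure (Pi_pmf A 0 (\<lambda>_. ?b)) {r. stays_positive s k (map r a)}"
    by (simp add: vimage_def cong: map_cong)
  then show ?thesis using main by simp
qed

text \<open>
  The list \<open>a\<close> contains the indices of the first points of \<open>x\<close> in \<open>[c, \<infinity>)\<close>, in increasing order of the points.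
  The enumeration of the points by \<open>x\<close> need not respect their order on the line.
\<close>

definition first_points :: "real \<Rightarrow> (nat \<Rightarrow> real) \<Rightarrow> nat list \<Rightarrow> bool" where
  "first_points c x a \<longleftrightarrow> sorted_wrt (\<lambda>i j. x i < x j) a \<and> (\<forall>i\<in>set a. c \<le> x i) \<and>
     (\<forall>i. c \<le> x i \<longrightarrow> i \<in> set a \<or> (\<forall>j\<in>set a. x j < x i))"

lemma first_points_distinct: "first_points c x a \<Longrightarrow> distinct a"
  unfolding first_points_def by (auto simp: distinct_conv_nth sorted_wrt_iff_nth_less) (metis less_irrefl nat_neq_iff)

lemma first_points_unique:
  assumes a: "first_points c x a" and b: "first_points c x b" and len: "length a = length b"
  shows "a = b"
proof -
  have sub: "set b \<subseteq> set a \<or> set a \<subseteq> set b"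
    using a b unfolding first_points_def by (meson less_asym subsetI)
  have "card (set a) = card (set b)"
    using first_points_distinct[OF a] first_points_distinct[OF b] len by (simp add: distinct_card)
  with sub have set_eq: "set a = set b"
    by (metis List.finite_set card_subset_eq)
  have sorted: "sorted_wrt (<) (map x a)" "sorted_wrt (<) (map x b)"
    using a b by (auto simp: first_points_def sorted_wrt_map)
  then have map_eq: "map x a = map x b"
    using set_eq by (intro strict_sorted_equal) auto
  have "distinct (map x a)" using sorted(1) by (rule strict_sorted_iff[THEN iffD1, THEN conjunct2])
  then have "inj_on x (set a \<union> set b)"
    using set_eq by (simp add: distinct_map)
  then show ?thesis
    using map_eq by (rule map_inj_on[rotated])
qed

lemma first_points_exists:
  assumes inj: "inj x" and inf: "infinite {i. c \<le> x i}" and fin: "\<And>b. finite {i. x i \<in> {c..b}}"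
  shows "\<exists>a. length a = n \<and> first_points c x a"
proof (induction n)
  case 0
  show ?case by (simp add: first_points_def)
next
  case (Suc n)
  then obtain a where a: "length a = n" "first_points c x a" by blast
  have "infinite ({i. c \<le> x i} - set a)" using inf by simp
  then obtain i0 where i0: "c \<le> x i0" "i0 \<notin> set a"
    by (metis (no_types, lifting) Diff_iff finite.emptyI mem_Collect_eq equals0I)
  define S where "S = {i. x i \<in> {c..x i0}} - set a"
  have S: "finite S" "S \<noteq> {}" using fin i0 by (auto simp: S_def)
  then obtain i where i: "i \<in> S" "\<And>j. j \<in> S \<Longrightarrow> x i \<le> x j"
    using ex_min_if_finite[of "x ` S"] by (metis (no_types, lifting) arg_min_if_finite(1) arg_min_least)
  have min: "x i < x j" if "c \<le> x j" "j \<notin> set a" "j \<noteq> i" for j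
  proof -
    have "x i \<le> x j"
    proof (cases "x j \<le> x i0")
      case True
      then show ?thesis using that i by (auto simp: S_def)
    next
      case False
      then show ?thesis using i by (auto simp: S_def)
    qed
    moreover have "x i \<noteq> x j" using inj that by (auto dest: injD)
    ultimately show ?thesis by simp
  qed
  have "first_points c x (a @ [i])"
    unfolding first_points_def
  proof (intro conjI)
    show "sorted_wrt (\<lambda>i j. x i < x j) (a @ [i])"
      using a i unfolding first_points_def by (auto simp: sorted_wrt_append S_def)
    show "\<forall>i\<in>set (a @ [i]). c \<le> x i"
      using a i unfolding first_points_def by (auto simp: S_def)
    show "\<forall>ia. c \<le> x ia \<longrightarrow> ia \<in> set (a @ [i]) \<or> (\<forall>j\<in>set (a @ [i]). x j < x ia)"
    proof (intro allI impI)
      fix j assume j: "c \<le> x j"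
      have "j \<in> set a \<or> (\<forall>l\<in>set a. x l < x j)" using a(2) j by (auto simp: first_points_def)
      then show "j \<in> set (a @ [i]) \<or> (\<forall>l\<in>set (a @ [i]). x l < x j)"
        using min[OF j] by auto
    qed
  qed
  then show ?case using a(1) by (intro exI[of _ "a @ [i]"]) simp
qed

lemma first_points_prefix:
  assumes a: "first_points c x a" and p: "p < length a"
  shows "{j. c \<le> x j \<and> x j \<le> x (a ! p)} = (!) a ` {..<Suc p}"
proof (intro equalityI subsetI)
  fix j assume j: "j \<in> {j. c \<le> x j \<and> x j \<le> x (a ! p)}"
  then have "j \<in> set a \<or> (\<forall>l\<in>set a. x l < x j)" using a by (auto simp: first_points_def)
  then have "j \<in> set a" using j p nth_mem[OF p] by fastforce
  then obtain q where q: "q < length a" "j = a ! q" by (auto simp: in_set_conv_nth)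
  have "\<not> p < q"
    using a j q by (force simp: first_points_def sorted_wrt_iff_nth_less)
  then show "j \<in> (!) a ` {..<Suc p}" using q by auto
next
  fix j assume "j \<in> (!) a ` {..<Suc p}"
  then obtain q where q: "q \<le> p" "j = a ! q" using less_Suc_eq_le by auto
  have "q = p \<or> x (a ! q) < x (a ! p)"
    using a p q unfolding first_points_def sorted_wrt_iff_nth_less by (metis le_neq_implies_less)
  then show "j \<in> {j. c \<le> x j \<and> x j \<le> x (a ! p)}"
    using a p q by (auto simp: first_points_def)
qed

text \<open>
  The order in which the points to the right of \<open>c\<close> appear is measurable with respect to \<open>F\<close>, so on the event
  \<open>J a\<close> that their first \<open>n\<close> indices are \<open>a\<close>, the marks along \<open>a\<close> are independent of \<open>F\<close>, and the
  walk survives with probability \<open>survival n\<close>. The events \<open>J a\<close> are disjoint, so the walk survives its first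
  \<open>n\<close> steps with probability at most \<open>survival n\<close>, which tends to \<open>0\<close>.
\<close>

theorem marks_walk_unbounded:
  fixes \<rho> :: "nat \<Rightarrow> 'w \<Rightarrow> nat" and X :: "nat \<Rightarrow> 'w \<Rightarrow> real" and k :: nat
  assumes M: "prob_space M" and F: "subalgebra M F"
    and \<rho>: "\<And>i. \<rho> i \<in> M \<rightarrow>\<^sub>M count_space UNIV"
    and cond: "\<And>m r. AE w in M. real_cond_exp M F (indicator {w \<in> space M. \<forall>i<m. \<rho> i w = r i}) w =
                 (\<Prod>i<m. pmf (binomial_pmf 2 (1/2)) (r i))"
    and X: "\<And>i. X i \<in> borel_measurable F"
    and inj: "AE w in M. inj (\<lambda>i. X i w)"
    and inf: "AE w in M. infinite {i. c \<le> X i w}"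
    and fin: "AE w in M. \<forall>b. finite {i. X i w \<in> {c..b}}"
    and s: "s = 1 \<or> s = -1"
  shows "AE w in M. \<exists>i. c \<le> X i w \<and> s * (\<Sum>j | c \<le> X j w \<and> X j w \<le> X i w. int (\<rho> j w) - 1) \<le> - int k"
proof -
  interpret prob_space M by fact
  define J where "J a = {w \<in> space F. first_points c (\<lambda>i. X i w) a}" for a
  have space: "space F = space M" using F by (simp add: subalgebra_def)
  have J [measurable]: "J a \<in> sets F" for a
  proof -
    note X[measurable]
    show ?thesis unfolding J_def first_points_def sorted_wrt_iff_nth_less by measurable
  qed
  have J' [measurable]: "J a \<in> sets M" for a
    using J F by (auto simp: subalgebra_def)
  define H where "H a = {w \<in> J a. stays_positive s (int k + 1) (map (\<lambda>i. \<rho> i w) a)}" for a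
  have H [measurable]: "H a \<in> sets M" for a
  proof -
    have "H a = (\<Union>rs\<in>{rs. length rs = length a \<and> stays_positive s (int k + 1) rs}. {w \<in> J a. \<forall>p<length a. \<rho> (a ! p) w = rs ! p})"
    proof -
      have "(\<forall>p<length a. \<rho> (a ! p) w = rs ! p) \<longleftrightarrow> rs = map (\<lambda>i. \<rho> i w) a" if "length rs = length a" for rs w
        using that by (auto simp: list_eq_iff_nth_eq)
      then show ?thesis by (auto simp: H_def)
    qed
    also have "\<dots> \<in> sets M"
    proof (intro sets.countable_UN'' countableI_type)
      fix rs
      note \<rho>[measurable]
      have "{w \<in> J a. \<forall>p<length a. \<rho> (a ! p) w = rs ! p} = {w \<in> space M. w \<in> J a \<and> (\<forall>p<length a. \<rho> (a ! p) w = rs ! p)}"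
        using sets.sets_into_space[OF J', of a] by auto
      also have "\<dots> \<in> sets M" by measurable
      finally show "{w \<in> J a. \<forall>p<length a. \<rho> (a ! p) w = rs ! p} \<in> sets M" .
    qed
    finally show ?thesis .
  qed
  have prob_H: "emeasure M (H a) = emeasure M (J a) * ennreal (survival (length a) (int k + 1))" if a: "distinct a" for a
  proof -
    obtain m where m: "set a \<subseteq> {..<m}"
      using finite_nat_iff_bounded[of "set a"] by auto
    define h :: "(nat \<Rightarrow> nat) \<Rightarrow> 'w \<Rightarrow> ennreal" where
      "h r w = indicator (J a) w * indicator {r. stays_positive s (int k + 1) (map r a)} r" for r w
    have "emeasure M (H a) = (\<integral>\<^sup>+w. indicator (H a) w \<partial>M)" by simp
    also have "\<dots> = (\<integral>\<^sup>+w. h (\<lambda>i. if i < m then \<rho> i w else 0) w \<partial>M)"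
    proof (rule nn_integral_cong)
      fix w
      have eq: "map (\<lambda>i. if i < m then \<rho> i w else 0) a = map (\<lambda>i. \<rho> i w) a" using m by auto
      show "indicator (H a) w = h (\<lambda>i. if i < m then \<rho> i w else 0) w"
        unfolding h_def indicator_def mem_Collect_eq eq by (simp add: H_def)
    qed
    also have "\<dots> = (\<integral>\<^sup>+w. (\<integral>\<^sup>+r. h r w \<partial>Pi_pmf {..<m} 0 (\<lambda>i. binomial_pmf 2 (1/2))) \<partial>M)"
      by (rule cond_law_of_marks[OF M F \<rho> cond]) (simp add: h_def)
    also have "\<dots> = (\<integral>\<^sup>+w. indicator (J a) w * ennreal (survival (length a) (int k + 1)) \<partial>M)"
      unfolding h_def using emeasure_stays_positive[OF _ m a s] by (simp add: nn_integral_cmult)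
    also have "\<dots> = emeasure M (J a) * ennreal (survival (length a) (int k + 1))"
      by (simp add: nn_integral_multc)
    finally show ?thesis .
  qed
  \<comment> \<open>the candidates for the indices of the first \<open>n\<close> points\<close>
  define L where "L n = {a :: nat list. length a = n \<and> distinct a}" for n
  define B where "B n = (\<Union>a\<in>L n. H a)" for n
  have B [measurable]: "B n \<in> sets M" for n
    unfolding B_def by (intro sets.countable_UN'' countableI_type H)
  have prob_B: "emeasure M (B n) \<le> ennreal (survival n (int k + 1))" for n
  proof -
    have disj: "disjoint_family_on J (L n)"
      by (auto simp: disjoint_family_on_def J_def L_def dest: first_points_unique)
    have "disjoint_family_on H (L n)"
      using disj by (rule disjoint_family_on_bisimulation) (auto simp: H_def)
    then have "emeasure M (B n) = (\<integral>\<^sup>+a. emeasure M (H a) \<partial>count_space (L n))"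
      unfolding B_def by (intro emeasure_UN_countable) auto
    also have "\<dots> = (\<integral>\<^sup>+a. emeasure M (J a) * ennreal (survival n (int k + 1)) \<partial>count_space (L n))"
      by (rule nn_integral_cong) (auto simp: L_def prob_H)
    also have "\<dots> = (\<integral>\<^sup>+a. emeasure M (J a) \<partial>count_space (L n)) * ennreal (survival n (int k + 1))"
      by (rule nn_integral_multc) simp
    also have "(\<integral>\<^sup>+a. emeasure M (J a) \<partial>count_space (L n)) = emeasure M (\<Union>a\<in>L n. J a)"
      using disj by (intro emeasure_UN_countable[symmetric]) auto
    also have "\<dots> * ennreal (survival n (int k + 1)) \<le> 1 * ennreal (survival n (int k + 1))"
      by (intro mult_right_mono emeasure_le_1) simp
    finally show ?thesis by simp
  qed
  have "emeasure M (\<Inter>n. B n) \<le> ennreal (survival n (int k + 1))" for n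
    by (rule order_trans[OF emeasure_mono prob_B[of n]]) auto
  then have "emeasure M (\<Inter>n. B n) \<le> ennreal 0"
    by (intro LIMSEQ_le_const[OF tendsto_ennrealI[OF survival_tendsto_0]]) auto
  then have "(\<Inter>n. B n) \<in> null_sets M"
    by (auto simp: null_sets_def)
  then have "AE w in M. w \<notin> (\<Inter>n. B n)" by (rule AE_not_in)
  then show ?thesis
    using inj inf fin AE_space
  proof eventually_elim
    case (elim w)
    then obtain n where n: "w \<notin> B n" by blast
    obtain a where a: "length a = n" "first_points c (\<lambda>i. X i w) a"
      using first_points_exists[of "\<lambda>i. X i w" c n] elim by blast
    have dist: "distinct a" using a(2) by (rule first_points_distinct)
    then have "\<not> stays_positive s (int k + 1) (map (\<lambda>i. \<rho> i w) a)"
      using n a elim by (auto simp: B_def L_def H_def J_def space)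
    then have "\<not> (\<forall>j\<le>length a. 0 < int k + 1 + s * (\<Sum>i<j. int (map (\<lambda>i. \<rho> i w) a ! i) - 1))"
      using stays_positiveI[of "map (\<lambda>i. \<rho> i w) a" "int k + 1" s] unfolding length_map by blast
    then obtain j where j: "j \<le> length a" "int k + 1 + s * (\<Sum>i<j. int (map (\<lambda>i. \<rho> i w) a ! i) - 1) \<le> 0"
      unfolding not_all not_imp not_less by blast
    then obtain p where p: "j = Suc p" by (cases j) auto
    have "(\<Sum>l | c \<le> X l w \<and> X l w \<le> X (a ! p) w. int (\<rho> l w) - 1) = (\<Sum>i<Suc p. int (\<rho> (a ! i) w) - 1)"
      using first_points_prefix[OF a(2), of p] dist j p
      by (subst first_points_prefix[OF a(2)]) (auto simp: sum.reindex inj_on_nth o_def simp del: sum.lessThan_Suc)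
    also have "\<dots> = (\<Sum>i<j. int (map (\<lambda>i. \<rho> i w) a ! i) - 1)"
      unfolding p by (rule sum.cong) (use j p in auto)
    finally have "s * (\<Sum>l | c \<le> X l w \<and> X l w \<le> X (a ! p) w. int (\<rho> l w) - 1) \<le> - int k"
      using j(2) by simp
    moreover have "c \<le> X (a ! p) w"
      using a(2) j(1) p by (auto simp: first_points_def)
    ultimately show ?case by blast
  qed
qed

section \<open>Poisson counts\<close>

lemma poisson_weights_sum: "0 \<le> x \<Longrightarrow> (\<Sum>k. ennreal (x ^ k / fact k * exp (- x))) = 1"
proof -
  assume x: "0 \<le> x"
  have "(\<lambda>k. x ^ k / fact k * exp (- x)) sums (exp x * exp (- x))"
    using sums_mult2[OF exp_converges[of x], of "exp (- x)"] by (simp add: divide_inverse mult_ac)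
  then have "(\<Sum>k. ennreal (x ^ k / fact k * exp (- x))) = ennreal (exp x * exp (- x))"
    using x by (intro suminf_ennreal_eq) auto
  then show ?thesis by (simp flip: exp_add)
qed

lemma poisson_prob:
  assumes "poisson_process M 1 P" "A \<in> sets borel" "bounded A" "prob_space M"
  shows "emeasure M {w \<in> space M. npts (P w) A = of_nat k} =
    ennreal (measure lborel A ^ k / fact k * exp (- measure lborel A))"
proof -
  interpret prob_space M by fact
  show ?thesis
    using assms unfolding poisson_process_def by (simp add: emeasure_eq_measure)
qed

lemma poisson_measurable:
  assumes "poisson_process M 1 P" "A \<in> sets borel"
  shows "(\<lambda>w. npts (P w) A) \<in> borel_measurable M"
proof -
  have [measurable]: "P \<in> M \<rightarrow>\<^sub>M config_algebra borel"
    using assms by (simp add: poisson_process_def)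
  show ?thesis using assms by measurable
qed

lemma poisson_expectation:
  fixes f :: "nat \<Rightarrow> ennreal"
  assumes P: "poisson_process M 1 P" and A: "A \<in> sets borel" "bounded A" and M: "prob_space M"
  shows "AE w in M. finite (P w \<inter> A)"
    and "(\<integral>\<^sup>+w. f (card (P w \<inter> A)) \<partial>M) =
      (\<Sum>k. f k * ennreal (measure lborel A ^ k / fact k * exp (- measure lborel A)))"
proof -
  interpret prob_space M by fact
  define E where "E k = {w \<in> space M. npts (P w) A = of_nat k}" for k
  have [measurable]: "(\<lambda>w. npts (P w) A) \<in> borel_measurable M"
    using P A by (intro poisson_measurable)
  have E [measurable]: "E k \<in> sets M" for k unfolding E_def by measurable
  have disj: "disjoint_family E" by (auto simp: disjoint_family_on_def E_def)
  have "emeasure M (\<Union>k. E k) = (\<Sum>k. emeasure M (E k))"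
    using disj by (intro suminf_emeasure[symmetric]) auto
  also have "\<dots> = 1"
    unfolding E_def poisson_prob[OF P A M] by (rule poisson_weights_sum) simp
  also have "(\<Union>k. E k) = {w \<in> space M. w \<in> (\<Union>k. E k)}" by (auto simp: E_def)
  finally have "AE w in M. w \<in> (\<Union>k. E k)"
    by (intro AE_I_eq_1) auto
  moreover have fin: "finite (P w \<inter> A) \<and> card (P w \<inter> A) = k" if "w \<in> E k" for w k
  proof -
    have "npts (P w) A < top" using that of_nat_less_top[of k] by (simp add: E_def)
    then have "finite (P w \<inter> A)" by (simp add: npts_less_top_iff)
    then show ?thesis using that npts_finite[of "P w" A] by (simp add: E_def)
  qed
  ultimately show "AE w in M. finite (P w \<inter> A)"
    by (auto elim!: eventually_mono)
  have "(\<integral>\<^sup>+w. f (card (P w \<inter> A)) \<partial>M) = (\<integral>\<^sup>+w. (\<Sum>k. f k * indicator (E k) w) \<partial>M)"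
  proof (rule nn_integral_cong_AE)
    show "AE w in M. f (card (P w \<inter> A)) = (\<Sum>k. f k * indicator (E k) w)"
      using \<open>AE w in M. w \<in> (\<Union>k. E k)\<close>
    proof eventually_elim
      case (elim w)
      then obtain k where k: "w \<in> E k" by blast
      then have "indicator (E j) w = (if j = k then 1 else 0 :: ennreal)" for j
        using disj by (auto simp: disjoint_family_on_def indicator_def)
      then have "(\<Sum>j. f j * indicator (E j) w) = (\<Sum>j. if j = k then f j else 0)"
        by (intro suminf_cong) simp
      also have "\<dots> = f k" by (subst suminf_finite[of "{k}"]) auto
      finally show ?case using fin[OF k] by simp
    qed
  qed
  also have "\<dots> = (\<Sum>k. f k * emeasure M (E k))"
    by (simp add: nn_integral_suminf nn_integral_cmult)
  finally show "(\<integral>\<^sup>+w. f (card (P w \<inter> A)) \<partial>M) =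
      (\<Sum>k. f k * ennreal (measure lborel A ^ k / fact k * exp (- measure lborel A)))"
    unfolding E_def poisson_prob[OF P A M] .
qed

lemma poisson_locally_finite:
  assumes "poisson_process M 1 P" "prob_space M"
  shows "AE w in M. \<forall>a b. finite (P w \<inter> {a..b})"
proof -
  have "AE w in M. \<forall>n :: nat. finite (P w \<inter> {- real n..real n})"
    unfolding AE_all_countable using assms by (intro allI poisson_expectation(1)) auto
  then show ?thesis
  proof eventually_elim
    case (elim w)
    show ?case
    proof (intro allI)
      fix a b
      obtain n where "max \<bar>a\<bar> \<bar>b\<bar> \<le> real n" using real_arch_simple by blast
      then have "{a..b} \<subseteq> {- real n..real n}" by auto
      then show "finite (P w \<inter> {a..b})"
        using elim by (meson Int_mono finite_subset order_refl)
    qed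
  qed
qed

text \<open>
  At most \<open>K\<close> points in \<open>T\<close> means at most \<open>K\<close> points in every \<open>A n\<close>, an event of probability at most the sum of
  \<open>n ^ k / exp n\<close> over \<open>k \<le> K\<close>, which tends to \<open>0\<close>.
\<close>

lemma poisson_infinite:
  assumes P: "poisson_process M 1 P" and M: "prob_space M"
    and A: "\<And>n :: nat. A n \<in> sets borel" "\<And>n. bounded (A n)" "\<And>n. measure lborel (A n) = real n" "\<And>n. A n \<subseteq> T"
  shows "AE w in M. infinite (P w \<inter> T)"
proof -
  interpret prob_space M by fact
  have null: "AE w in M. \<not> (\<forall>n. npts (P w) (A n) \<le> of_nat K)" for K
  proof -
    define B where "B n = {w \<in> space M. npts (P w) (A n) \<le> of_nat K}" for n
    have [measurable]: "(\<lambda>w. npts (P w) (A n)) \<in> borel_measurable M" for n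
      using P A by (intro poisson_measurable)
    have B [measurable]: "B n \<in> sets M" for n unfolding B_def by measurable
    have le: "emeasure M (B n) \<le> ennreal (\<Sum>k\<le>K. real n ^ k / exp (real n))" for n
    proof -
      have "B n \<subseteq> (\<Union>k\<le>K. {w \<in> space M. npts (P w) (A n) = of_nat k})"
      proof
        fix w assume w: "w \<in> B n"
        then have "npts (P w) (A n) < top"
          using of_nat_less_top[of K] by (auto simp: B_def intro: order_le_less_trans)
        then have "npts (P w) (A n) = of_nat (card (P w \<inter> A n))"
          by (simp add: npts_less_top_iff npts_finite)
        then show "w \<in> (\<Union>k\<le>K. {w \<in> space M. npts (P w) (A n) = of_nat k})"
          using w by (auto simp: B_def)
      qed
      then have "emeasure M (B n) \<le> emeasure M (\<Union>k\<le>K. {w \<in> space M. npts (P w) (A n) = of_nat k})"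
        by (rule emeasure_mono) measurable
      also have "\<dots> \<le> (\<Sum>k\<le>K. emeasure M {w \<in> space M. npts (P w) (A n) = of_nat k})"
        by (rule emeasure_subadditive_finite) auto
      also have "\<dots> \<le> (\<Sum>k\<le>K. ennreal (real n ^ k / exp (real n)))"
      proof (rule sum_mono)
        fix k
        have "real n ^ k / fact k * exp (- real n) \<le> real n ^ k / exp (real n)"
        proof -
          have "real n ^ k / fact k \<le> real n ^ k / 1"
            by (intro divide_left_mono) (auto simp: fact_ge_1)
          then have "real n ^ k / fact k * exp (- real n) \<le> real n ^ k * exp (- real n)"
            by (intro mult_right_mono) auto
          then show ?thesis by (simp add: exp_minus divide_inverse)
        qed
        then show "emeasure M {w \<in> space M. npts (P w) (A n) = of_nat k} \<le> ennreal (real n ^ k / exp (real n))"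
          unfolding poisson_prob[OF P A(1,2) M] A(3) by (rule ennreal_leI)
      qed
      also have "\<dots> = ennreal (\<Sum>k\<le>K. real n ^ k / exp (real n))" by (rule sum_ennreal) simp
      finally show ?thesis .
    qed
    have "emeasure M (\<Inter>n. B n) \<le> ennreal (\<Sum>k\<le>K. real n ^ k / exp (real n))" for n
      by (rule order_trans[OF emeasure_mono le[of n]]) auto
    moreover have "(\<lambda>n. ennreal (\<Sum>k\<le>K. real n ^ k / exp (real n))) \<longlonglongrightarrow> ennreal (\<Sum>k\<le>K. 0)"
      by (intro tendsto_ennrealI tendsto_sum filterlim_compose[OF tendsto_power_div_exp_0 filterlim_real_sequentially])
    ultimately have "emeasure M (\<Inter>n. B n) \<le> ennreal (\<Sum>k\<le>K. 0)"
      by (intro LIMSEQ_le_const) auto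
    then have "(\<Inter>n. B n) \<in> null_sets M" by (auto simp: null_sets_def)
    then have "AE w in M. w \<notin> (\<Inter>n. B n)" by (rule AE_not_in)
    then show ?thesis using AE_space by eventually_elim (auto simp: B_def)
  qed
  have "AE w in M. \<forall>K. \<not> (\<forall>n. npts (P w) (A n) \<le> of_nat K)"
    unfolding AE_all_countable using null by blast
  then show ?thesis
  proof eventually_elim
    case (elim w)
    show ?case
    proof
      assume fin: "finite (P w \<inter> T)"
      have "npts (P w) (A n) \<le> of_nat (card (P w \<inter> T))" for n
        using npts_mono[of "P w" "A n" "P w" T] A(4)[of n] npts_finite[OF fin] by auto
      then show False using elim by blast
    qed
  qed
qed

section \<open>Real estimates\<close>

lemma one_minus_cos_le: "1 - cos u \<le> \<bar>u :: real\<bar>"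
proof -
  have "1 - cos u = 2 * (sin (u / 2))\<^sup>2"
    using cos_double_sin[of "u / 2"] by simp
  also have "(sin (u / 2))\<^sup>2 \<le> \<bar>sin (u / 2)\<bar>"
    using mult_left_mono[of "\<bar>sin (u / 2)\<bar>" 1 "\<bar>sin (u / 2)\<bar>"] by (simp add: power2_eq_square flip: abs_mult)
  also have "\<dots> \<le> \<bar>u / 2\<bar>" by (rule abs_sin_x_le_abs_x)
  finally show ?thesis by simp
qed

lemma one_minus_cos_ge:
  assumes "0 \<le> u" "u \<le> (1 :: real)"
  shows "u\<^sup>2 / 4 \<le> 1 - cos u"
proof -
  \<comment> \<open>half angles: on \<open>[0, 1/2]\<close> the sine is at least \<open>3/4\<close> of the identity\<close>
  define x where "x = u / 2"
  have x: "0 \<le> x" "x \<le> 1 / 2" using assms by (auto simp: x_def)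
  have "\<bar>sin x - x\<bar> \<le> x ^ 3 / 6"
  proof -
    have "(\<Sum>m<3. sin_coeff m * x ^ m) = x" by (simp add: numeral_3_eq_3 sin_coeff_def)
    moreover have "inverse (fact 3) = (1 / 6 :: real)" by (simp add: fact_numeral)
    moreover have "\<bar>x\<bar> = x" using x by simp
    ultimately show ?thesis using Maclaurin_sin_bound[of x 3] by (simp only:)
  qed
  moreover have "x ^ 3 \<le> x * 1"
    using x power_decreasing[of 1 3 x] by simp
  ultimately have "(3 / 4) * x \<le> sin x" using x by linarith
  then have "((3 / 4) * x)\<^sup>2 \<le> (sin x)\<^sup>2" using x by (intro power_mono) auto
  moreover have "1 - cos u = 2 * (sin x)\<^sup>2" using cos_double_sin[of x] by (simp add: x_def)
  moreover have "u\<^sup>2 / 4 = x\<^sup>2" by (simp add: x_def power_divide)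
  moreover have "((3 / 4) * x)\<^sup>2 = 9 / 16 * x\<^sup>2" by (simp add: power_mult_distrib power_divide)
  moreover have "0 \<le> x\<^sup>2" by simp
  ultimately show ?thesis by linarith
qed

text \<open>
  The term \<open>1 / \<surd>(n + 1)\<close> is at most twice the increment of the square root from \<open>n\<close> to \<open>n + 1\<close>.
\<close>

lemma sum_inverse_sqrt_le:
  "(\<Sum>n<N. 1 / sqrt (real (Suc n)) * of_bool (real (Suc n) < y)) \<le> 2 * sqrt y" if "0 \<le> y"
proof -
  have "(\<Sum>n<N. 1 / sqrt (real (Suc n)) * of_bool (real (Suc n) < y)) \<le> 2 * sqrt (min (real N) y)"
  proof (induction N)
    case 0
    then show ?case using that by simp
  next
    case (Suc N)
    show ?case
    proof (cases "real (Suc N) < y")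
      case True
      have "1 / sqrt (real (Suc N)) \<le> 2 * (sqrt (real (Suc N)) - sqrt (real N))"
      proof -
        define a b where "a = sqrt (real (Suc N))" and "b = sqrt (real N)"
        have a: "0 < a" "0 \<le> b" "b \<le> a" "a\<^sup>2 - b\<^sup>2 = 1" by (auto simp: a_def b_def)
        have "1 = (a - b) * (a + b)" using a by (simp add: power2_eq_square algebra_simps)
        also have "\<dots> \<le> (a - b) * (2 * a)" using a by (intro mult_left_mono) auto
        finally show ?thesis unfolding a_def[symmetric] b_def[symmetric] using a by (simp add: field_simps)
      qed
      then show ?thesis using Suc True by simp
    next
      case False
      then have "(\<Sum>n<Suc N. 1 / sqrt (real (Suc n)) * of_bool (real (Suc n) < y)) \<le> 2 * sqrt (min (real N) y)"
        using Suc by simp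
      also have "\<dots> \<le> 2 * sqrt (min (real (Suc N)) y)" by simp
      finally show ?thesis .
    qed
  qed
  also have "\<dots> \<le> 2 * sqrt y" by simp
  finally show ?thesis .
qed

text \<open>
  Kronecker's lemma for the weights \<open>\<surd>n\<close>: summability of \<open>t n / \<surd>(n + 1)\<close> makes the partial sums
  of \<open>t\<close> of smaller order than \<open>\<surd>n\<close>.
\<close>

lemma no_sqrt_growth_if_summable:
  fixes t :: "nat \<Rightarrow> real"
  assumes t: "\<And>n. 0 \<le> t n" and sum: "summable (\<lambda>n. t n / sqrt (real (Suc n)))" and c: "0 < c"
    and lower: "\<And>n. 1 \<le> n \<Longrightarrow> c * sqrt (real n) \<le> a + 2 * (\<Sum>m<n. t m)"
  shows False
proof -
  define f where "f n = t n / sqrt (real (Suc n))" for n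
  have f: "0 \<le> f n" for n using t by (simp add: f_def)
  have "summable f" using sum unfolding f_def .
  then obtain K where K': "\<And>n. norm (\<Sum>m = K..n. f m) < c / 4"
    using summable_partial_sum_bound[of f "c / 4"] c by (metis divide_pos_pos order_refl zero_less_numeral)
  have K: "\<bar>\<Sum>m\<in>{K..<n}. f m\<bar> < c / 4" for n
  proof (cases n)
    case (Suc n')
    then show ?thesis using K'[of n'] by (simp add: atLeastLessThanSuc_atLeastAtMost)
  qed (use c in simp)
  define A where "A = \<bar>a\<bar> + 2 * (\<Sum>m<K. t m)"
  have A: "0 \<le> A" unfolding A_def using t by (auto intro!: add_nonneg_nonneg sum_nonneg)
  have bound: "c * sqrt (real n) \<le> A + c / 2 * sqrt (real n)" if n: "1 \<le> n" "K \<le> n" for n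
  proof -
    have "(\<Sum>m<n. t m) = (\<Sum>m<K. t m) + (\<Sum>m\<in>{K..<n}. t m)"
      using n by (subst sum.union_disjoint[symmetric]) (auto intro!: sum.cong)
    also have "(\<Sum>m\<in>{K..<n}. t m) \<le> (\<Sum>m\<in>{K..<n}. sqrt (real n) * f m)"
    proof (rule sum_mono)
      fix m assume m: "m \<in> {K..<n}"
      have "t m = sqrt (real (Suc m)) * f m" by (simp add: f_def)
      also have "\<dots> \<le> sqrt (real n) * f m" using m f by (intro mult_right_mono) auto
      finally show "t m \<le> sqrt (real n) * f m" .
    qed
    also have "\<dots> = sqrt (real n) * (\<Sum>m\<in>{K..<n}. f m)" by (simp add: sum_distrib_left)
    also have "\<dots> \<le> sqrt (real n) * (c / 4)" using K[of n] by (intro mult_left_mono) auto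
    finally have "(\<Sum>m<n. t m) \<le> (\<Sum>m<K. t m) + sqrt (real n) * (c / 4)" by simp
    then show ?thesis using lower[OF n(1)] unfolding A_def by (simp add: algebra_simps)
  qed
  obtain n where n: "max (real (max 1 K)) ((2 * A / c)\<^sup>2 + 1) \<le> real n" using real_arch_simple by blast
  then have "2 * A / c < sqrt (real n)"
    using A c by (intro real_less_rsqrt) auto
  moreover have "1 \<le> n" "K \<le> n" using n by auto
  ultimately show False using bound[of n] c by (simp add: field_simps)
qed

section \<open>Finite components in the two-regular case\<close>

lemma subalgebra_vimage: "f \<in> M \<rightarrow>\<^sub>M N \<Longrightarrow> subalgebra M (vimage_algebra (space M) f N)"
  unfolding subalgebra_def by (simp add: sets_image_in_sets)

lemma bij_betw_vimage_Int: "bij_betw f UNIV V \<Longrightarrow> bij_betw f {i. f i \<in> T} (V \<inter> T)"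
  by (auto simp: bij_betw_def intro: inj_on_subset)

locale random_matching =
  fixes M :: "'w measure"
    and P :: "'w \<Rightarrow> real set"
    and D R :: "'w \<Rightarrow> real \<Rightarrow> nat"
    and E :: "'w \<Rightarrow> real uprod set"
    and \<mu> :: "nat pmf"
  assumes prob: "prob_space M"
    and poisson: "poisson_process M 1 P"
    and zero_notin: "0 \<notin> set_pmf \<mu>"
    and degrees: "degree_marks M P \<mu> D"
    and matching: "random_direction_stable_multimatching M P D R E"
begin

sublocale prob_space M by (rule prob)

definition F_pts :: "'w measure" where
  "F_pts = vimage_algebra (space M) P (config_algebra borel)"

definition F_marked :: "'w measure" where
  "F_marked = vimage_algebra (space M) (marked_points P D) marked_algebra"

lemma measurable_P [measurable]: "P \<in> M \<rightarrow>\<^sub>M config_algebra borel"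
  using poisson by (simp add: poisson_process_def)

lemma measurable_marked [measurable]: "marked_points P D \<in> M \<rightarrow>\<^sub>M marked_algebra"
  using degrees by (simp add: degree_marks_def cond_indep_marks_def)

lemma measurable_E [measurable]: "E \<in> M \<rightarrow>\<^sub>M config_algebra upair_algebra"
  using matching by (simp add: random_direction_stable_multimatching_def matching_scheme_def)

lemma subalgebra_pts: "subalgebra M F_pts"
  unfolding F_pts_def by (rule subalgebra_vimage) measurable

lemma subalgebra_marked: "subalgebra M F_marked"
  unfolding F_marked_def by (rule subalgebra_vimage) measurable

lemma degree_enum:
  "\<exists>X :: nat \<Rightarrow> 'w \<Rightarrow> real. (\<forall>i. X i \<in> borel_measurable F_pts) \<and> (AE w in M. bij_betw (\<lambda>i. X i w) UNIV (P w)) \<and>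
    (\<forall>i. (\<lambda>w. D w (X i w)) \<in> M \<rightarrow>\<^sub>M count_space UNIV) \<and>
    (\<forall>n. \<forall>r. AE w in M. real_cond_exp M F_pts (indicator {w \<in> space M. \<forall>i<n. D w (X i w) = r i}) w =
             (\<Prod>i<n. pmf \<mu> (r i)))"
  using degrees unfolding degree_marks_def cond_indep_marks_def F_pts_def[symmetric] by (rule conjunct2)

lemma direction_enum:
  "\<exists>X :: nat \<Rightarrow> 'w \<Rightarrow> real. (\<forall>i. X i \<in> borel_measurable F_marked) \<and> (AE w in M. bij_betw (\<lambda>i. X i w) UNIV (P w)) \<and>
    (\<forall>i. (\<lambda>w. R w (X i w)) \<in> M \<rightarrow>\<^sub>M count_space UNIV) \<and>
    (\<forall>n. \<forall>r. AE w in M. real_cond_exp M F_marked (indicator {w \<in> space M. \<forall>i<n. R w (X i w) = r i}) w =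
             (\<Prod>i<n. pmf (binomial_pmf (D w (X i w)) (1/2)) (r i)))"
proof -
  have "direction_marks M P D R"
    using matching by (simp add: random_direction_stable_multimatching_def)
  then show ?thesis
    unfolding direction_marks_def cond_indep_marks_def F_marked_def[symmetric] by (rule conjunct2)
qed

text \<open>
  The degrees are prescribed at the enumerated points, and almost surely these are all points.
\<close>

lemma degree_in_support: "AE w in M. \<forall>x\<in>P w. D w x \<in> set_pmf \<mu>"
proof -
  obtain X :: "nat \<Rightarrow> 'w \<Rightarrow> real" where X': "\<forall>i. X i \<in> borel_measurable F_pts" "AE w in M. bij_betw (\<lambda>i. X i w) UNIV (P w)"
    "\<forall>i. (\<lambda>w. D w (X i w)) \<in> M \<rightarrow>\<^sub>M count_space UNIV"
    "\<forall>n. \<forall>r. AE w in M. real_cond_exp M F_pts (indicator {w \<in> space M. \<forall>i<n. D w (X i w) = r i}) w =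
             (\<Prod>i<n. pmf \<mu> (r i))"
    using degree_enum by (elim exE conjE) (rule that, assumption+)
  note X = X'(1)[rule_format] X'(2) X'(3)[rule_format] X'(4)[rule_format]
  have "AE w in M. D w (X i w) \<in> set_pmf \<mu>" for i
  proof -
    have [measurable]: "(\<lambda>w. D w (X i w)) \<in> M \<rightarrow>\<^sub>M count_space UNIV" by (rule X(3))
    define h :: "(nat \<Rightarrow> nat) \<Rightarrow> 'w \<Rightarrow> ennreal" where "h r w = indicator {r. r i \<notin> set_pmf \<mu>} r" for r w
    have "(\<integral>\<^sup>+w. h (\<lambda>j. if j < Suc i then D w (X j w) else 0) w \<partial>M) =
        (\<integral>\<^sup>+w. (\<integral>\<^sup>+r. h r w \<partial>Pi_pmf {..<Suc i} 0 (\<lambda>_. \<mu>)) \<partial>M)"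
      by (rule cond_law_of_marks[where \<rho> = "\<lambda>i w. D w (X i w)" and \<kappa> = "\<lambda>_ _. \<mu>", OF prob subalgebra_pts X(3,4)])
        (simp add: h_def)
    moreover have "(\<integral>\<^sup>+r. h r w \<partial>Pi_pmf {..<Suc i} 0 (\<lambda>_. \<mu>)) = 0" for w
      unfolding h_def
      by (subst nn_integral_0_iff_AE) (auto simp: AE_measure_pmf_iff set_Pi_pmf PiE_dflt_def indicator_def)
    ultimately have "(\<integral>\<^sup>+w. indicator {d. d \<notin> set_pmf \<mu>} (D w (X i w)) \<partial>M) = 0"
      by (simp add: h_def indicator_def)
    then have "AE w in M. indicator {d. d \<notin> set_pmf \<mu>} (D w (X i w)) = (0 :: ennreal)"
      by (subst (asm) nn_integral_0_iff_AE) auto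
    then show ?thesis by eventually_elim (auto simp: indicator_def split: if_splits)
  qed
  then have "AE w in M. \<forall>i. D w (X i w) \<in> set_pmf \<mu>" by (simp add: AE_all_countable)
  then show ?thesis
    using X(2)
  proof eventually_elim
    case (elim w)
    then show ?case unfolding bij_betw_def by (metis imageE)
  qed
qed

lemma matching_structure:
  "AE w in M. (\<forall>e\<in>E w. set_uprod e \<subseteq> P w) \<and> (\<forall>x. Upair x x \<notin> E w) \<and>
     (\<forall>x\<in>P w. finite (nbrs (E w) x) \<and> card (nbrs (E w) x) = D w x) \<and>
     (\<forall>x\<in>P w. card {y \<in> nbrs (E w) x. x < y} = R w x) \<and>
     (\<forall>x\<in>P w. \<forall>y\<in>P w. x < y \<longrightarrow>
           y \<in> nbrs (E w) x \<or>
           \<not> (\<exists>z\<in>nbrs (E w) x. x < z \<and> \<bar>x - z\<bar> > \<bar>x - y\<bar>) \<or>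
           \<not> (\<exists>z\<in>nbrs (E w) y. z < y \<and> \<bar>z - y\<bar> > \<bar>x - y\<bar>))"
  using matching
  unfolding random_direction_stable_multimatching_def matching_scheme_def
  by (simp add: nbrs_def)

text \<open>
  As all degrees are \<open>2\<close>, the conditional law of the direction marks does not depend on the condition,
  so the recurrence theorem applies. It is used with the points \<open>X i\<close> to the right of every integer and
  with the reflected points \<open>- X i\<close> and steps to the left of every integer. With integer base
  points the exceptional set is a countable union of null sets.
\<close>

theorem no_infinite_component:
  assumes two: "set_pmf \<mu> = {2}"
  shows "AE w in M. \<not> (\<exists>x\<in>P w. infinite (component (P w) (E w) x))"
proof -
  obtain X :: "nat \<Rightarrow> 'w \<Rightarrow> real" where X': "\<forall>i. X i \<in> borel_measurable F_marked" "AE w in M. bij_betw (\<lambda>i. X i w) UNIV (P w)"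
    "\<forall>i. (\<lambda>w. R w (X i w)) \<in> M \<rightarrow>\<^sub>M count_space UNIV"
    "\<forall>n. \<forall>r. AE w in M. real_cond_exp M F_marked (indicator {w \<in> space M. \<forall>i<n. R w (X i w) = r i}) w =
             (\<Prod>i<n. pmf (binomial_pmf (D w (X i w)) (1/2)) (r i))"
    using direction_enum by (elim exE conjE) (rule that, assumption+)
  note X = X'(1)[rule_format] X'(2) X'(3)[rule_format] X'(4)[rule_format]
  have D2: "AE w in M. \<forall>x\<in>P w. D w x = 2" using degree_in_support two by simp
  have cond: "AE w in M. real_cond_exp M F_marked (indicator {w \<in> space M. \<forall>i<n. R w (X i w) = r i}) w =
             (\<Prod>i<n. pmf (binomial_pmf 2 (1/2)) (r i))" for n r
    using X(4)[of n r] D2 X(2)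
  proof eventually_elim
    case (elim w)
    have "X i w \<in> P w" for i using elim(3) by (auto simp: bij_betw_def)
    then show ?case using elim by simp
  qed
  have lf: "AE w in M. \<forall>a b. finite (P w \<inter> {a..b})"
    using poisson prob by (rule poisson_locally_finite)
  have inf_right: "AE w in M. infinite (P w \<inter> {c..})" for c
    by (rule poisson_infinite[OF poisson prob, of "\<lambda>n. {c..c + real n}"]) auto
  have inf_left: "AE w in M. infinite (P w \<inter> {..c})" for c
    by (rule poisson_infinite[OF poisson prob, of "\<lambda>n. {c - real n..c}"]) auto
  have card_eq: "infinite {i. X i w \<in> T} \<longleftrightarrow> infinite (P w \<inter> T)" if "bij_betw (\<lambda>i. X i w) UNIV (P w)" for w T
  proof -
    have "bij_betw (\<lambda>i. X i w) {i. X i w \<in> T} (P w \<inter> T)"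
      using that by (rule bij_betw_vimage_Int)
    then show ?thesis by (simp add: bij_betw_finite)
  qed
  have sum_eq: "(\<Sum>j | X j w \<in> T. int (R w (X j w)) - 1) = (\<Sum>x\<in>P w \<inter> T. int (R w x) - 1)"
    if "bij_betw (\<lambda>i. X i w) UNIV (P w)" for w T
  proof -
    have "bij_betw (\<lambda>i. X i w) {i. X i w \<in> T} (P w \<inter> T)"
      using that by (rule bij_betw_vimage_Int)
    then show ?thesis by (rule sum.reindex_bij_betw)
  qed
  have down: "AE w in M. \<forall>(c :: int) (k :: nat). \<exists>y\<in>P w. c \<le> y \<and> (\<Sum>x\<in>P w \<inter> {of_int c..y}. int (R w x) - 1) \<le> - int k"
    unfolding AE_all_countable
  proof (intro allI)
    fix c :: int and k :: nat
    have "AE w in M. \<exists>i. of_int c \<le> X i w \<and>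
        1 * (\<Sum>j | of_int c \<le> X j w \<and> X j w \<le> X i w. int (R w (X j w)) - 1) \<le> - int k"
    proof (rule marks_walk_unbounded[OF prob subalgebra_marked X(3) cond X(1)])
      show "AE w in M. inj (\<lambda>i. X i w)"
        using X(2) by eventually_elim (auto simp: bij_betw_def)
      show "AE w in M. infinite {i. of_int c \<le> X i w}"
        using X(2) inf_right[of "of_int c"]
        by eventually_elim (use card_eq[of _ "{of_int c..}"] in simp)
      show "AE w in M. \<forall>b. finite {i. X i w \<in> {of_int c..b}}"
        using X(2) lf by eventually_elim (use card_eq in blast)
    qed simp
    then show "AE w in M. \<exists>y\<in>P w. c \<le> y \<and> (\<Sum>x\<in>P w \<inter> {of_int c..y}. int (R w x) - 1) \<le> - int k"
      using X(2)
    proof eventually_elim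
      case (elim w)
      then obtain i where i: "of_int c \<le> X i w"
        "(\<Sum>j | X j w \<in> {of_int c..X i w}. int (R w (X j w)) - 1) \<le> - int k"
        by auto
      moreover have "X i w \<in> P w" using elim(2) by (auto simp: bij_betw_def)
      ultimately show ?case unfolding sum_eq[OF elim(2)] by (intro bexI[of _ "X i w"]) auto
    qed
  qed
  have up: "AE w in M. \<forall>(c :: int) (k :: nat). \<exists>x\<in>P w. x \<le> c \<and> int k \<le> (\<Sum>x\<in>P w \<inter> {x..of_int c}. int (R w x) - 1)"
    unfolding AE_all_countable
  proof (intro allI)
    fix c :: int and k :: nat
    have "AE w in M. \<exists>i. - of_int c \<le> - X i w \<and>
        - 1 * (\<Sum>j | - of_int c \<le> - X j w \<and> - X j w \<le> - X i w. int (R w (X j w)) - 1) \<le> - int k"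
    \<comment> \<open>the line read from right to left\<close>
    proof (rule marks_walk_unbounded[where X = "\<lambda>i w. - X i w", OF prob subalgebra_marked X(3) cond])
      show "(\<lambda>w. - X i w) \<in> borel_measurable F_marked" for i using X(1) by simp
      show "AE w in M. inj (\<lambda>i. - X i w)"
        using X(2) by eventually_elim (auto simp: bij_betw_def inj_on_def)
      show "AE w in M. infinite {i. - of_int c \<le> - X i w}"
        using X(2) inf_left[of "of_int c"]
        by eventually_elim (use card_eq[of _ "{..of_int c}"] in simp)
      show "AE w in M. \<forall>b. finite {i. - X i w \<in> {- of_int c..b}}"
        using X(2) lf
      proof eventually_elim
        case (elim w)
        show ?case
        proof
          fix b
          have "{i. - X i w \<in> {- of_int c..b}} = {i. X i w \<in> {- b..of_int c}}" by auto
          then show "finite {i. - X i w \<in> {- of_int c..b}}"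
            using card_eq[OF elim(1), of "{- b..of_int c}"] elim(2) by simp
        qed
      qed
    qed simp
    then show "AE w in M. \<exists>x\<in>P w. x \<le> c \<and> int k \<le> (\<Sum>x\<in>P w \<inter> {x..of_int c}. int (R w x) - 1)"
      using X(2)
    proof eventually_elim
      case (elim w)
      then obtain i where i: "X i w \<le> of_int c"
        "int k \<le> (\<Sum>j | X j w \<le> of_int c \<and> X i w \<le> X j w. int (R w (X j w)) - 1)"
        by auto
      have "{j. X j w \<le> of_int c \<and> X i w \<le> X j w} = {j. X j w \<in> {X i w..of_int c}}" by auto
      then have "int k \<le> (\<Sum>x\<in>P w \<inter> {X i w..of_int c}. int (R w x) - 1)"
        using i(2) sum_eq[OF elim(2), of "{X i w..of_int c}"] by simp
      moreover have "X i w \<in> P w" using elim(2) by (auto simp: bij_betw_def)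
      ultimately show ?case using i(1) by (intro bexI[of _ "X i w"]) auto
    qed
  qed
  show ?thesis
    using down up matching_structure D2 lf
  proof eventually_elim
    case (elim w)
    interpret G: stable_two_regular "P w" "E w" "R w"
    proof
      fix x y assume "x \<in> P w" "y \<in> P w" "x < y"
      then show "y \<in> nbrs (E w) x \<or> \<not> (\<exists>z\<in>nbrs (E w) x. x < z \<and> \<bar>x - z\<bar> > \<bar>x - y\<bar>) \<or>
           \<not> (\<exists>z\<in>nbrs (E w) y. z < y \<and> \<bar>z - y\<bar> > \<bar>x - y\<bar>)"
        using elim(3) by blast
    qed (use elim in auto)
    have "finite (component (P w) (E w) x)" if "x \<in> P w" for x
      by (rule G.component_finite) (use elim(1,2) that in \<open>auto simp: G.walk_def\<close>)
    then show ?case by blast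
  qed
qed

section \<open>The Palm version\<close>

lemma sets_palm: "sets (palm M P D E) = sets matched_algebra"
  unfolding palm_def by (simp add: sets.space_closed sets.sigma_sets_eq)

lemma poisson_intensity: "(\<integral>\<^sup>+w. npts (P w) {0..<1} \<partial>M) = 1"
proof -
  have "AE w in M. finite (P w \<inter> {0..<1})"
    using poisson prob by (intro poisson_expectation(1)) auto
  then have "(\<integral>\<^sup>+w. npts (P w) {0..<1} \<partial>M) = (\<integral>\<^sup>+w. of_nat (card (P w \<inter> {0..<1})) \<partial>M)"
    by (intro nn_integral_cong_AE) (auto elim!: eventually_mono simp: npts_finite)
  also have "\<dots> = (\<Sum>k. of_nat k * ennreal (measure lborel {0..<1 :: real} ^ k / fact k * exp (- measure lborel {0..<1 :: real})))"
    using poisson prob by (intro poisson_expectation(2)) auto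
  also have "\<dots> = (\<Sum>k. ennreal (real k * (1 / fact k * exp (- 1))))"
    by (intro suminf_cong) (subst ennreal_mult', simp_all add: ennreal_of_nat_eq_real_of_nat)
  also have "\<dots> = ennreal 1"
  proof (rule suminf_ennreal_eq)
    have "(\<lambda>k. 1 / fact k * exp (- 1 :: real)) sums (exp 1 * exp (- 1))"
      using sums_mult2[OF exp_converges[of "1 :: real"], of "exp (- 1)"] by (simp add: divide_inverse mult_ac)
    moreover have "real (Suc k) * (1 / fact (Suc k) * exp (- 1)) = 1 / fact k * exp (- 1 :: real)" for k
      unfolding fact_Suc by (simp del: of_nat_Suc)
    moreover have "exp 1 * exp (- 1) = (1 :: real)" by (simp flip: exp_add)
    ultimately have "(\<lambda>k. real (Suc k) * (1 / fact (Suc k) * exp (- 1))) sums 1"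
      by (simp only:)
    then show "(\<lambda>k. real k * (1 / fact k * exp (- 1))) sums 1"
      using sums_Suc[of "\<lambda>k. real k * (1 / fact k * exp (- 1))" 1] by simp
  qed simp
  finally show ?thesis by simp
qed

text \<open>
  The set function that defines the Palm law counts indices, so it is the image of the product of \<open>M\<close>
  with counting measure on the indices, restricted to \<open>X i w \<in> [0, 1)\<close>, under the map that shifts the configuration
  by \<open>- X i w\<close>. This map is measurable once the configurations are replaced by empty ones
  on the null set where they fail to be locally finite.
\<close>

theorem palm_campbell:
  "\<exists>X :: nat \<Rightarrow> 'w \<Rightarrow> real. (AE w in M. bij_betw (\<lambda>i. X i w) UNIV (P w)) \<and>
    (\<forall>g\<in>borel_measurable matched_algebra.
      (\<integral>\<^sup>+c. g c \<partial>palm M P D E) = (\<integral>\<^sup>+w. (\<Sum>i. indicator {0..<1} (X i w) *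
         g (shift_matched (- X i w) (P w, marked_points P D w, E w))) \<partial>M))"
proof -
  obtain X :: "nat \<Rightarrow> 'w \<Rightarrow> real" where X': "\<forall>i. X i \<in> borel_measurable F_pts" "AE w in M. bij_betw (\<lambda>i. X i w) UNIV (P w)"
    using degree_enum by (elim exE conjE) (rule that, assumption+)
  note X = X'(1)[rule_format] X'(2)
  have [measurable]: "X i \<in> borel_measurable M" for i
    using X(1) by (rule measurable_from_subalg[OF subalgebra_pts])
  have "AE w in M. bij_betw (\<lambda>i. X i w) UNIV (P w) \<and> (\<forall>a b. finite (P w \<inter> {a..b})) \<and> (\<forall>e\<in>E w. set_uprod e \<subseteq> P w)"
    using X(2) poisson_locally_finite[OF poisson prob] matching_structure by eventually_elim blast
  then obtain N where N: "N \<in> null_sets M"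
    "\<And>w. w \<in> space M - N \<Longrightarrow> bij_betw (\<lambda>i. X i w) UNIV (P w) \<and> (\<forall>a b. finite (P w \<inter> {a..b})) \<and> (\<forall>e\<in>E w. set_uprod e \<subseteq> P w)"
    by (rule AE_E3) (rule that)
  \<comment> \<open>a measurable set of full measure on which all configurations are locally finite\<close>
  define G where "G = space M - N"
  have G [measurable]: "G \<in> sets M" using N(1) by (auto simp: G_def)
  have AE_G: "AE w in M. w \<in> G"
    using AE_not_in[OF N(1)] AE_space by eventually_elim (simp add: G_def)
  define P0 where "P0 w = (if w \<in> G then P w else {})" for w
  define Z0 where "Z0 w = (if w \<in> G then marked_points P D w else {})" for w
  define E0 where "E0 w = (if w \<in> G then E w else {})" for w
  have meas0: "P0 \<in> M \<rightarrow>\<^sub>M config_algebra borel" "Z0 \<in> M \<rightarrow>\<^sub>M config_algebra (borel \<Otimes>\<^sub>M count_space UNIV)"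
    "E0 \<in> M \<rightarrow>\<^sub>M config_algebra upair_algebra"
    unfolding P0_def Z0_def E0_def
    using measurable_empty_config measurable_P measurable_marked measurable_E unfolding marked_algebra_def
    by (auto intro!: measurable_If_set)
  have fin0: "finite (P0 w \<inter> {a..b})" for w a b
    using N(2)[of w] by (auto simp: P0_def G_def)
  have box: "\<exists>n. - real n \<le> x \<and> x \<le> real n" for x
  proof -
    obtain n where "\<bar>x\<bar> \<le> real n" using real_arch_simple by blast
    then show ?thesis by (intro exI[of _ n]) auto
  qed
  have shift_P: "(\<lambda>w. shift_pts (- X i w) (P0 w)) \<in> M \<rightarrow>\<^sub>M config_algebra borel" for i
    unfolding shift_pts_def
  proof (rule measurable_config_image[OF meas0(1), where B = "\<lambda>n. {- real n..real n}"])
    show "(\<Union>n. {- real n..real n}) = space borel"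
      using box by auto
    show "incseq (\<lambda>n. {- real n..real n})" by (auto simp: incseq_def)
    show "npts (P0 w) {- real n..real n} < top" for w n using fin0 by (simp add: npts_less_top_iff)
  qed (auto simp: inj_on_def)
  have shift_Z: "(\<lambda>w. shift_marked (- X i w) (Z0 w)) \<in> M \<rightarrow>\<^sub>M config_algebra (borel \<Otimes>\<^sub>M count_space UNIV)" for i
    unfolding shift_marked_def
  proof (rule measurable_config_image[OF meas0(2), where B = "\<lambda>n. {- real n..real n} \<times> UNIV"])
    show "(\<Union>n. {- real n..real n} \<times> UNIV) = space (borel \<Otimes>\<^sub>M count_space UNIV)"
      using box by (auto simp: space_pair_measure)
    show "incseq (\<lambda>n. {- real n..real n} \<times> UNIV)" by (auto simp: incseq_def)
    show "npts (Z0 w) ({- real n..real n} \<times> UNIV) < top" for w n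
    proof -
      have "Z0 w \<inter> {- real n..real n} \<times> UNIV \<subseteq> (\<lambda>x. (x, D w x)) ` (P0 w \<inter> {- real n..real n})"
        by (auto simp: Z0_def P0_def marked_points_def)
      then show ?thesis
        using fin0 by (auto simp: npts_less_top_iff intro: finite_subset)
    qed
  qed (auto simp: inj_on_def)
  have shift_E: "(\<lambda>w. shift_edges (- X i w) (E0 w)) \<in> M \<rightarrow>\<^sub>M config_algebra upair_algebra" for i
    unfolding shift_edges_def
  proof (rule measurable_config_image[OF meas0(3), where B = "\<lambda>n. {e. set_uprod e \<subseteq> {- real n..real n}}"])
    show "{e. set_uprod e \<subseteq> {- real n..real n}} \<in> sets upair_algebra" for n
      by (rule sets_upair_algebraI) simp
    have "\<exists>n. set_uprod e \<subseteq> {- real n..real n}" for e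
    proof (cases e)
      case (Upair x y)
      obtain n where "max \<bar>x\<bar> \<bar>y\<bar> \<le> real n" using real_arch_simple by blast
      then show ?thesis using Upair by (intro exI[of _ n]) auto
    qed
    then show "(\<Union>n. {e. set_uprod e \<subseteq> {- real n..real n}}) = space upair_algebra" by auto
    show "incseq (\<lambda>n. {e. set_uprod e \<subseteq> {- real n..real n}})" by (fastforce simp: incseq_def)
    show "npts (E0 w) {e. set_uprod e \<subseteq> {- real n..real n}} < top" for w n
    proof -
      let ?V = "P0 w \<inter> {- real n..real n}"
      have "E0 w \<inter> {e. set_uprod e \<subseteq> {- real n..real n}} \<subseteq> (\<lambda>(x, y). Upair x y) ` (?V \<times> ?V)"
      proof
        fix e assume e: "e \<in> E0 w \<inter> {e. set_uprod e \<subseteq> {- real n..real n}}"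
        then have "set_uprod e \<subseteq> ?V" using N(2)[of w] by (auto simp: E0_def P0_def G_def split: if_splits)
        then show "e \<in> (\<lambda>(x, y). Upair x y) ` (?V \<times> ?V)" by (cases e) auto
      qed
      then show ?thesis
        using fin0 by (auto simp: npts_less_top_iff intro: finite_subset)
    qed
    show "(\<lambda>(w, x). map_uprod (\<lambda>x. x + - X i w) x) \<in> M \<Otimes>\<^sub>M upair_algebra \<rightarrow>\<^sub>M upair_algebra"
      by (rule measurable_map_uprod_shift) measurable
    show "inj_on (map_uprod (\<lambda>x. x + - X i w)) (space upair_algebra)" for w
      by (rule inj_on_subset[OF uprod.inj_map]) (auto simp: inj_on_def)
  qed
  define \<Phi> where "\<Phi> i w = shift_matched (- X i w) (P0 w, Z0 w, E0 w)" for i w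
  have [measurable]: "\<Phi> i \<in> M \<rightarrow>\<^sub>M matched_algebra" for i
    unfolding \<Phi>_def shift_matched_def matched_algebra_def marked_algebra_def prod.case
    using shift_P shift_Z shift_E by (intro measurable_Pair)
  define Q where "Q = distr (density (count_space UNIV \<Otimes>\<^sub>M M) (\<lambda>(i, w). indicator {0..<1} (X i w)))
     matched_algebra (\<lambda>(i, w). \<Phi> i w)"
  have [measurable]: "(\<lambda>(i, w). indicator {0..<1} (X i w) :: ennreal) \<in> borel_measurable (count_space UNIV \<Otimes>\<^sub>M M)"
    by (rule measurable_pair_measure_countable1) auto
  have [measurable]: "(\<lambda>(i, w). \<Phi> i w) \<in> count_space UNIV \<Otimes>\<^sub>M M \<rightarrow>\<^sub>M matched_algebra"
    by (rule measurable_pair_measure_countable1) auto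
  have Q: "(\<integral>\<^sup>+c. g c \<partial>Q) = (\<integral>\<^sup>+w. (\<Sum>i. indicator {0..<1} (X i w) *
         g (shift_matched (- X i w) (P w, marked_points P D w, E w))) \<partial>M)"
    if g [measurable]: "g \<in> borel_measurable matched_algebra" for g
  proof -
    have "(\<integral>\<^sup>+c. g c \<partial>Q) = (\<integral>\<^sup>+z. (case z of (i, w) \<Rightarrow> indicator {0..<1} (X i w) * g (\<Phi> i w)) \<partial>(count_space UNIV \<Otimes>\<^sub>M M))"
      unfolding Q_def
      by (subst nn_integral_distr, measurable, subst nn_integral_density, measurable)
        (auto intro!: nn_integral_cong)
    also have "\<dots> = (\<integral>\<^sup>+i. (\<integral>\<^sup>+w. indicator {0..<1} (X i w) * g (\<Phi> i w) \<partial>M) \<partial>count_space UNIV)"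
      by (subst nn_integral_fst[symmetric]) (auto intro!: measurable_pair_measure_countable1)
    also have "\<dots> = (\<integral>\<^sup>+w. (\<Sum>i. indicator {0..<1} (X i w) * g (\<Phi> i w)) \<partial>M)"
      by (simp add: nn_integral_count_space_nat nn_integral_suminf)
    also have "\<dots> = (\<integral>\<^sup>+w. (\<Sum>i. indicator {0..<1} (X i w) *
         g (shift_matched (- X i w) (P w, marked_points P D w, E w))) \<partial>M)"
      using AE_G by (intro nn_integral_cong_AE) (auto elim!: eventually_mono simp: \<Phi>_def P0_def Z0_def E0_def)
    finally show ?thesis .
  qed
  have sets_Q: "sets Q = sets matched_algebra" "space Q = space matched_algebra" by (auto simp: Q_def)
  have "emeasure Q A = (\<integral>\<^sup>+ w. npts {x \<in> P w. shift_matched (- x) (P w, marked_points P D w, E w) \<in> A} {0..<1} \<partial>M)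
          / (\<integral>\<^sup>+ w. npts (P w) {0..<1} \<partial>M)" if A: "A \<in> sets matched_algebra" for A
  proof -
    have "emeasure Q A = (\<integral>\<^sup>+c. indicator A c \<partial>Q)" using A sets_Q by simp
    also have "\<dots> = (\<integral>\<^sup>+w. (\<Sum>i. indicator {0..<1} (X i w) *
         indicator A (shift_matched (- X i w) (P w, marked_points P D w, E w))) \<partial>M)"
      by (rule Q) (use A in measurable)
    also have "\<dots> = (\<integral>\<^sup>+ w. npts {x \<in> P w. shift_matched (- x) (P w, marked_points P D w, E w) \<in> A} {0..<1} \<partial>M)"
    proof (rule nn_integral_cong_AE)
      show "AE w in M. (\<Sum>i. indicator {0..<1} (X i w) *
         indicator A (shift_matched (- X i w) (P w, marked_points P D w, E w))) =
         npts {x \<in> P w. shift_matched (- x) (P w, marked_points P D w, E w) \<in> A} {0..<1}"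
        using X(2)
      proof eventually_elim
        case (elim w)
        show ?case
          unfolding npts_enum[OF elim] by (intro suminf_cong) (simp add: indicator_def)
      qed
    qed
    finally show ?thesis by (simp add: poisson_intensity divide_ennreal_def)
  qed
  then have "palm M P D E = measure_of (space Q) (sets Q) (emeasure Q)"
    unfolding palm_def sets_Q
    by (intro measure_of_eq) (auto simp: sets.space_closed sets.sigma_sets_eq)
  then have "palm M P D E = Q" by (simp add: measure_of_of_measure)
  then show ?thesis using X(2) Q by (intro exI[of _ X]) simp
qed

section \<open>Edges leaving an interval\<close>

definition crossing :: "nat \<Rightarrow> real uprod set" where
  "crossing n = {e. \<exists>x y. e = Upair x y \<and> x \<in> {0..<real n} \<and> y \<notin> {0..<real n}}"

text \<open>
  By cancellation of the inner edges, the imbalance of \<open>[0, n)\<close> is a signed count of the edges that leave it.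
\<close>

lemma imbalance_le_crossing:
  assumes w: "finite (P w \<inter> {0..<real n})" "\<And>e. e \<in> E w \<Longrightarrow> set_uprod e \<subseteq> P w"
    "\<And>x. x \<in> P w \<Longrightarrow> finite (nbrs (E w) x) \<and> card (nbrs (E w) x) = D w x"
    "\<And>x. x \<in> P w \<Longrightarrow> card {y \<in> nbrs (E w) x. x < y} = R w x" "\<And>x. Upair x x \<notin> E w"
  shows "ennreal \<bar>\<Sum>x\<in>P w \<inter> {0..<real n}. 2 * real (R w x) - real (D w x)\<bar> \<le> npts (E w) (crossing n)"
proof -
  let ?A = "P w \<inter> {0..<real n}"
  let ?r = "\<lambda>x. {y \<in> nbrs (E w) x - ?A. x < y}" and ?l = "\<lambda>x. {y \<in> nbrs (E w) x - ?A. y < x}"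
  have fin: "finite (nbrs (E w) x)" if "x \<in> ?A" for x using w(3) that by blast
  have "(\<Sum>x\<in>?A. 2 * real (R w x) - real (D w x)) =
      real_of_int (\<Sum>x\<in>?A. int (card {y \<in> nbrs (E w) x. x < y}) - int (card {y \<in> nbrs (E w) x. y < x}))"
    unfolding of_int_sum
  proof (rule sum.cong)
    fix x assume x: "x \<in> ?A"
    have eq: "nbrs (E w) x = {y \<in> nbrs (E w) x. x < y} \<union> {y \<in> nbrs (E w) x. y < x}"
      using w(5)[of x] by (auto simp: nbrs_def) (metis linorder_less_linear)
    have "card ({y \<in> nbrs (E w) x. x < y} \<union> {y \<in> nbrs (E w) x. y < x}) =
        card {y \<in> nbrs (E w) x. x < y} + card {y \<in> nbrs (E w) x. y < x}"
      by (rule card_Un_disjoint) (use fin[OF x] in auto)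
    then have "D w x = R w x + card {y \<in> nbrs (E w) x. y < x}"
      using w(3,4)[of x] x unfolding eq[symmetric] by simp
    then show "2 * real (R w x) - real (D w x) =
        real_of_int (int (card {y \<in> nbrs (E w) x. x < y}) - int (card {y \<in> nbrs (E w) x. y < x}))"
      using w(4)[of x] x by simp
  qed simp
  also have "\<dots> = real_of_int ((\<Sum>x\<in>?A. int (card (?r x))) - (\<Sum>x\<in>?A. int (card (?l x))))"
    using w(1) fin by (subst stub_imbalance_eq_boundary) auto
  finally have eq: "(\<Sum>x\<in>?A. 2 * real (R w x) - real (D w x)) =
      real_of_int ((\<Sum>x\<in>?A. int (card (?r x))) - (\<Sum>x\<in>?A. int (card (?l x))))" .
  have "\<bar>\<Sum>x\<in>?A. 2 * real (R w x) - real (D w x)\<bar> \<le> real (\<Sum>x\<in>?A. card (?r x) + card (?l x))"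
  proof -
    have "\<bar>a - b\<bar> \<le> a + b" if "0 \<le> a" "0 \<le> b" for a b :: real using that by simp
    from this[of "\<Sum>x\<in>?A. real (card (?r x))" "\<Sum>x\<in>?A. real (card (?l x))"] show ?thesis
      unfolding eq by (simp add: sum.distrib sum_nonneg)
  qed
  also have "real (\<Sum>x\<in>?A. card (?r x) + card (?l x)) \<le> real (\<Sum>x\<in>?A. card (nbrs (E w) x - ?A))"
  proof (intro of_nat_mono sum_mono)
    fix x assume x: "x \<in> ?A"
    have "card (?r x) + card (?l x) = card (?r x \<union> ?l x)"
      by (rule card_Un_disjoint[symmetric]) (use fin[OF x] in auto)
    also have "\<dots> \<le> card (nbrs (E w) x - ?A)" by (rule card_mono) (use fin[OF x] in auto)
    finally show "card (?r x) + card (?l x) \<le> card (nbrs (E w) x - ?A)" .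
  qed
  also have "(\<Sum>x\<in>?A. card (nbrs (E w) x - ?A)) = card (SIGMA x:?A. nbrs (E w) x - ?A)"
    using w(1) fin by simp
  finally have "ennreal \<bar>\<Sum>x\<in>?A. 2 * real (R w x) - real (D w x)\<bar> \<le> of_nat (card (SIGMA x:?A. nbrs (E w) x - ?A))"
    by (simp add: ennreal_of_nat_eq_real_of_nat ennreal_leI)
  also have "\<dots> = of_nat (card ((\<lambda>(x, y). Upair x y) ` (SIGMA x:?A. nbrs (E w) x - ?A)))"
    by (subst card_image) (auto simp: inj_on_def)
  also have "\<dots> = emeasure (count_space UNIV) ((\<lambda>(x, y). Upair x y) ` (SIGMA x:?A. nbrs (E w) x - ?A))"
    by (subst emeasure_count_space_finite) (auto intro!: finite_imageI finite_SigmaI w(1) finite_Diff fin)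
  also have "\<dots> \<le> npts (E w) (crossing n)"
    unfolding npts_def
  proof (rule emeasure_mono)
    show "(\<lambda>(x, y). Upair x y) ` (SIGMA x:?A. nbrs (E w) x - ?A) \<subseteq> E w \<inter> crossing n"
    proof
      fix e assume "e \<in> (\<lambda>(x, y). Upair x y) ` (SIGMA x:?A. nbrs (E w) x - ?A)"
      then obtain x y where e: "e = Upair x y" "x \<in> ?A" "y \<in> nbrs (E w) x" "y \<notin> ?A" by fast
      then have "e \<in> E w" by (simp add: nbrs_def)
      moreover from this have "y \<in> P w" using w(2)[of e] e(1) by auto
      ultimately show "e \<in> E w \<inter> crossing n" using e unfolding crossing_def by blast
    qed
  qed simp
  finally show ?thesis .
qed

text \<open>
  The generating function of the Poisson law: the mean of \<open>c ^ N\<close> is \<open>exp (- n (1 - c))\<close>.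
\<close>

lemma poisson_laplace:
  assumes c: "0 \<le> c" "c \<le> 1"
  shows "(\<integral>\<^sup>+w. ennreal (1 - c ^ card (P w \<inter> {0..<real n})) \<partial>M) = ennreal (1 - exp (- real n * (1 - c)))"
proof -
  have "(\<integral>\<^sup>+w. ennreal (1 - c ^ card (P w \<inter> {0..<real n})) \<partial>M) =
      (\<Sum>k. ennreal (1 - c ^ k) * ennreal (real n ^ k / fact k * exp (- real n)))"
    using poisson_expectation(2)[OF poisson _ _ prob, of "{0..<real n}" "\<lambda>k. ennreal (1 - c ^ k)"] by simp
  also have "\<dots> = (\<Sum>k. ennreal ((1 - c ^ k) * (real n ^ k / fact k * exp (- real n))))"
    using c by (intro suminf_cong ennreal_mult[symmetric]) (auto simp: power_le_one)
  also have "\<dots> = ennreal (1 - exp (- real n * (1 - c)))"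
  proof (rule suminf_ennreal_eq)
    have s: "(\<lambda>k. x ^ k / fact k * exp (- real n)) sums (exp x * exp (- real n))" for x
      using sums_mult2[OF exp_converges[of x], of "exp (- real n)"] by (simp add: divide_inverse mult_ac)
    have "(\<lambda>k. real n ^ k / fact k * exp (- real n) - (c * real n) ^ k / fact k * exp (- real n)) sums
        (exp (real n) * exp (- real n) - exp (c * real n) * exp (- real n))"
      by (intro sums_diff s)
    moreover have "exp (real n) * exp (- real n) - exp (c * real n) * exp (- real n) = 1 - exp (- real n * (1 - c))"
      by (simp add: algebra_simps flip: exp_add)
    moreover have "real n ^ k / fact k * exp (- real n) - (c * real n) ^ k / fact k * exp (- real n) =
        (1 - c ^ k) * (real n ^ k / fact k * exp (- real n))" for k
      by (simp add: power_mult_distrib left_diff_distrib diff_divide_distrib)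
    ultimately show "(\<lambda>k. (1 - c ^ k) * (real n ^ k / fact k * exp (- real n))) sums (1 - exp (- real n * (1 - c)))"
      by simp
    show "0 \<le> (1 - c ^ k) * (real n ^ k / fact k * exp (- real n))" for k
      using c by (auto simp: power_le_one)
  qed
  finally show ?thesis .
qed

text \<open>
  The degree of the \<open>i\<close>-th point is almost surely a function of the marked configuration: it is the
  \<open>k\<close> such that the configuration has a point at \<open>(X i, k)\<close>. It is used as part of the information
  on which the direction marks are conditioned.
\<close>

lemma measurable_degree:
  assumes X: "\<And>i. X i \<in> borel_measurable F_marked" "AE w in M. bij_betw (\<lambda>i. X i w) UNIV (P w)"
    and b: "\<And>d. d \<in> set_pmf \<mu> \<Longrightarrow> d \<le> b"
  obtains d :: "nat \<Rightarrow> 'w \<Rightarrow> real" where "\<And>i. d i \<in> borel_measurable F_marked"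
    "AE w in M. \<forall>i. d i w = real (D w (X i w))"
proof -
  let ?N = "borel \<Otimes>\<^sub>M count_space UNIV :: (real \<times> nat) measure"
  let ?box = "\<lambda>n. {- real n..real n} \<times> (UNIV :: nat set)"
  note X(1)[measurable]
  have space_F: "space F_marked = space M" by (simp add: F_marked_def)
  have Z [measurable]: "marked_points P D \<in> F_marked \<rightarrow>\<^sub>M config_algebra ?N"
    unfolding F_marked_def marked_algebra_def
    by (rule measurable_vimage_algebra1)
      (use measurable_space[OF measurable_marked] in \<open>auto simp: marked_algebra_def\<close>)
  have box [measurable]: "?box n \<in> sets ?N" for n by measurable
  define G where "G = {w \<in> space F_marked. \<forall>n. npts (marked_points P D w) (?box n) < top}"
  have [measurable]: "G \<in> sets F_marked" unfolding G_def by measurable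
  define Z0 where "Z0 w = (if w \<in> G then marked_points P D w else {})" for w
  have Z0: "Z0 \<in> F_marked \<rightarrow>\<^sub>M config_algebra ?N"
    unfolding Z0_def using measurable_empty_config by (intro measurable_If_set) auto
  have atom: "(\<lambda>w. npts (Z0 w) {(X i w, k)}) \<in> borel_measurable F_marked" for i k
  proof -
    define C where "C = {z \<in> space (F_marked \<Otimes>\<^sub>M ?N). fst (snd z) = X i (fst z) \<and> snd (snd z) = k}"
    have "(\<lambda>w. npts (Z0 w) (Pair w -` C)) \<in> borel_measurable F_marked"
    proof (rule measurable_npts_section[OF Z0, where B = ?box])
      show "C \<in> sets (F_marked \<Otimes>\<^sub>M ?N)" unfolding C_def by measurable
      show "incseq ?box" by (auto simp: incseq_def)
      have "\<exists>n. - real n \<le> x \<and> x \<le> real n" for x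
      proof -
        obtain n where "\<bar>x\<bar> \<le> real n" using real_arch_simple by blast
        then show ?thesis by (intro exI[of _ n]) auto
      qed
      then show "(\<Union>n. ?box n) = space ?N" by (auto simp: space_pair_measure)
      show "npts (Z0 w) (?box n) < top" for w n
        by (cases "w \<in> G") (auto simp: Z0_def G_def npts_def)
    qed (rule box)
    moreover have "Pair w -` C = {(X i w, k)}" if "w \<in> space F_marked" for w
      using that by (auto simp: C_def space_pair_measure)
    ultimately show ?thesis by (simp cong: measurable_cong)
  qed
  \<comment> \<open>exactly one summand is nonzero, the one for the mark at \<open>X i w\<close>\<close>
  define d where "d i w = (\<Sum>k\<le>b. real k * of_bool (npts (Z0 w) {(X i w, k)} \<noteq> 0))" for i w
  have "d i \<in> borel_measurable F_marked" for i
    unfolding d_def using atom[measurable] by measurable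
  moreover have "AE w in M. \<forall>i. d i w = real (D w (X i w))"
    using X(2) poisson_locally_finite[OF poisson prob] degree_in_support AE_space
  proof eventually_elim
    case (elim w)
    have fin: "npts (marked_points P D w) (?box n) < top" for n
    proof -
      have "marked_points P D w \<inter> ?box n \<subseteq> (\<lambda>x. (x, D w x)) ` (P w \<inter> {- real n..real n})"
        by (auto simp: marked_points_def)
      then show ?thesis using elim(2) by (auto simp: npts_less_top_iff intro: finite_subset)
    qed
    then have Zw: "Z0 w = marked_points P D w" using elim(4) by (simp add: Z0_def G_def space_F)
    show ?case
    proof
      fix i
      have Xi: "X i w \<in> P w" using elim(1) by (auto simp: bij_betw_def)
      have "npts (Z0 w) {(X i w, k)} \<noteq> 0 \<longleftrightarrow> k = D w (X i w)" for k
        using Xi by (auto simp: Zw npts_def marked_points_def emeasure_count_space_eq_0)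
      then have "d i w = (\<Sum>k\<le>b. if k = D w (X i w) then real k else 0)"
        unfolding d_def by (intro sum.cong) auto
      also have "\<dots> = real (D w (X i w))"
        using b elim(3) Xi by simp
      finally show "d i w = real (D w (X i w))" .
    qed
  qed
  ultimately show thesis by (rule that)
qed

text \<open>
  With \<open>S\<close> the imbalance and \<open>N\<close> the number of points of \<open>[0, n)\<close>, the conditional expectation of
  \<open>1 - cos (\<theta> S)\<close> is \<open>1\<close> minus a product of powers of \<open>cos \<theta>\<close>, hence at least \<open>1 - (cos \<theta>) ^ N\<close>, and
  \<open>1 - cos (\<theta> S) \<le> \<theta> \<bar>S\<bar>\<close>. The law of the marks is known for finitely many indices at a time, so the
  estimate is made on the event \<open>\<Omega> m\<close> that all points of \<open>[0, n)\<close> have an index below \<open>m\<close>, and \<open>m\<close> tends to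
  infinity by monotone convergence.
\<close>

lemma crossing_lower_bound:
  assumes b: "\<And>d. d \<in> set_pmf \<mu> \<Longrightarrow> d \<le> b" and \<theta>: "0 < \<theta>" "0 \<le> cos \<theta>"
  shows "(\<integral>\<^sup>+w. ennreal (1 - cos \<theta> ^ card (P w \<inter> {0..<real n})) \<partial>M)
     \<le> (\<integral>\<^sup>+w. ennreal \<theta> * npts (E w) (crossing n) \<partial>M)"
proof -
  obtain X :: "nat \<Rightarrow> 'w \<Rightarrow> real" where X': "\<forall>i. X i \<in> borel_measurable F_marked" "AE w in M. bij_betw (\<lambda>i. X i w) UNIV (P w)"
    "\<forall>i. (\<lambda>w. R w (X i w)) \<in> M \<rightarrow>\<^sub>M count_space UNIV"
    "\<forall>n. \<forall>r. AE w in M. real_cond_exp M F_marked (indicator {w \<in> space M. \<forall>i<n. R w (X i w) = r i}) w =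
             (\<Prod>i<n. pmf (binomial_pmf (D w (X i w)) (1/2)) (r i))"
    using direction_enum by (elim exE conjE) (rule that, assumption+)
  note X = X'(1)[rule_format] X'(2) X'(3)[rule_format] X'(4)[rule_format]
  note X(1)[measurable]
  obtain d where d: "\<And>i. d i \<in> borel_measurable F_marked" "AE w in M. \<forall>i. d i w = real (D w (X i w))"
    using measurable_degree[OF X(1,2) b] by blast
  note d(1)[measurable]
  let ?I = "{0..<real n}"
  define c where "c i w = \<theta> * indicator ?I (X i w)" for i w
  have [measurable]: "c i \<in> borel_measurable F_marked" for i unfolding c_def by measurable
  define \<Omega> where "\<Omega> m = {w \<in> space F_marked. \<forall>i\<ge>m. X i w \<notin> ?I}" for m
  have [measurable]: "\<Omega> m \<in> sets F_marked" for m unfolding \<Omega>_def by measurable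
  have space_F: "space F_marked = space M" by (simp add: F_marked_def)
  define \<phi> where "\<phi> m w = indicator (\<Omega> m) w * ennreal (1 - cos \<theta> ^ card {i. i < m \<and> X i w \<in> ?I})" for m w
  have cos1: "cos \<theta> \<le> 1" by simp
  have bound: "(\<integral>\<^sup>+w. \<phi> m w \<partial>M) \<le> (\<integral>\<^sup>+w. ennreal \<theta> * npts (E w) (crossing n) \<partial>M)" for m
  proof -
    define h :: "(nat \<Rightarrow> nat) \<Rightarrow> 'w \<Rightarrow> ennreal" where
      "h r w = indicator (\<Omega> m) w * ennreal (1 - cos (\<Sum>i<m. c i w * (2 * real (r i) - d i w)))" for r w
    have "(\<integral>\<^sup>+w. \<phi> m w \<partial>M) \<le> (\<integral>\<^sup>+w. (\<integral>\<^sup>+r. h r w \<partial>Pi_pmf {..<m} 0 (\<lambda>i. binomial_pmf (D w (X i w)) (1/2))) \<partial>M)"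
    proof (rule nn_integral_mono_AE)
      show "AE w in M. \<phi> m w \<le> (\<integral>\<^sup>+r. h r w \<partial>Pi_pmf {..<m} 0 (\<lambda>i. binomial_pmf (D w (X i w)) (1/2)))"
        using d(2) X(2) degree_in_support
      proof eventually_elim
        case (elim w)
        have D1: "1 \<le> D w (X i w)" for i
        proof -
          have "X i w \<in> P w" using elim(2) by (auto simp: bij_betw_def)
          then have "D w (X i w) \<noteq> 0" using elim(3) zero_notin by metis
          then show ?thesis by simp
        qed
        have "(\<Prod>i<m. cos (c i w) ^ D w (X i w)) \<le> (\<Prod>i<m. if X i w \<in> ?I then cos \<theta> else 1)"
        proof (rule prod_mono, intro conjI)
          fix i
          have "cos \<theta> ^ D w (X i w) \<le> cos \<theta> ^ 1"
            by (rule power_decreasing) (use D1 \<theta> cos1 in auto)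
          then show "cos (c i w) ^ D w (X i w) \<le> (if X i w \<in> ?I then cos \<theta> else 1)"
            by (auto simp: c_def)
          show "0 \<le> cos (c i w) ^ D w (X i w)"
            using \<theta> by (auto simp: c_def indicator_def)
        qed
        also have "\<dots> = cos \<theta> ^ card {i. i < m \<and> X i w \<in> ?I}"
          by (simp add: prod.If_cases Int_def)
        finally have "ennreal (1 - cos \<theta> ^ card {i. i < m \<and> X i w \<in> ?I}) \<le> ennreal (1 - (\<Prod>i<m. cos (c i w) ^ D w (X i w)))"
          by (intro ennreal_leI) simp
        also have "\<dots> = (\<integral>\<^sup>+r. ennreal (1 - cos (\<Sum>i<m. c i w * (2 * real (r i) - real (D w (X i w)))))
            \<partial>Pi_pmf {..<m} 0 (\<lambda>i. binomial_pmf (D w (X i w)) (1/2)))"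
          by (rule nn_integral_one_minus_cos[symmetric]) simp
        finally show ?case
          unfolding \<phi>_def h_def using elim(1) by (simp add: nn_integral_cmult mult_left_mono)
      qed
    qed
    also have "\<dots> = (\<integral>\<^sup>+w. h (\<lambda>i. if i < m then R w (X i w) else 0) w \<partial>M)"
      by (rule cond_law_of_marks[where \<rho> = "\<lambda>i w. R w (X i w)" and \<kappa> = "\<lambda>i w. binomial_pmf (D w (X i w)) (1/2)",
            OF prob subalgebra_marked X(3,4), symmetric])
        (simp add: h_def)
    also have "\<dots> \<le> (\<integral>\<^sup>+w. ennreal \<theta> * npts (E w) (crossing n) \<partial>M)"
    proof (rule nn_integral_mono_AE)
      show "AE w in M. h (\<lambda>i. if i < m then R w (X i w) else 0) w \<le> ennreal \<theta> * npts (E w) (crossing n)"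
        using d(2) X(2) matching_structure poisson_locally_finite[OF poisson prob]
      proof eventually_elim
        case (elim w)
        show ?case
        proof (cases "w \<in> \<Omega> m")
          case True
          have "{i. i < m \<and> X i w \<in> ?I} = {i. X i w \<in> ?I}"
            using True by (auto simp: \<Omega>_def not_le[symmetric])
          moreover have "bij_betw (\<lambda>i. X i w) {i. X i w \<in> ?I} (P w \<inter> ?I)"
            using elim(2) by (rule bij_betw_vimage_Int)
          ultimately have bij: "bij_betw (\<lambda>i. X i w) {i. i < m \<and> X i w \<in> ?I} (P w \<inter> ?I)"
            by simp
          have "(\<Sum>i<m. c i w * (2 * real (if i < m then R w (X i w) else 0) - d i w)) =
              (\<Sum>i\<in>{i. i < m \<and> X i w \<in> ?I}. \<theta> * (2 * real (R w (X i w)) - real (D w (X i w))))"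
            using elim(1) by (intro sum.mono_neutral_cong_right) (auto simp: c_def)
          also have "\<dots> = (\<Sum>x\<in>P w \<inter> ?I. \<theta> * (2 * real (R w x) - real (D w x)))"
            using bij by (rule sum.reindex_bij_betw)
          also have "\<dots> = \<theta> * (\<Sum>x\<in>P w \<inter> ?I. 2 * real (R w x) - real (D w x))"
            by (simp add: sum_distrib_left)
          finally have sum: "(\<Sum>i<m. c i w * (2 * real (if i < m then R w (X i w) else 0) - d i w)) =
              \<theta> * (\<Sum>x\<in>P w \<inter> ?I. 2 * real (R w x) - real (D w x))" .
          have "finite (P w \<inter> ?I)"
            by (rule finite_subset[of _ "P w \<inter> {0..real n}"]) (use elim(4) in auto)
          then have "ennreal \<bar>\<Sum>x\<in>P w \<inter> ?I. 2 * real (R w x) - real (D w x)\<bar> \<le> npts (E w) (crossing n)"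
            by (rule imbalance_le_crossing) (use elim(3) in auto)
          then have "ennreal \<theta> * ennreal \<bar>\<Sum>x\<in>P w \<inter> ?I. 2 * real (R w x) - real (D w x)\<bar> \<le> ennreal \<theta> * npts (E w) (crossing n)"
            by (rule mult_left_mono) simp
          moreover have "ennreal (1 - cos (\<theta> * (\<Sum>x\<in>P w \<inter> ?I. 2 * real (R w x) - real (D w x)))) \<le>
              ennreal \<theta> * ennreal \<bar>\<Sum>x\<in>P w \<inter> ?I. 2 * real (R w x) - real (D w x)\<bar>"
            using one_minus_cos_le[of "\<theta> * (\<Sum>x\<in>P w \<inter> ?I. 2 * real (R w x) - real (D w x))"] \<theta>
            by (subst ennreal_mult[symmetric]) (auto intro!: ennreal_leI simp: abs_mult)
          ultimately show ?thesis
            unfolding h_def sum using True by simp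
        qed (simp add: h_def)
      qed
    qed
    finally show ?thesis .
  qed
  have meas: "\<phi> m \<in> borel_measurable M" for m
  proof -
    have "cos \<theta> ^ card {i. i < m \<and> X i w \<in> ?I} = (\<Prod>i<m. if X i w \<in> ?I then cos \<theta> else 1)" for w
      by (simp add: prod.If_cases Int_def)
    then have "\<phi> m \<in> borel_measurable F_marked" unfolding \<phi>_def by simp
    then show ?thesis by (rule measurable_from_subalg[OF subalgebra_marked])
  qed
  have stable: "{i. i < m \<and> X i w \<in> ?I} = {i. X i w \<in> ?I}" if "w \<in> \<Omega> m" for m w
    using that by (auto simp: \<Omega>_def not_le[symmetric])
  have mono_\<Omega>: "w \<in> \<Omega> m'" if "w \<in> \<Omega> m" "m \<le> m'" for w m m'
    using that by (auto simp: \<Omega>_def)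
  have "(\<integral>\<^sup>+w. ennreal (1 - cos \<theta> ^ card (P w \<inter> ?I)) \<partial>M) \<le> (\<integral>\<^sup>+w. (SUP m. \<phi> m w) \<partial>M)"
  proof (rule nn_integral_mono_AE)
    show "AE w in M. ennreal (1 - cos \<theta> ^ card (P w \<inter> ?I)) \<le> (SUP m. \<phi> m w)"
      using X(2) poisson_locally_finite[OF poisson prob] AE_space
    proof eventually_elim
      case (elim w)
      have bij: "bij_betw (\<lambda>i. X i w) {i. X i w \<in> ?I} (P w \<inter> ?I)"
        using elim(1) by (rule bij_betw_vimage_Int)
      moreover have "finite (P w \<inter> ?I)"
        by (rule finite_subset[of _ "P w \<inter> {0..real n}"]) (use elim(2) in auto)
      ultimately have "finite {i. X i w \<in> ?I}" by (simp add: bij_betw_finite)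
      then obtain m where "{i. X i w \<in> ?I} \<subseteq> {..<m}" using finite_nat_iff_bounded by blast
      then have m: "w \<in> \<Omega> m" using elim(3) by (auto simp: \<Omega>_def space_F)
      then have "\<phi> m w = ennreal (1 - cos \<theta> ^ card (P w \<inter> ?I))"
        unfolding \<phi>_def stable[OF m] bij_betw_same_card[OF bij] by simp
      then show ?case by (metis SUP_upper UNIV_I)
    qed
  qed
  also have "\<dots> = (SUP m. \<integral>\<^sup>+w. \<phi> m w \<partial>M)"
  proof (rule nn_integral_monotone_convergence_SUP)
    show "incseq \<phi>"
    proof (rule incseq_SucI, rule le_funI)
      fix m w
      show "\<phi> m w \<le> \<phi> (Suc m) w"
      proof (cases "w \<in> \<Omega> m")
        case True
        then show ?thesis
          using mono_\<Omega>[OF True, of "Suc m"] unfolding \<phi>_def by (simp only: stable indicator_simps le_SucI order_refl)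
      qed (simp add: \<phi>_def)
    qed
  qed (rule meas)
  also have "\<dots> \<le> (\<integral>\<^sup>+w. ennreal \<theta> * npts (E w) (crossing n) \<partial>M)"
    by (rule SUP_least) (rule bound)
  finally show ?thesis .
qed

section \<open>Long edges and the Palm version\<close>

definition long_edges :: "real \<Rightarrow> real \<Rightarrow> real uprod set" where
  "long_edges k s = {e. \<exists>x y. e = Upair x y \<and> k \<le> x \<and> x < k + 1 \<and> s < \<bar>x - y\<bar>}"

definition star :: "real \<Rightarrow> real uprod set" where
  "star s = {e. \<exists>y. e = Upair 0 y \<and> s < \<bar>y\<bar>}"

lemma Upair_in_long_edges:
  "Upair x y \<in> long_edges k s \<longleftrightarrow> (k \<le> x \<and> x < k + 1 \<or> k \<le> y \<and> y < k + 1) \<and> s < \<bar>x - y\<bar>"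
  (is "?l \<longleftrightarrow> ?r")
proof
  show "?l \<Longrightarrow> ?r" by (auto simp: long_edges_def abs_minus_commute)
  assume ?r
  then consider "k \<le> x" "x < k + 1" "s < \<bar>x - y\<bar>" | "k \<le> y" "y < k + 1" "s < \<bar>y - x\<bar>"
    by (auto simp: abs_minus_commute)
  then show ?l
  proof cases
    case 1
    then show ?thesis unfolding long_edges_def by blast
  next
    case 2
    moreover have "Upair x y = Upair y x" by simp
    ultimately show ?thesis unfolding long_edges_def by blast
  qed
qed

lemma Upair_in_star: "Upair x y \<in> star s \<longleftrightarrow> (x = 0 \<and> s < \<bar>y\<bar> \<or> y = 0 \<and> s < \<bar>x\<bar>)"
  unfolding star_def by auto

lemma Upair_in_crossing: "Upair x y \<in> crossing n \<longleftrightarrow> (x \<in> {0..<real n} \<longleftrightarrow> y \<notin> {0..<real n})"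
  unfolding crossing_def by auto

lemma long_edges_sets [measurable]: "long_edges k s \<in> sets upair_algebra"
  by (rule sets_upair_algebraI) (simp add: Upair_in_long_edges)

lemma star_sets [measurable]: "star s \<in> sets upair_algebra"
  by (rule sets_upair_algebraI) (simp add: Upair_in_star)

lemma crossing_sets [measurable]: "crossing n \<in> sets upair_algebra"
  by (rule sets_upair_algebraI) (simp add: Upair_in_crossing)

definition edge_tail :: "real \<Rightarrow> ennreal" where
  "edge_tail s = (\<integral>\<^sup>+w. npts (E w) (long_edges 0 s) \<partial>M)"

lemma inj_map_uprod_shift: "inj (map_uprod (\<lambda>x :: real. x + t))"
  by (rule uprod.inj_map) (auto simp: inj_on_def)

text \<open>
  The count is a functional of the matching alone, whose law is invariant under shifts.
\<close>

lemma long_edges_stationary: "(\<integral>\<^sup>+w. npts (E w) (long_edges k s) \<partial>M) = edge_tail s"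
proof -
  have vimage_sets: "map_uprod (\<lambda>x. x + t) -` A \<in> sets upair_algebra" if "A \<in> sets upair_algebra" for t A
  proof -
    have "map_uprod (\<lambda>x. x + t) \<in> upair_algebra \<rightarrow>\<^sub>M upair_algebra"
      by (rule measurable_from_upair) simp
    then have "map_uprod (\<lambda>x. x + t) -` A \<inter> space upair_algebra \<in> sets upair_algebra"
      using that by (rule measurable_sets)
    then show ?thesis by simp
  qed
  have "shift_edges t \<in> config_algebra upair_algebra \<rightarrow>\<^sub>M config_algebra upair_algebra" for t
    unfolding shift_edges_def
    by (rule measurable_config_algebraI)
      (auto simp: npts_image[OF inj_on_subset[OF inj_map_uprod_shift]] intro!: measurable_npts vimage_sets)
  then have [measurable]: "(\<lambda>w. shift_edges t (E w)) \<in> M \<rightarrow>\<^sub>M config_algebra upair_algebra" for t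
    using measurable_E by (rule measurable_compose[rotated])
  have "edge_tail s = (\<integral>\<^sup>+G. npts G (long_edges 0 s) \<partial>distr M (config_algebra upair_algebra) E)"
    unfolding edge_tail_def by (subst nn_integral_distr) auto
  also have "distr M (config_algebra upair_algebra) E =
      distr M (config_algebra upair_algebra) (\<lambda>w. shift_edges (- k) (E w))"
    using matching unfolding random_direction_stable_multimatching_def matching_scheme_def by metis
  also have "(\<integral>\<^sup>+G. npts G (long_edges 0 s) \<partial>distr M (config_algebra upair_algebra) (\<lambda>w. shift_edges (- k) (E w))) =
      (\<integral>\<^sup>+w. npts (shift_edges (- k) (E w)) (long_edges 0 s) \<partial>M)"
    by (subst nn_integral_distr) auto
  also have "\<dots> = (\<integral>\<^sup>+w. npts (E w) (long_edges k s) \<partial>M)"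
  proof (rule nn_integral_cong)
    fix w
    have "map_uprod (\<lambda>x. x + - k) -` long_edges 0 s = long_edges k s"
    proof (rule set_eqI)
      fix e
      show "e \<in> map_uprod (\<lambda>x. x + - k) -` long_edges 0 s \<longleftrightarrow> e \<in> long_edges k s"
        by (cases e) (auto simp: Upair_in_long_edges)
    qed
    then show "npts (shift_edges (- k) (E w)) (long_edges 0 s) = npts (E w) (long_edges k s)"
      unfolding shift_edges_def by (simp only: npts_image[OF inj_on_subset[OF inj_map_uprod_shift]] subset_UNIV)
  qed
  finally show ?thesis ..
qed

text \<open>
  An edge from \<open>[k, k + 1)\<close> to a point outside \<open>[0, n)\<close> is longer than \<open>k\<close> if it goes to the left, and
  longer than \<open>n - 1 - k\<close> if it goes to the right. Each of these bounds takes every value below \<open>n\<close> once.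
\<close>

lemma crossing_le_sum_edge_tail: "(\<integral>\<^sup>+w. npts (E w) (crossing n) \<partial>M) \<le> 2 * (\<Sum>m<n. edge_tail (real m))"
proof -
  \<comment> \<open>a lower bound for the distance from \<open>[k, k + 1)\<close> to the complement of \<open>[0, n)\<close>\<close>
  define s where "s k = min (real k) (real (n - Suc k))" for k
  have "crossing n \<subseteq> (\<Union>k<n. long_edges (real k) (s k))"
  proof
    fix e assume "e \<in> crossing n"
    then obtain x y where e: "e = Upair x y" "0 \<le> x" "x < real n" "y < 0 \<or> real n \<le> y"
      by (auto simp: crossing_def)
    define k where "k = nat \<lfloor>x\<rfloor>"
    have k: "real k \<le> x" "x < real k + 1" unfolding k_def using e(2) by linarith+
    then have kn: "k < n" using e(3) by linarith
    have "s k < \<bar>x - y\<bar>"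
      using e(4) k e(2) kn unfolding s_def by (auto simp: of_nat_diff min_def)
    then show "e \<in> (\<Union>k<n. long_edges (real k) (s k))"
      using kn k e(1) by (intro UN_I[of k]) (auto simp: Upair_in_long_edges)
  qed
  then have "npts (E w) (crossing n) \<le> (\<Sum>k<n. npts (E w) (long_edges (real k) (s k)))" for w
    by (intro npts_UN_finite_le) auto
  then have "(\<integral>\<^sup>+w. npts (E w) (crossing n) \<partial>M) \<le> (\<integral>\<^sup>+w. (\<Sum>k<n. npts (E w) (long_edges (real k) (s k))) \<partial>M)"
    by (intro nn_integral_mono)
  also have "\<dots> = (\<Sum>k<n. edge_tail (s k))"
    by (subst nn_integral_sum) (auto simp: long_edges_stationary)
  also have "\<dots> \<le> (\<Sum>k<n. edge_tail (real k) + edge_tail (real (n - Suc k)))"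
    by (rule sum_mono) (auto simp: s_def min_def add_increasing add_increasing2)
  also have "\<dots> = 2 * (\<Sum>m<n. edge_tail (real m))"
    unfolding sum.distrib sum.nat_diff_reindex[of "\<lambda>m. edge_tail (real m)"] by (simp add: mult_2)
  finally show ?thesis .
qed

text \<open>
  Each long edge with an end in \<open>[0, 1)\<close> is counted at that end; edges with both ends there are counted
  twice on the right-hand side.
\<close>

lemma edge_tail_le_palm: "edge_tail s \<le> (\<integral>\<^sup>+c. npts (snd (snd c)) (star s) \<partial>palm M P D E)"
proof -
  obtain X :: "nat \<Rightarrow> 'w \<Rightarrow> real" where X': "AE w in M. bij_betw (\<lambda>i. X i w) UNIV (P w)"
    "\<forall>g\<in>borel_measurable matched_algebra.
      (\<integral>\<^sup>+c. g c \<partial>palm M P D E) = (\<integral>\<^sup>+w. (\<Sum>i. indicator {0..<1} (X i w) *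
         g (shift_matched (- X i w) (P w, marked_points P D w, E w))) \<partial>M)"
    using palm_campbell by (elim exE conjE) (rule that, assumption+)
  note X = X'(1) X'(2)[rule_format]
  have "(\<lambda>c. npts (snd (snd c)) (star s)) \<in> borel_measurable matched_algebra"
    unfolding matched_algebra_def by measurable
  note X(2)[OF this]
  moreover have "edge_tail s \<le> (\<integral>\<^sup>+w. (\<Sum>i. indicator {0..<1} (X i w) *
         npts (snd (snd (shift_matched (- X i w) (P w, marked_points P D w, E w)))) (star s)) \<partial>M)"
    unfolding edge_tail_def
  proof (rule nn_integral_mono_AE)
    show "AE w in M. npts (E w) (long_edges 0 s) \<le> (\<Sum>i. indicator {0..<1} (X i w) *
         npts (snd (snd (shift_matched (- X i w) (P w, marked_points P D w, E w)))) (star s))"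
      using X(1) matching_structure
    proof eventually_elim
      case (elim w)
      define B where "B i = (if X i w \<in> {0..<1} then map_uprod (\<lambda>x. x + - X i w) -` star s else {})" for i
      have "E w \<inter> long_edges 0 s \<subseteq> (\<Union>i. E w \<inter> B i)"
      proof
        fix e assume e: "e \<in> E w \<inter> long_edges 0 s"
        then obtain x y where xy: "e = Upair x y" "0 \<le> x" "x < 1" "s < \<bar>x - y\<bar>"
          by (auto simp: long_edges_def)
        have "x \<in> P w" using e xy elim(2) by force
        then have "x \<in> range (\<lambda>i. X i w)" using bij_betw_imp_surj_on[OF elim(1)] by simp
        then obtain i where i: "X i w = x" by blast
        then have "e \<in> B i" using xy by (auto simp: B_def Upair_in_star abs_minus_commute)
        then show "e \<in> (\<Union>i. E w \<inter> B i)" using e by blast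
      qed
      then have "npts (E w) (long_edges 0 s) \<le> (\<Sum>i. npts (E w) (B i))" by (rule npts_UN_le)
      moreover have "npts (E w) (B i) = indicator {0..<1} (X i w) *
         npts (snd (snd (shift_matched (- X i w) (P w, marked_points P D w, E w)))) (star s)" for i
        unfolding shift_matched_def prod.case snd_conv shift_edges_def B_def
          npts_image[OF inj_on_subset[OF inj_map_uprod_shift subset_UNIV]]
        by (cases "X i w \<in> {0..<1}")
          (simp_all only: indicator_simps if_True if_False mult_1 mult_zero_left npts_def Int_empty_right emeasure_empty not_False_eq_True)
      ultimately show ?case by (simp only:)
    qed
  qed
  ultimately show ?thesis by simp
qed

text \<open>
  With the bound \<open>-1\<close> on the length, the star contains all edges at the origin, and its count is the degree.
\<close>

lemma palm_degree_bounded: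
  assumes b: "\<And>d. d \<in> set_pmf \<mu> \<Longrightarrow> d \<le> b"
  shows "AE c in palm M P D E. finite (nbrs (snd (snd c)) 0) \<and> card (nbrs (snd (snd c)) 0) \<le> b"
proof -
  obtain X :: "nat \<Rightarrow> 'w \<Rightarrow> real" where X': "AE w in M. bij_betw (\<lambda>i. X i w) UNIV (P w)"
    "\<forall>g\<in>borel_measurable matched_algebra.
      (\<integral>\<^sup>+c. g c \<partial>palm M P D E) = (\<integral>\<^sup>+w. (\<Sum>i. indicator {0..<1} (X i w) *
         g (shift_matched (- X i w) (P w, marked_points P D w, E w))) \<partial>M)"
    using palm_campbell by (elim exE conjE) (rule that, assumption+)
  note X = X'(1) X'(2)[rule_format]
  have count: "npts G (star (- 1)) = emeasure (count_space UNIV) (nbrs G 0)" for G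
  proof -
    have "G \<inter> star (- 1) = Upair 0 ` nbrs G 0"
      by (auto simp: star_def nbrs_def)
    then have "npts G (star (- 1)) = npts (Upair 0 ` nbrs G 0) UNIV" by (simp add: npts_def)
    also have "\<dots> = npts (nbrs G 0) UNIV" by (subst npts_image) (auto simp: inj_on_def)
    finally show ?thesis by (simp add: npts_def)
  qed
  have bad_iff: "\<not> of_nat b < npts G (star (- 1)) \<longleftrightarrow> finite (nbrs G 0) \<and> card (nbrs G 0) \<le> b" for G
    unfolding count by (cases "finite (nbrs G 0)") (auto simp: emeasure_count_space of_nat_less_top not_less)
  let ?g = "\<lambda>c. indicator {n. of_nat b < n} (npts (snd (snd c)) (star (- 1))) :: ennreal"
  have g: "?g \<in> borel_measurable matched_algebra"
    unfolding matched_algebra_def by measurable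
  have "(\<integral>\<^sup>+c. ?g c \<partial>palm M P D E) = (\<integral>\<^sup>+w. 0 \<partial>M)"
    unfolding X(2)[OF g]
  proof (rule nn_integral_cong_AE)
    show "AE w in M. (\<Sum>i. indicator {0..<1} (X i w) *
         ?g (shift_matched (- X i w) (P w, marked_points P D w, E w))) = 0"
      using X(1) matching_structure degree_in_support
    proof eventually_elim
      case (elim w)
      have "?g (shift_matched (- X i w) (P w, marked_points P D w, E w)) = 0" for i
      proof -
        have Xi: "X i w \<in> P w" using elim(1) by (auto simp: bij_betw_def)
        have "nbrs (shift_edges (- X i w) (E w)) 0 = (\<lambda>y. y + - X i w) ` nbrs (E w) (X i w)"
        proof (intro equalityI subsetI)
          fix y assume "y \<in> nbrs (shift_edges (- X i w) (E w)) 0"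
          then obtain e where e: "e \<in> E w" "map_uprod (\<lambda>x. x + - X i w) e = Upair 0 y"
            by (auto simp: nbrs_def shift_edges_def)
          have "map_uprod (\<lambda>x. x + - X i w) e = map_uprod (\<lambda>x. x + - X i w) (Upair (X i w) (y + X i w))"
            using e(2) by simp
          then have "e = Upair (X i w) (y + X i w)"
            by (rule injD[OF inj_map_uprod_shift])
          then show "y \<in> (\<lambda>y. y + - X i w) ` nbrs (E w) (X i w)"
            using e(1) by (intro image_eqI[of _ _ "y + X i w"]) (auto simp: nbrs_def)
        next
          fix y assume "y \<in> (\<lambda>y. y + - X i w) ` nbrs (E w) (X i w)"
          then obtain z where z: "Upair (X i w) z \<in> E w" "y = z + - X i w" by (auto simp: nbrs_def)
          then show "y \<in> nbrs (shift_edges (- X i w) (E w)) 0"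
            unfolding nbrs_def shift_edges_def mem_Collect_eq
            by (intro image_eqI[OF _ z(1)]) simp
        qed
        moreover have "finite (nbrs (E w) (X i w))" "card (nbrs (E w) (X i w)) \<le> b"
          using elim(2,3) Xi b by auto
        ultimately have "finite (nbrs (shift_edges (- X i w) (E w)) 0)"
            "card (nbrs (shift_edges (- X i w) (E w)) 0) \<le> b"
          using card_image_le[of "nbrs (E w) (X i w)" "\<lambda>y. y + - X i w"] by auto
        then have "\<not> of_nat b < npts (shift_edges (- X i w) (E w)) (star (- 1))"
          using bad_iff by blast
        then show ?thesis by (simp add: shift_matched_def)
      qed
      then show ?case by simp
    qed
  qed
  moreover have "?g \<in> borel_measurable (palm M P D E)"
    using g by (simp only: measurable_cong_sets[OF sets_palm refl])
  ultimately have "AE c in palm M P D E. ?g c = 0"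
    by (simp only: nn_integral_0_iff_AE nn_integral_const mult_zero_left)
  then show ?thesis
    by eventually_elim (use bad_iff in \<open>auto simp: indicator_def split: if_splits\<close>)
qed

lemma palm_total: "(\<integral>\<^sup>+c. 1 \<partial>palm M P D E) = 1"
proof -
  obtain X :: "nat \<Rightarrow> 'w \<Rightarrow> real" where X': "AE w in M. bij_betw (\<lambda>i. X i w) UNIV (P w)"
    "\<forall>g\<in>borel_measurable matched_algebra.
      (\<integral>\<^sup>+c. g c \<partial>palm M P D E) = (\<integral>\<^sup>+w. (\<Sum>i. indicator {0..<1} (X i w) *
         g (shift_matched (- X i w) (P w, marked_points P D w, E w))) \<partial>M)"
    using palm_campbell by (elim exE conjE) (rule that, assumption+)
  note X = X'(1) X'(2)[rule_format]
  have "(\<integral>\<^sup>+c. 1 \<partial>palm M P D E) = (\<integral>\<^sup>+w. (\<Sum>i. indicator {0..<1} (X i w)) \<partial>M)"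
    using X(2)[of "\<lambda>_. 1"] by simp
  also have "\<dots> = (\<integral>\<^sup>+w. npts (P w) {0..<1} \<partial>M)"
  proof (rule nn_integral_cong_AE)
    show "AE w in M. (\<Sum>i. indicator {0..<1} (X i w)) = npts (P w) {0..<1}"
      using X(1)
    proof eventually_elim
      case (elim w)
      show ?case using npts_enum[OF elim, of "\<lambda>_. True" "{0..<1}"]
        by (simp only: simp_thms Collect_mem_eq)
    qed
  qed
  finally show ?thesis by (simp add: poisson_intensity)
qed

lemma npts_star:
  assumes fin: "finite (nbrs G 0)"
  shows "npts G (star s) = (\<Sum>y\<in>nbrs G 0. of_bool (s < \<bar>y\<bar>))"
proof -
  have "G \<inter> star s = Upair 0 ` {y \<in> nbrs G 0. s < \<bar>y\<bar>}"
    by (auto simp: star_def nbrs_def)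
  then have "npts G (star s) = npts (Upair 0 ` {y \<in> nbrs G 0. s < \<bar>y\<bar>}) UNIV" by (simp add: npts_def)
  also have "\<dots> = npts {y \<in> nbrs G 0. s < \<bar>y\<bar>} UNIV" by (subst npts_image) (auto simp: inj_on_def)
  also have "\<dots> = of_nat (card {y \<in> nbrs G 0. s < \<bar>y\<bar>})" using fin by (simp add: npts_finite)
  also have "\<dots> = (\<Sum>y\<in>nbrs G 0. of_bool (s < \<bar>y\<bar>))" using fin by (simp add: Int_def)
  finally show ?thesis .
qed

text \<open>
  A neighbour at distance \<open>l\<close> is counted by the stars of radius \<open>s < l\<close>, with total weight at most \<open>2 \<surd>l\<close>.
  Every \<open>l\<close> is at most the sum of all lengths at the origin, which is at most \<open>b\<close> times their average.
\<close>

lemma star_counts_le_avg_length: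
  assumes fin: "finite (nbrs G 0)" and card: "card (nbrs G 0) \<le> b"
  shows "(\<Sum>n. ennreal (1 / sqrt (real (Suc n))) * npts G (star (real (Suc n)))) \<le>
    ennreal (2 * real b * sqrt (real b)) * ennreal (avg_edge_length G 0 powr (1/2))"
proof -
  let ?N = "nbrs G 0"
  note count = npts_star[OF fin]
  have "(\<Sum>n. ennreal (1 / sqrt (real (Suc n))) * npts G (star (real (Suc n)))) =
      (\<Sum>n. \<Sum>y\<in>?N. ennreal (1 / sqrt (real (Suc n)) * of_bool (real (Suc n) < \<bar>y\<bar>)))"
    unfolding count sum_distrib_left by (intro suminf_cong sum.cong) auto
  also have "\<dots> = (\<Sum>y\<in>?N. \<Sum>n. ennreal (1 / sqrt (real (Suc n)) * of_bool (real (Suc n) < \<bar>y\<bar>)))"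
    by (rule suminf_sum) simp
  also have "\<dots> \<le> (\<Sum>y\<in>?N. ennreal (2 * sqrt \<bar>y\<bar>))"
  proof (rule sum_mono)
    fix y
    show "(\<Sum>n. ennreal (1 / sqrt (real (Suc n)) * of_bool (real (Suc n) < \<bar>y\<bar>))) \<le> ennreal (2 * sqrt \<bar>y\<bar>)"
    proof (rule suminf_le_const)
      fix N
      have "(\<Sum>n<N. ennreal (1 / sqrt (real (Suc n)) * of_bool (real (Suc n) < \<bar>y\<bar>))) =
          ennreal (\<Sum>n<N. 1 / sqrt (real (Suc n)) * of_bool (real (Suc n) < \<bar>y\<bar>))"
        by (rule sum_ennreal) simp
      also have "\<dots> \<le> ennreal (2 * sqrt \<bar>y\<bar>)"
        by (rule ennreal_leI, rule sum_inverse_sqrt_le) simp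
      finally show "(\<Sum>n<N. ennreal (1 / sqrt (real (Suc n)) * of_bool (real (Suc n) < \<bar>y\<bar>))) \<le> ennreal (2 * sqrt \<bar>y\<bar>)" .
    qed simp
  qed
  also have "\<dots> = ennreal (\<Sum>y\<in>?N. 2 * sqrt \<bar>y\<bar>)" by (rule sum_ennreal) simp
  also have "\<dots> \<le> ennreal (2 * real b * sqrt (real b) * (avg_edge_length G 0 powr (1/2)))"
  proof (rule ennreal_leI)
    define L where "L = (\<Sum>y\<in>?N. \<bar>y\<bar>)"
    have L: "0 \<le> L" unfolding L_def by (rule sum_nonneg) simp
    have avg: "0 \<le> avg_edge_length G 0" "L \<le> real b * avg_edge_length G 0"
    proof -
      have eq: "avg_edge_length G 0 = L / real (card ?N)" by (simp add: avg_edge_length_def L_def)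
      then show nn: "0 \<le> avg_edge_length G 0" using L by simp
      have "L = real (card ?N) * avg_edge_length G 0"
        using fin unfolding eq by (cases "?N = {}") (auto simp: L_def)
      also have "\<dots> \<le> real b * avg_edge_length G 0" using card nn by (intro mult_right_mono) auto
      finally show "L \<le> real b * avg_edge_length G 0" .
    qed
    have "(\<Sum>y\<in>?N. 2 * sqrt \<bar>y\<bar>) \<le> (\<Sum>y\<in>?N. 2 * sqrt L)"
    proof (rule sum_mono)
      fix y assume "y \<in> ?N"
      then have "\<bar>y\<bar> \<le> L" unfolding L_def using fin by (intro member_le_sum) auto
      then show "2 * sqrt \<bar>y\<bar> \<le> 2 * sqrt L" by simp
    qed
    also have "\<dots> = real (card ?N) * (2 * sqrt L)" by simp
    also have "\<dots> \<le> real b * (2 * sqrt (real b * avg_edge_length G 0))"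
      using card avg L by (intro mult_mono) auto
    also have "\<dots> = 2 * real b * sqrt (real b) * (avg_edge_length G 0 powr (1/2))"
      using avg by (simp add: real_sqrt_mult powr_half_sqrt)
    finally show "(\<Sum>y\<in>?N. 2 * sqrt \<bar>y\<bar>) \<le> 2 * real b * sqrt (real b) * (avg_edge_length G 0 powr (1/2))" .
  qed
  also have "\<dots> = ennreal (2 * real b * sqrt (real b)) * ennreal (avg_edge_length G 0 powr (1/2))"
    by (rule ennreal_mult) auto
  finally show ?thesis .
qed

text \<open>
  If the integral were finite, so would be that of \<open>g / C\<close>, which lies below the integrand by
  \<open>star_counts_le_avg_length\<close>. Integrated term by term, \<open>g\<close> dominates the sum of the intensities of
  edges longer than \<open>n\<close>, weighted by \<open>1 / \<surd>n\<close>, and this contradicts the growth of the number of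
  crossing edges.
\<close>

theorem infinite_half_moment:
  assumes b: "\<And>d. d \<in> set_pmf \<mu> \<Longrightarrow> d \<le> b"
  shows "(\<integral>\<^sup>+c. ennreal (avg_edge_length (snd (snd c)) 0 powr (1/2)) \<partial>palm M P D E) = \<infinity>"
proof (rule ccontr)
  let ?f = "\<lambda>c. ennreal (avg_edge_length (snd (snd c)) 0 powr (1/2))"
  let ?Q = "palm M P D E"
  assume "\<not> ?thesis"
  then have fin: "(\<integral>\<^sup>+c. ?f c \<partial>?Q) < \<infinity>" by (simp add: less_top)
  obtain d where "d \<in> set_pmf \<mu>" using set_pmf_not_empty[of \<mu>] by blast
  then have "1 \<le> b" using b[of d] zero_notin by (cases d) auto
  have degree: "AE c in ?Q. finite (nbrs (snd (snd c)) 0) \<and> card (nbrs (snd (snd c)) 0) \<le> b"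
    by (rule palm_degree_bounded) (rule b)
  define C where "C = 2 * real b * sqrt (real b)"
  have C: "0 < C" using \<open>1 \<le> b\<close> by (simp add: C_def)
  define g where "g c = (\<Sum>n. ennreal (1 / sqrt (real (Suc n))) * npts (snd (snd c)) (star (real (Suc n))))"
    for c :: matched_config
  have count [measurable]: "(\<lambda>c. npts (snd (snd c)) (star s)) \<in> borel_measurable ?Q" for s
  proof -
    have "(\<lambda>c. npts (snd (snd c)) (star s)) \<in> borel_measurable matched_algebra"
      unfolding matched_algebra_def by measurable
    then show ?thesis by (simp only: measurable_cong_sets[OF sets_palm refl])
  qed
  have g [measurable]: "g \<in> borel_measurable ?Q" unfolding g_def by measurable
  have "ennreal (1 / C) * (\<integral>\<^sup>+c. g c \<partial>?Q) = (\<integral>\<^sup>+c. ennreal (1 / C) * g c \<partial>?Q)"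
    by (rule nn_integral_cmult[symmetric]) measurable
  also have "\<dots> \<le> (\<integral>\<^sup>+c. ?f c \<partial>?Q)"
  proof (rule nn_integral_mono_AE)
    show "AE c in ?Q. ennreal (1 / C) * g c \<le> ?f c"
      using degree
    proof eventually_elim
      case (elim c)
      then have "ennreal (1 / C) * g c \<le> ennreal (1 / C) * (ennreal C * ?f c)"
        unfolding g_def C_def by (intro mult_left_mono star_counts_le_avg_length) auto
      also have "\<dots> = ?f c"
        using C by (simp add: mult.assoc[symmetric] flip: ennreal_mult)
      finally show ?case .
    qed
  qed
  finally have "ennreal (1 / C) * (\<integral>\<^sup>+c. g c \<partial>?Q) < \<infinity>" using fin by (rule order_le_less_trans)
  then have g_fin: "(\<integral>\<^sup>+c. g c \<partial>?Q) < \<infinity>"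
    using C by (auto simp: ennreal_mult_less_top)
  have "(\<Sum>n. ennreal (1 / sqrt (real (Suc n))) * edge_tail (real (Suc n))) \<le>
      (\<Sum>n. ennreal (1 / sqrt (real (Suc n))) * (\<integral>\<^sup>+c. npts (snd (snd c)) (star (real (Suc n))) \<partial>?Q))"
    by (intro suminf_le mult_left_mono edge_tail_le_palm) auto
  also have "\<dots> = (\<integral>\<^sup>+c. g c \<partial>?Q)"
    unfolding g_def by (simp add: nn_integral_suminf nn_integral_cmult)
  finally have sum_fin: "(\<Sum>n. ennreal (1 / sqrt (real (Suc n))) * edge_tail (real (Suc n))) < \<infinity>"
    using g_fin by (rule order_le_less_trans)
  have intensity_fin: "edge_tail (real n) < top" for n
  proof (cases n)
    case 0
    have "edge_tail 0 \<le> (\<integral>\<^sup>+c. npts (snd (snd c)) (star 0) \<partial>?Q)" by (rule edge_tail_le_palm)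
    also have "\<dots> \<le> (\<integral>\<^sup>+c. of_nat b * 1 \<partial>?Q)"
    proof (rule nn_integral_mono_AE)
      show "AE c in ?Q. npts (snd (snd c)) (star 0) \<le> of_nat b * 1"
        using degree
      proof eventually_elim
        case (elim c)
        have "npts (snd (snd c)) (star 0) \<le> (\<Sum>y\<in>nbrs (snd (snd c)) 0. 1)"
          unfolding npts_star[OF elim[THEN conjunct1]] by (rule sum_mono) simp
        also have "\<dots> \<le> of_nat b" using elim by simp
        finally show ?case by simp
      qed
    qed
    also have "\<dots> = of_nat b * (\<integral>\<^sup>+c. 1 \<partial>?Q)" by (rule nn_integral_cmult) simp
    also have "\<dots> < top" unfolding palm_total by (simp add: of_nat_less_top)
    finally show ?thesis using 0 by simp
  next
    case (Suc m)
    have "ennreal (1 / sqrt (real (Suc m))) * edge_tail (real (Suc m)) \<le>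
        (\<Sum>n. ennreal (1 / sqrt (real (Suc n))) * edge_tail (real (Suc n)))"
      using sum_le_suminf[of "\<lambda>n. ennreal (1 / sqrt (real (Suc n))) * edge_tail (real (Suc n))" "{m}"]
      by (simp del: of_nat_Suc)
    then have "ennreal (1 / sqrt (real (Suc m))) * edge_tail (real (Suc m)) < \<infinity>"
      using sum_fin by (rule order_le_less_trans)
    then show ?thesis unfolding Suc by (auto simp: ennreal_mult_less_top)
  qed
  define t where "t n = enn2real (edge_tail (real (Suc n)))" for n
  have t: "edge_tail (real (Suc n)) = ennreal (t n)" "0 \<le> t n" for n
    using intensity_fin[of "Suc n"] unfolding t_def by auto
  define t0 where "t0 = enn2real (edge_tail 0)"
  have t0: "edge_tail 0 = ennreal t0" "0 \<le> t0"
    using intensity_fin[of 0] unfolding t0_def by auto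
  have "(\<Sum>n. ennreal (t n / sqrt (real (Suc n)))) = (\<Sum>n. ennreal (1 / sqrt (real (Suc n))) * edge_tail (real (Suc n)))"
    unfolding t(1) using t(2) by (intro suminf_cong) (simp flip: ennreal_mult)
  then have summable: "summable (\<lambda>n. t n / sqrt (real (Suc n)))"
    using sum_fin t(2) by (intro summable_suminf_not_top) auto
  have lower: "(1 - exp (- 1 / 4)) * sqrt (real n) \<le> 2 * t0 + 2 * (\<Sum>m<n. t m)" if n: "1 \<le> n" for n
  proof -
    \<comment> \<open>of the order of the inverse standard deviation; it makes \<open>n (1 - cos \<theta>)\<close> at least \<open>1/4\<close>\<close>
    define \<theta> where "\<theta> = 1 / sqrt (real n)"
    have \<theta>: "0 < \<theta>" "\<theta> \<le> 1" "real n * \<theta>\<^sup>2 = 1"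
      using n by (auto simp: \<theta>_def power_divide)
    have cos: "0 \<le> cos \<theta>"
      using \<theta> pi_gt3 by (intro cos_ge_zero) auto
    have "1 / 4 = real n * (\<theta>\<^sup>2 / 4)" using \<theta> by simp
    also have "\<dots> \<le> real n * (1 - cos \<theta>)"
      using \<theta> by (intro mult_left_mono one_minus_cos_ge) auto
    finally have "1 - exp (- 1 / 4) \<le> 1 - exp (- real n * (1 - cos \<theta>))" by simp
    then have "ennreal (1 - exp (- 1 / 4)) \<le> ennreal (1 - exp (- real n * (1 - cos \<theta>)))" by (rule ennreal_leI)
    also have "\<dots> \<le> (\<integral>\<^sup>+w. ennreal \<theta> * npts (E w) (crossing n) \<partial>M)"
      unfolding poisson_laplace[OF cos cos_le_one, symmetric]
      by (rule crossing_lower_bound[OF _ \<theta>(1) cos]) (rule b)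
    also have "\<dots> = ennreal \<theta> * (\<integral>\<^sup>+w. npts (E w) (crossing n) \<partial>M)"
      by (rule nn_integral_cmult) measurable
    also have "\<dots> \<le> ennreal \<theta> * (2 * (edge_tail 0 + (\<Sum>m<n. edge_tail (real (Suc m)))))"
    proof (rule mult_left_mono)
      have "(\<Sum>m<n. edge_tail (real m)) \<le> (\<Sum>m<Suc n. edge_tail (real m))" by (rule sum_mono2) auto
      also have "\<dots> = edge_tail 0 + (\<Sum>m<n. edge_tail (real (Suc m)))" by (simp only: sum.lessThan_Suc_shift of_nat_0)
      finally have "2 * (\<Sum>m<n. edge_tail (real m)) \<le> 2 * (edge_tail 0 + (\<Sum>m<n. edge_tail (real (Suc m))))"
        by (rule mult_left_mono) simp
      then show "(\<integral>\<^sup>+w. npts (E w) (crossing n) \<partial>M) \<le> 2 * (edge_tail 0 + (\<Sum>m<n. edge_tail (real (Suc m))))"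
        using crossing_le_sum_edge_tail[of n] by (rule order_trans[rotated])
    qed simp
    also have "\<dots> = ennreal (\<theta> * (2 * (t0 + (\<Sum>m<n. t m))))"
    proof -
      have "(\<Sum>m<n. edge_tail (real (Suc m))) = ennreal (\<Sum>m<n. t m)"
        unfolding t(1) using t(2) by (intro sum_ennreal) simp
      moreover have "0 \<le> (\<Sum>m<n. t m)" using t(2) by (intro sum_nonneg) simp
      moreover have "2 = ennreal 2" by simp
      ultimately show ?thesis
        using t0 \<theta> by (simp only: ennreal_plus[symmetric] ennreal_mult[symmetric]) (simp add: ennreal_mult)
    qed
    finally have "1 - exp (- 1 / 4) \<le> \<theta> * (2 * (t0 + (\<Sum>m<n. t m)))"
      using t0 t(2) \<theta> by (subst (asm) ennreal_le_iff) (auto intro!: mult_nonneg_nonneg add_nonneg_nonneg sum_nonneg)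
    then have "(1 - exp (- 1 / 4)) * sqrt (real n) \<le> \<theta> * (2 * (t0 + (\<Sum>m<n. t m))) * sqrt (real n)"
      by (rule mult_right_mono) simp
    also have "\<dots> = 2 * t0 + 2 * (\<Sum>m<n. t m)"
      using n by (simp add: \<theta>_def)
    finally show ?thesis .
  qed
  show False
    by (rule no_sqrt_growth_if_summable[OF t(2) summable _ lower]) simp_all
qed

end

theorem theorem1p2:
  fixes M :: "'w measure"
    and P :: "'w \<Rightarrow> real set"
    and D R :: "'w \<Rightarrow> real \<Rightarrow> nat"
    and E :: "'w \<Rightarrow> real uprod set"
    and \<mu> :: "nat pmf"
  assumes "prob_space M"
    and "poisson_process M 1 P"
    and "0 \<notin> set_pmf \<mu>"
    and "degree_marks M P \<mu> D"
    and "random_direction_stable_multimatching M P D R E"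
  shows "(measure_pmf.prob \<mu> {2} = 1 \<longrightarrow>
            (AE w in M. \<not> (\<exists>x\<in>P w. infinite (component (P w) (E w) x)))) \<and>
         ((\<exists>b. \<forall>d\<in>set_pmf \<mu>. d \<le> b) \<longrightarrow>
            (\<integral>\<^sup>+ (S, Z, G). ennreal (avg_edge_length G 0 powr (1/2)) \<partial>palm M P D E) = \<infinity>)"
proof -
  interpret random_matching M P D R E \<mu>
    by (rule random_matching.intro) (use assms in simp_all)
  show ?thesis
  proof (intro conjI impI)
    assume "measure_pmf.prob \<mu> {2} = 1"
    then have "AE d in measure_pmf \<mu>. d \<in> {2}"
      by (subst (asm) measure_pmf.prob_eq_1) auto
    then have "set_pmf \<mu> = {2}"
      using set_pmf_not_empty[of \<mu>] by (auto simp: AE_measure_pmf_iff)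
    then show "AE w in M. \<not> (\<exists>x\<in>P w. infinite (component (P w) (E w) x))"
      by (rule no_infinite_component)
  next
    assume "\<exists>b. \<forall>d\<in>set_pmf \<mu>. d \<le> b"
    then obtain b where "\<And>d. d \<in> set_pmf \<mu> \<Longrightarrow> d \<le> b" by blast
    then have "(\<integral>\<^sup>+c. ennreal (avg_edge_length (snd (snd c)) 0 powr (1/2)) \<partial>palm M P D E) = \<infinity>"
      by (rule infinite_half_moment)
    then show "(\<integral>\<^sup>+ (S, Z, G). ennreal (avg_edge_length G 0 powr (1/2)) \<partial>palm M P D E) = \<infinity>"
      by (simp add: case_prod_beta')
  qed
qed

end
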